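(* Let $n$ be a positive integer, $1<p<n$ and $p^\star=\frac{np}{n-p}$. For every nontrivial $f\in L^{1,0}(\mathbb R^n)$, $$\omega_n^{1/n}\,\alpha_{n,p}\,|\langle f\rangle_p|^{\frac{n-p}{np}}\geq\left(\int_{\mathbb R^n}|f|^{p^\star}dx\right)^{1/p^\star},$$ where $$\alpha_{n,p}=n^{-1/p}\left(\frac{p-1}{n-p}\right)^{1-1/p}\left(\frac{\Gamma(n)}{\omega_n\Gamma(\frac np)\Gamma(n+1-\frac np)}\right)^{1/n}.$$
   Context: $\omega_n=\pi^{n/2}/\Gamma(1+\frac n2)$ is the volume of the Euclidean unit ball in $\mathbb R^n$ and $|\cdot|$ applied to a set is $n$-dimensional Lebesgue measure. $L^{1,0}(\mathbb R^n)$ is the space of piecewise affine functions: continuous $f:\mathbb R^n\to\mathbb R$ for which there are finitely many $n$-dimensional simplices $T_1,\dots,T_m\subset\mathbb R^n$ with pairwise disjoint interiors such that $f$ is affine on each $T_i$ and $f=0$ outside $T_1\cup\dots\cup T_m$. Nontrivial means not identically zero. $\mathcal P_0^n$ is the set of polytopes containing the origin in their interior. $h(K,x)=\max\{x\cdot y:y\in K\}$ is the support function, $S(K,\cdot)$ is the surface area measure of $K$ on $S^{n-1}$ ($S(K,\omega)$ is the $(n-1)$-dimensional Hausdorff measure of the set of boundary points of $K$ with an outer unit normal in $\omega$), and $dS_p(K,u)=h(K,u)^{1-p}dS(K,u)$. For nontrivial $f\in L^{1,0}(\mathbb R^n)$, $\langle f\rangle_p$ denotes the unique polytope in $\mathcal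 P_0^n$ (it exists for $1<p<\infty$, $p\neq n$) such that $$n\int_{\mathbb R^n}\Psi(-\nabla f(x))^p\,dx=\int_{S^{n-1}}\Psi(u)^p\,dS_p(\langle f\rangle_p,u)$$ for every continuous $\Psi:\mathbb R^n\to[0,\infty)$ with $\Psi(tx)=t\Psi(x)$ for all $t\geq0$. *)

theory Defs
  imports "HOL-Analysis.Analysis"
begin

definition piecewise_affine :: "('a::euclidean_space \<Rightarrow> real) \<Rightarrow> bool" where
  "piecewise_affine f \<longleftrightarrow> continuous_on UNIV f \<and>
     (\<exists>\<T>. finite \<T> \<and> (\<forall>T\<in>\<T>. int DIM('a) simplex T) \<and>
        pairwise (\<lambda>S T. interior S \<inter> interior T = {}) \<T> \<and>
        (\<forall>T\<in>\<T>. \<exists>a b. \<forall>x\<in>T. f x = a \<bullet> x + b) \<and>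
        (\<forall>x. x \<notin> \<Union>\<T> \<longrightarrow> f x = 0))"

text \<open>The value at a point where f is not differentiable is an arbitrary fixed vector. For
  piecewise affine f these points form a null set, so they do not affect integrals.\<close>

definition grad :: "('a::euclidean_space \<Rightarrow> real) \<Rightarrow> 'a \<Rightarrow> 'a" where
  "grad f x = (THE D. GDERIV f x :> D)"

definition origin_polytope :: "'a::euclidean_space set \<Rightarrow> bool" where
  "origin_polytope K \<longleftrightarrow> polytope K \<and> 0 \<in> interior K"

text \<open>For nonempty compact K the supremum is attained.\<close>

definition support_fun :: "'a::euclidean_space set \<Rightarrow> 'a \<Rightarrow> real" where
  "support_fun K x = (SUP y\<in>K. x \<bullet> y)"

text \<open>The k-dimensional Hausdorff measure, normalised to agree with Lebesgue measure when the ambient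
  dimension is k. Covering sets are required to be bounded because the library's diameter is
  meaningless otherwise; the empty set gets weight 0 also for k = 0, where 0 ^ 0 = 1.\<close>

definition hausdorff_weight :: "nat \<Rightarrow> 'a::metric_space set \<Rightarrow> ennreal" where
  "hausdorff_weight k U =
     (if U = {} then 0 else ennreal (unit_ball_vol (real k) * (diameter U / 2) ^ k))"

definition hausdorff_pre :: "nat \<Rightarrow> real \<Rightarrow> 'a::metric_space set \<Rightarrow> ennreal" where
  "hausdorff_pre k \<delta> A =
     (INF U \<in> {U :: nat \<Rightarrow> 'a set. A \<subseteq> (\<Union>i. U i) \<and> (\<forall>i. bounded (U i) \<and> diameter (U i) \<le> \<delta>)}.
        \<Sum>i. hausdorff_weight k (U i))"

definition hausdorff_measure :: "nat \<Rightarrow> 'a::metric_space set \<Rightarrow> ennreal" where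
  "hausdorff_measure k A = (SUP \<delta>\<in>{0<..}. hausdorff_pre k \<delta> A)"

definition outer_unit_normal :: "'a::euclidean_space set \<Rightarrow> 'a \<Rightarrow> 'a \<Rightarrow> bool" where
  "outer_unit_normal K x u \<longleftrightarrow> norm u = 1 \<and> (\<forall>y\<in>K. u \<bullet> (y - x) \<le> 0)"

text \<open>The set function below is countably additive on the Borel sets of the sphere when K is a convex
  body, as the boundary points with more than one outer unit normal are negligible. In that case it
  is the emeasure of the measure constructed here.\<close>

definition surface_area_measure :: "'a::euclidean_space set \<Rightarrow> 'a measure" where
  "surface_area_measure K =
     measure_of (sphere 0 1) (sets (restrict_space borel (sphere 0 1)))
       (\<lambda>\<omega>. hausdorff_measure (DIM('a) - 1) {x \<in> frontier K. \<exists>u\<in>\<omega>. outer_unit_normal K x u})"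

definition Lp_surface_area_measure :: "real \<Rightarrow> 'a::euclidean_space set \<Rightarrow> 'a measure" where
  "Lp_surface_area_measure p K =
     density (surface_area_measure K) (\<lambda>u. ennreal (support_fun K u powr (1 - p)))"

text \<open>K is the polytope usually written as f in angle brackets with subscript p. For nontrivial
  piecewise affine f and p > 1 different from the dimension, exactly one such K exists.\<close>

definition is_Lp_polytope_of :: "real \<Rightarrow> ('a::euclidean_space \<Rightarrow> real) \<Rightarrow> 'a set \<Rightarrow> bool" where
  "is_Lp_polytope_of p f K \<longleftrightarrow> origin_polytope K \<and>
     (\<forall>\<Psi> :: 'a \<Rightarrow> real.
        continuous_on UNIV \<Psi> \<and> (\<forall>x. 0 \<le> \<Psi> x) \<and> (\<forall>t\<ge>0. \<forall>x. \<Psi> (t *\<^sub>R x) = t * \<Psi> x) \<longrightarrow>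
        real DIM('a) * (LINT x|lebesgue. \<Psi> (- grad f x) powr p) =
          (LINT u|Lp_surface_area_measure p K. \<Psi> u powr p))"

definition sobolev_const :: "nat \<Rightarrow> real \<Rightarrow> real" where
  "sobolev_const n p =
     real n powr (- (1 / p)) * ((p - 1) / (real n - p)) powr (1 - 1 / p) *
     (Gamma (real n) /
        (unit_ball_vol (real n) * Gamma (real n / p) * Gamma (real n + 1 - real n / p)))
       powr (1 / real n)"

end

theory Submission
  imports Defs
begin

text \<open>
  Write \<open>h\<close> for the support function of \<open>K\<close>. Testing the identity that defines \<open>K\<close> against
  \<open>\<Psi> = h\<close> gives \<open>n \<integral> h(- grad f) powr p = \<integral> h dS\<close>, because \<open>h powr p\<close> cancels the weight \<open>h powr (1 - p)\<close>
  up to one factor. The right-hand side is \<open>n\<close> times the volume of \<open>K\<close>. Hence the energy of \<open>f\<close>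
  measured with \<open>h\<close> is the volume of \<open>K\<close>, and the claim becomes the sharp Sobolev inequality of
  Cordero-Erausquin, Nazaret and Villani for the (not necessarily symmetric) norm with unit
  ball \<open>K\<close>.

  For the first half only \<open>\<integral> h dS \<le> n |K|\<close> matters, so it suffices to bound the Hausdorff measure of
  a facet from above by the volume of the cone over it. This is done inside the n-dimensional
  space: cover the cone by small balls whose total volume is almost that of the cone, and slice
  at height \<open>\<tau>\<close>. Each slice of the cone is a scaled copy of the facet, covered by the disks in
  which the balls are cut, and the areas of these disks integrate over \<open>\<tau>\<close> to the volumes of the
  balls (\<open>cone_over_hausdorff_bound\<close>). Normals that are no facet normals only occur at points
  lying in two facets. Such points have Hausdorff measure 0 by the same estimate, as the cone over
  them lies in a hyperplane (\<open>nn_integral_support_surface_le\<close>).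

  The Sobolev inequality is proved by mass transport. With \<open>\<nu>\<close> the gauge of \<open>K\<close>, \<open>1/p + 1/q = 1\<close>
  and \<open>p'\<close> the Sobolev exponent, transport the density \<open>(max f 0) powr p'\<close> to the extremal density
  \<open>w = (1 + \<nu> powr q) powr (- n)\<close>. The argument rests on a
  transport map whose derivative has positive diagonal with product the quotient of the two
  densities. The triangular Knothe map \<open>T\<close>, built one coordinate at a time from monotone
  rearrangements of the line, has this property. The inequality of the arithmetic and geometric mean bounds
  \<open>div T\<close> from below by a power of that quotient, integration by parts along coordinate lines
  replaces \<open>div T\<close> by \<open>- grad f \<bullet> T\<close>, and \<open>- grad f \<bullet> T \<le> h(- grad f) * \<nu> T\<close> together with Hoelder's
  inequality leaves the energy of \<open>f\<close> and integrals of powers of \<open>1 + \<nu> powr q\<close>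
  (\<open>sobolev_cube_perturbed\<close>). All of this happens on a cube and with a small constant added to the
  density of the source. Then all densities, marginals and maps are continuous and both maps and
  partial derivatives exist everywhere. The constant tends to 0 and the cube to the whole space
  afterwards. A layer cake formula turns the remaining integrals into beta functions
  (\<open>nn_integral_profile\<close>), which gives the constant in \<open>sobolev_positive_part\<close>.

  That inequality sees the positive part of \<open>f\<close> only. It is applied to \<open>f\<close> with \<open>K\<close> and to \<open>- f\<close>
  with the reflection of \<open>K\<close>. The energies of the two parts add up, and since \<open>p \<le> p'\<close> so do the
  two inequalities.
\<close>

section \<open>Covering by balls and Hausdorff measure\<close>

text \<open>Slicing the unit ball of dimension \<open>m + 1\<close> into balls of dimension \<open>m\<close>.\<close>

lemma unit_ball_vol_Suc:
  "unit_ball_vol (real m) * Beta (1/2) (real m / 2 + 1) = unit_ball_vol (real (Suc m))"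
proof -
  have "Gamma (real m / 2 + 1) \<noteq> 0"
    using Gamma_real_pos[of "real m / 2 + 1"] by (smt (verit) divide_nonneg_pos of_nat_0_le_iff)
  moreover have "pi powr (real (Suc m) / 2) = pi powr (real m / 2) * sqrt pi"
    by (simp add: powr_half_sqrt [symmetric] powr_add [symmetric] add_divide_distrib add.commute)
  ultimately show ?thesis
    by (simp add: unit_ball_vol_def Beta_def Gamma_one_half_real field_simps)
qed

text \<open>The integrand is the area of the disk in which a hyperplane at height \<open>\<tau>\<close> cuts a ball of radius
  \<open>r\<close> centred at height \<open>c\<close>. Stating this for numbers makes it possible to speak about slices without
  a measure on hyperplanes.\<close>

lemma nn_integral_ball_slices:
  fixes r c :: real
  assumes "0 \<le> r"
  shows "(\<integral>\<^sup>+ \<tau>. ennreal (unit_ball_vol (real m) *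
            (if \<bar>\<tau> - c\<bar> \<le> r then sqrt (r\<^sup>2 - (\<tau> - c)\<^sup>2) ^ m else 0)) \<partial>lborel)
         = ennreal (unit_ball_vol (real (Suc m)) * r ^ Suc m)"
proof (cases "r = 0")
  case True
  have "AE \<tau> in lborel. \<tau> \<noteq> c"
    by (rule AE_lborel_singleton)
  then have "(\<integral>\<^sup>+ \<tau>. ennreal (unit_ball_vol (real m) *
            (if \<bar>\<tau> - c\<bar> \<le> r then sqrt (r\<^sup>2 - (\<tau> - c)\<^sup>2) ^ m else 0)) \<partial>lborel) = (\<integral>\<^sup>+ \<tau>. 0 \<partial>(lborel::real measure))"
    by (intro nn_integral_cong_AE) (erule eventually_mono, use True in auto)
  then show ?thesis using True by simp
next
  case False
  then have r: "r > 0" using assms by simp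
  have B: "0 \<le> Beta (1/2) (real m / 2 + 1)"
    using unit_ball_vol_Suc[of m] unit_ball_vol_pos[of "real m"] unit_ball_vol_nonneg[of "real (Suc m)"]
    by (smt (verit) of_nat_0_le_iff mult_pos_neg)
  have "(\<integral>\<^sup>+ \<tau>. ennreal (unit_ball_vol (real m) *
            (if \<bar>\<tau> - c\<bar> \<le> r then sqrt (r\<^sup>2 - (\<tau> - c)\<^sup>2) ^ m else 0)) \<partial>lborel)
     = ennreal \<bar>r\<bar> * (\<integral>\<^sup>+ x. ennreal (unit_ball_vol (real m) *
            (if \<bar>(c + r * x) - c\<bar> \<le> r then sqrt (r\<^sup>2 - ((c + r * x) - c)\<^sup>2) ^ m else 0)) \<partial>lborel)"
    using r by (intro nn_integral_real_affine) auto
  also have "\<dots> = ennreal \<bar>r\<bar> * (\<integral>\<^sup>+ x. ennreal (unit_ball_vol (real m) * r ^ m) *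
       ennreal (indicator {-1..1} x * sqrt (1 - x\<^sup>2) ^ m) \<partial>lborel)"
  proof (intro arg_cong[where f="\<lambda>z. ennreal \<bar>r\<bar> * z"] nn_integral_cong)
    fix x :: real
    have 1: "\<bar>(c + r * x) - c\<bar> \<le> r \<longleftrightarrow> x \<in> {-1..1}"
      using r by (auto simp: abs_mult abs_le_iff)
    have "sqrt (r\<^sup>2 - (r * x)\<^sup>2) = r * sqrt (1 - x\<^sup>2)"
    proof -
      have "r\<^sup>2 - (r * x)\<^sup>2 = r\<^sup>2 * (1 - x\<^sup>2)" by (simp add: power_mult_distrib algebra_simps)
      then show ?thesis using r by (simp add: real_sqrt_mult)
    qed
    then have "unit_ball_vol (real m) *
            (if \<bar>(c + r * x) - c\<bar> \<le> r then sqrt (r\<^sup>2 - ((c + r * x) - c)\<^sup>2) ^ m else 0)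
        = (unit_ball_vol (real m) * r ^ m) * (indicator {-1..1} x * sqrt (1 - x\<^sup>2) ^ m)"
      unfolding 1 by (simp add: power_mult_distrib)
    moreover have "0 \<le> indicator {-1..1} x * sqrt (1 - x\<^sup>2) ^ m"
      by (auto simp: indicator_def abs_square_le_1 power2_le_iff_abs_le)
    ultimately show "ennreal (unit_ball_vol (real m) *
            (if \<bar>(c + r * x) - c\<bar> \<le> r then sqrt (r\<^sup>2 - ((c + r * x) - c)\<^sup>2) ^ m else 0))
        = ennreal (unit_ball_vol (real m) * r ^ m) *
       ennreal (indicator {-1..1} x * sqrt (1 - x\<^sup>2) ^ m)"
      using r by (simp only: ennreal_mult'')
  qed
  also have "\<dots> = ennreal r * (ennreal (unit_ball_vol (real m) * r ^ m) * ennreal (Beta (1/2) (real m / 2 + 1)))"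
    using r by (subst nn_integral_cmult) (auto simp: emeasure_cball_aux_integral)
  also have "\<dots> = ennreal (r * ((unit_ball_vol (real m) * r ^ m) * Beta (1/2) (real m / 2 + 1)))"
    using r B by (simp add: ennreal_mult)
  also have "r * ((unit_ball_vol (real m) * r ^ m) * Beta (1/2) (real m / 2 + 1))
       = (unit_ball_vol (real m) * Beta (1/2) (real m / 2 + 1)) * r ^ Suc m"
    by (simp add: mult_ac)
  finally show ?thesis unfolding unit_ball_vol_Suc .
qed

text \<open>A family of balls is a set of pairs of centre and radius.\<close>

definition ball_cost :: "('a::euclidean_space \<times> real) set \<Rightarrow> ennreal" where
  "ball_cost D = (\<integral>\<^sup>+ i. ennreal (unit_ball_vol (real DIM('a)) * snd i ^ DIM('a)) \<partial>count_space D)"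

lemma ball_cost_Un: "ball_cost (A \<union> B) \<le> ball_cost A + ball_cost B"
proof -
  let ?f = "\<lambda>i::'a\<times>real. ennreal (unit_ball_vol (real DIM('a)) * snd i ^ DIM('a))"
  have *: "ball_cost X = (\<integral>\<^sup>+ i. ?f i * indicator X i \<partial>count_space UNIV)" for X
    unfolding ball_cost_def
    by (cases "X = UNIV") (auto simp: nn_integral_count_space_indicator)
  have "(\<integral>\<^sup>+ i. ?f i * indicator (A \<union> B) i \<partial>count_space UNIV)
     \<le> (\<integral>\<^sup>+ i. ?f i * indicator A i + ?f i * indicator B i \<partial>count_space UNIV)"
    by (intro nn_integral_mono) (auto simp: indicator_def)
  then show ?thesis unfolding * by (subst (asm) nn_integral_add) auto
qed

lemma ball_cost_disjoint:
  fixes C :: "('a::euclidean_space \<times> real) set"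
  assumes "countable C" "pairwise (\<lambda>i j. disjnt (ball (fst i) (snd i)) (ball (fst j) (snd j))) C"
    "\<And>i. i \<in> C \<Longrightarrow> 0 \<le> snd i \<and> ball (fst i) (snd i) \<subseteq> V" "open V"
  shows "ball_cost C \<le> emeasure lborel V"
proof -
  have "ball_cost C = (\<integral>\<^sup>+ i. emeasure lborel (ball (fst i) (snd i)) \<partial>count_space C)"
    unfolding ball_cost_def using assms(3)
    by (intro nn_integral_cong) (auto simp: emeasure_ball)
  also have "\<dots> = emeasure lborel (\<Union>i\<in>C. ball (fst i) (snd i))"
    using assms by (subst emeasure_UN_countable)
      (auto simp: disjoint_family_on_def pairwise_def disjnt_def)
  also have "\<dots> \<le> emeasure lborel V"
    using assms by (intro emeasure_mono) auto
  finally show ?thesis .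
qed

lemma ball_cost_scale:
  fixes C :: "('a::euclidean_space \<times> real) set"
  assumes "0 < k"
  shows "ball_cost ((\<lambda>i. (fst i, k * snd i)) ` C) = ennreal (k ^ DIM('a)) * ball_cost C"
proof -
  have inj: "inj_on (\<lambda>i::'a\<times>real. (fst i, k * snd i)) C"
    using assms by (auto simp: inj_on_def prod_eq_iff)
  have "ball_cost ((\<lambda>i. (fst i, k * snd i)) ` C)
     = (\<integral>\<^sup>+ i. ennreal (unit_ball_vol (real DIM('a)) * (k * snd i) ^ DIM('a)) \<partial>count_space C)"
    unfolding ball_cost_def
    by (subst nn_integral_bij_count_space[OF inj_on_imp_bij_betw[OF inj], symmetric]) simp
  also have "\<dots> = (\<integral>\<^sup>+ i. ennreal (k ^ DIM('a)) * ennreal (unit_ball_vol (real DIM('a)) * snd i ^ DIM('a)) \<partial>count_space C)"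
    using assms
    by (intro nn_integral_cong) (simp add: power_mult_distrib ennreal_mult'[symmetric] mult_ac)
  also have "\<dots> = ennreal (k ^ DIM('a)) * ball_cost C"
    unfolding ball_cost_def by (subst nn_integral_cmult) auto
  finally show ?thesis .
qed

text \<open>Vitali's theorem fills almost all of \<open>S\<close> with disjoint balls inside an open superset of almost the
  same measure. The null set left over lies in an open set of tiny measure, where the covering lemma
  with fivefold radii wastes only a factor \<open>5\<close> to the power of the dimension.\<close>

lemma fine_ball_cover:
  fixes S :: "'a::euclidean_space set"
  assumes S: "S \<in> sets borel" and \<delta>: "0 < \<delta>" and \<epsilon>: "0 < \<epsilon>"
  obtains D :: "('a \<times> real) set" where "countable D" "\<And>i. i \<in> D \<Longrightarrow> 0 < snd i \<and> snd i < \<delta>"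
    "S \<subseteq> (\<Union>i\<in>D. ball (fst i) (snd i))" "ball_cost D \<le> emeasure lborel S + ennreal \<epsilon>"
proof -
  define k where "k = (5::real) ^ DIM('a)"
  have k: "k > 0" by (simp add: k_def)
  have outer: "\<exists>V. open V \<and> Z \<subseteq> V \<and> emeasure lborel V \<le> emeasure lebesgue Z + ennreal e"
    if eZ: "e > 0" "Z \<in> sets lebesgue" for e and Z :: "'a set"
  proof -
    obtain V where V: "open V" "Z \<subseteq> V" "V - Z \<in> lmeasurable" "emeasure lebesgue (V - Z) < ennreal e"
      using sets_lebesgue_outer_open[OF eZ(2,1)] by blast
    have "emeasure lborel V = emeasure lebesgue (Z \<union> (V - Z))"
      using V(1,2) by (simp add: Un_absorb1)
    also have "\<dots> \<le> emeasure lebesgue Z + emeasure lebesgue (V - Z)"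
      using eZ V by (intro emeasure_subadditive) auto
    also have "\<dots> \<le> emeasure lebesgue Z + ennreal e"
      using V(4) by (intro add_left_mono) simp
    finally show ?thesis using V by blast
  qed
  obtain V where V: "open V" "S \<subseteq> V" "emeasure lborel V \<le> emeasure lebesgue S + ennreal (\<epsilon>/2)"
    using outer[of "\<epsilon>/2" S] S \<epsilon> by auto
  define P where "P = {i :: 'a\<times>real. 0 < snd i \<and> snd i < \<delta> \<and> ball (fst i) (snd i) \<subseteq> V}"
  have fine: "\<exists>i. i \<in> P \<and> x \<in> ball (fst i) (snd i) \<and> snd i < d" if x: "x \<in> S" "0 < d" for x d
  proof -
    obtain e where e: "e > 0" "ball x e \<subseteq> V" using V x openE by blast
    define \<rho> where "\<rho> = min e (min (d/2) (\<delta>/2))"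
    have "\<rho> > 0" "\<rho> < d" "\<rho> < \<delta>" "ball x \<rho> \<subseteq> V"
      using e x \<delta> subset_ball[of \<rho> e x] by (auto simp: \<rho>_def min_def)
    then show ?thesis by (intro exI[of _ "(x,\<rho>)"]) (auto simp: P_def)
  qed
  obtain C where C: "countable C" "C \<subseteq> P"
     "pairwise (\<lambda>i j. disjnt (ball (fst i) (snd i)) (ball (fst j) (snd j))) C"
     "negligible (S - (\<Union>i \<in> C. ball (fst i) (snd i)))"
    using Vitali_covering_theorem_balls[of S P fst snd, OF fine] by blast
  define N where "N = S - (\<Union>i \<in> C. ball (fst i) (snd i))"
  have "N \<in> sets lebesgue" "emeasure lebesgue N = 0"
    using C(4) by (auto simp: N_def negligible_iff_null_sets)
  then obtain W where W: "open W" "N \<subseteq> W" "emeasure lborel W \<le> ennreal (\<epsilon>/2/k)"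
    using outer[of "\<epsilon>/2/k" N] \<epsilon> k by auto
  define P2 where "P2 = {i :: 'a\<times>real. 0 < snd i \<and> snd i < \<delta>/5 \<and> ball (fst i) (snd i) \<subseteq> W}"
  have "N \<subseteq> (\<Union>i\<in>P2. ball (fst i) (snd i))"
  proof
    fix x assume "x \<in> N"
    then obtain e where e: "e > 0" "ball x e \<subseteq> W" using W openE by blast
    define \<rho> where "\<rho> = min e (\<delta>/10)"
    have "\<rho> > 0" "\<rho> < \<delta>/5" "ball x \<rho> \<subseteq> W"
      using e \<delta> subset_ball[of \<rho> e x] by (auto simp: \<rho>_def min_def)
    then show "x \<in> (\<Union>i\<in>P2. ball (fst i) (snd i))"
      by (intro UN_I[of "(x,\<rho>)"]) (auto simp: P2_def)
  qed
  moreover have "0 < snd i \<and> snd i \<le> \<delta>/5" if "i \<in> P2" for i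
    using that by (auto simp: P2_def)
  ultimately obtain C2 where C2: "countable C2" "C2 \<subseteq> P2"
     "pairwise (\<lambda>i j. disjnt (ball (fst i) (snd i)) (ball (fst j) (snd j))) C2"
     "N \<subseteq> (\<Union>i\<in>C2. ball (fst i) (5 * snd i))"
    by (rule Vitali_covering_lemma_balls[where S=N and K=P2 and a=fst and r=snd and B="\<delta>/5"])
  define D where "D = C \<union> (\<lambda>i. (fst i, 5 * snd i)) ` C2"
  show thesis
  proof
    show "countable D" using C C2 by (simp add: D_def)
    show "0 < snd i \<and> snd i < \<delta>" if "i \<in> D" for i
      using that C(2) C2(2) by (auto simp: D_def P_def P2_def)
    show "S \<subseteq> (\<Union>i\<in>D. ball (fst i) (snd i))"
      using C2(4) by (auto simp: D_def N_def)
    have "ball_cost D \<le> ball_cost C + ennreal k * ball_cost C2"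
      unfolding D_def k_def using ball_cost_Un[of C "(\<lambda>i. (fst i, 5 * snd i)) ` C2"] ball_cost_scale[of 5 C2] by simp
    also have "\<dots> \<le> emeasure lborel V + ennreal k * emeasure lborel W"
      using C C2 V W by (intro add_mono mult_left_mono ball_cost_disjoint) (auto simp: P_def P2_def)
    also have "\<dots> \<le> emeasure lborel V + ennreal k * ennreal (\<epsilon>/2/k)"
      using W by (intro add_mono mult_left_mono) auto
    also have "\<dots> = emeasure lborel V + ennreal (\<epsilon>/2)"
      using k \<epsilon> by (simp flip: ennreal_mult')
    also have "\<dots> \<le> emeasure lborel S + ennreal (\<epsilon>/2) + ennreal (\<epsilon>/2)"
      using V(3) S by (intro add_mono) auto
    also have "\<dots> = emeasure lborel S + ennreal \<epsilon>"
      using \<epsilon> by (simp add: add.assoc flip: ennreal_plus)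
    finally show "ball_cost D \<le> emeasure lborel S + ennreal \<epsilon>" .
  qed
qed

lemma hausdorff_weight_mono:
  fixes U V :: "'a::euclidean_space set"
  assumes "U \<subseteq> V" "bounded V"
  shows "hausdorff_weight k U \<le> hausdorff_weight k V"
  unfolding hausdorff_weight_def using assms diameter_subset[OF assms] diameter_ge_0[OF bounded_subset[OF assms(2,1)]]
  by (auto intro!: ennreal_leI mult_left_mono power_mono)

text \<open>The definition asks for covers indexed by the natural numbers. Empty sets have weight 0, also when
  the dimension is 0, so any countable index set can be padded.\<close>

lemma hausdorff_pre_countable:
  fixes U :: "'i \<Rightarrow> 'a::euclidean_space set"
  assumes "countable D" "A \<subseteq> (\<Union>i\<in>D. U i)" "\<And>i. i \<in> D \<Longrightarrow> bounded (U i) \<and> diameter (U i) \<le> \<delta>" "0 \<le> \<delta>"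
  shows "hausdorff_pre k \<delta> A \<le> (\<integral>\<^sup>+ i. hausdorff_weight k (U i) \<partial>count_space D)"
proof -
  let ?J = "to_nat_on D ` D"
  define V where "V n = (if n \<in> ?J then U (from_nat_into D n) else {})" for n
  have inj: "inj_on (to_nat_on D) D" using assms(1) by (rule inj_on_to_nat_on)
  have nat_inv: "from_nat_into D (to_nat_on D i) = i" if "i \<in> D" for i
    using that assms(1) by simp
  have "A \<subseteq> (\<Union>n. V n)"
  proof
    fix x assume "x \<in> A"
    then obtain i where "i \<in> D" "x \<in> U i" using assms(2) by blast
    then show "x \<in> (\<Union>n. V n)" using nat_inv by (intro UN_I[of "to_nat_on D i"]) (auto simp: V_def)
  qed
  moreover have "\<forall>n. bounded (V n) \<and> diameter (V n) \<le> \<delta>"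
    using assms(3,4) nat_inv by (auto simp: V_def)
  ultimately have "hausdorff_pre k \<delta> A \<le> (\<Sum>n. hausdorff_weight k (V n))"
    unfolding hausdorff_pre_def by (intro INF_lower) auto
  also have "\<dots> = (\<integral>\<^sup>+ n. hausdorff_weight k (V n) \<partial>count_space UNIV)"
    by (simp add: nn_integral_count_space_nat)
  also have "\<dots> = (\<integral>\<^sup>+ n. hausdorff_weight k (V n) * indicator ?J n \<partial>count_space UNIV)"
    by (intro nn_integral_cong) (auto simp: V_def hausdorff_weight_def indicator_def)
  also have "\<dots> = (\<integral>\<^sup>+ n. hausdorff_weight k (V n) \<partial>count_space ?J)"
    by (cases "?J = UNIV") (auto simp: nn_integral_count_space_indicator)
  also have "\<dots> = (\<integral>\<^sup>+ i. hausdorff_weight k (V (to_nat_on D i)) \<partial>count_space D)"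
    by (rule nn_integral_bij_count_space[OF inj_on_imp_bij_betw[OF inj], symmetric])
  also have "\<dots> = (\<integral>\<^sup>+ i. hausdorff_weight k (U i) \<partial>count_space D)"
    using nat_inv by (intro nn_integral_cong) (auto simp: V_def)
  finally show ?thesis .
qed

section \<open>Hausdorff measure of the base of a cone\<close>

text \<open>Cover the cone by small balls. For \<open>\<tau>\<close> between \<open>lam * h\<close> and \<open>h\<close>, the disks cut out at height \<open>\<tau>\<close>
  cover \<open>\<tau> / h\<close> times \<open>F\<close>, so after rescaling they form an admissible cover of \<open>F\<close>. The restriction to
  \<open>\<tau> \<ge> lam * h\<close> keeps the rescaling factor bounded, and thereby the diameters below \<open>\<delta>\<close>. Integrating
  the resulting inequality over \<open>\<tau>\<close> produces \<open>\<integral> (\<tau> / h) ^ (n - 1) d\<tau>\<close> on the left and the volumes of the balls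
  on the right.\<close>

lemma cone_over_hausdorff_pre_bound:
  fixes u :: "'a::euclidean_space"
  assumes u: "norm u = 1" and h: "0 < h" and F: "compact F" "F \<subseteq> {x. u \<bullet> x = h}"
    and C: "C = (\<lambda>(t, x). t *\<^sub>R x) ` ({0..1} \<times> F)"
    and lam: "0 < lam" "lam < 1" and \<delta>: "0 < \<delta>" and dim: "2 \<le> DIM('a)"
  shows "hausdorff_pre (DIM('a) - 1) \<delta> F * ennreal (h / real DIM('a) * (1 - lam ^ DIM('a)))
           \<le> emeasure lborel C"
proof (rule ennreal_le_epsilon)
  fix \<epsilon> :: real assume \<epsilon>: "0 < \<epsilon>"
  define m where "m = DIM('a) - 1"
  have n: "DIM('a) = Suc m" and m: "m \<ge> 1" using dim by (auto simp: m_def)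
  have "compact C" unfolding C
    by (intro compact_continuous_image compact_Times F) (auto simp: case_prod_beta intro!: continuous_intros)
  then have "C \<in> sets borel" by (simp add: borel_compact)
  then obtain D :: "('a \<times> real) set" where D: "countable D"
    "\<And>i. i \<in> D \<Longrightarrow> 0 < snd i \<and> snd i < lam * \<delta> / 2"
    "C \<subseteq> (\<Union>i\<in>D. ball (fst i) (snd i))" "ball_cost D \<le> emeasure lborel C + ennreal \<epsilon>"
    by (rule fine_ball_cover[of C "lam * \<delta> / 2" \<epsilon>]) (use lam \<delta> \<epsilon> in auto)
  define s where "s i \<tau> = (if \<bar>\<tau> - u \<bullet> fst i\<bar> \<le> snd i then sqrt ((snd i)\<^sup>2 - (\<tau> - u \<bullet> fst i)\<^sup>2) ^ m else 0)"
    for i :: "'a \<times> real" and \<tau>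
  have s0: "0 \<le> s i \<tau>" if "i \<in> D" for i \<tau>
    using D(2)[OF that] by (auto simp: s_def power2_le_iff_abs_le intro!: zero_le_power)
  let ?P = "hausdorff_pre m \<delta> F"
  let ?area = "\<lambda>\<tau>. \<integral>\<^sup>+ i. ennreal (unit_ball_vol (real m) * s i \<tau>) \<partial>count_space D"
  have slice: "?P * ennreal ((\<tau> / h) ^ m) \<le> ?area \<tau>"
    if \<tau>: "\<tau> \<in> {lam * h..h}" for \<tau>
  proof -
    have \<tau>0: "\<tau> > 0" using \<tau> lam h by (smt (verit) atLeastAtMost_iff mult_pos_pos)
    define k where "k = h / \<tau>"
    have k: "k > 0" "k * lam \<le> 1" using \<tau> \<tau>0 h lam by (auto simp: k_def field_simps)
    define U where "U i = (\<lambda>z. k *\<^sub>R z) ` (ball (fst i) (snd i) \<inter> {z. u \<bullet> z = \<tau>})" for i :: "'a \<times> real"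
    define c where "c i = k *\<^sub>R (fst i + (\<tau> - u \<bullet> fst i) *\<^sub>R u)" for i :: "'a \<times> real"
    define \<rho> where "\<rho> i = sqrt ((snd i)\<^sup>2 - (\<tau> - u \<bullet> fst i)\<^sup>2)" for i :: "'a \<times> real"
    have U: "U i = {} \<or> (\<bar>\<tau> - u \<bullet> fst i\<bar> \<le> snd i \<and> U i \<subseteq> cball (c i) (k * \<rho> i))" for i
    proof (cases "U i = {}")
      case False
      have main: "(norm (z - (fst i + (\<tau> - u \<bullet> fst i) *\<^sub>R u)))\<^sup>2 + (\<tau> - u \<bullet> fst i)\<^sup>2 = (norm (z - fst i))\<^sup>2"
        if z: "u \<bullet> z = \<tau>" for z
      proof -
        have 1: "u \<bullet> (z - fst i) = \<tau> - u \<bullet> fst i" using z by (simp add: inner_diff_right)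
        have uu: "u \<bullet> u = 1" using u by (simp add: norm_eq_1)
        define v where "v = z - fst i"
        define a where "a = \<tau> - u \<bullet> fst i"
        have va: "u \<bullet> v = a" "v \<bullet> u = a" using 1 by (auto simp: v_def a_def inner_commute)
        have "(norm (v - a *\<^sub>R u))\<^sup>2 + a\<^sup>2 = (norm v)\<^sup>2"
          unfolding power2_norm_eq_inner using va uu
          by (simp add: inner_diff_left inner_diff_right power2_eq_square)
        then show ?thesis by (simp add: v_def a_def algebra_simps)
      qed
      have in_ball: "\<bar>\<tau> - u \<bullet> fst i\<bar> \<le> snd i \<and> norm (z - (fst i + (\<tau> - u \<bullet> fst i) *\<^sub>R u)) \<le> \<rho> i"
        if z: "u \<bullet> z = \<tau>" "z \<in> ball (fst i) (snd i)" for z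
      proof -
        have 2: "norm (z - fst i) < snd i" using z(2) by (simp add: dist_norm norm_minus_commute)
        then have 3: "(norm (z - fst i))\<^sup>2 \<le> (snd i)\<^sup>2" by (intro power_mono) auto
        have 5: "snd i > 0" using 2 norm_ge_zero[of "z - fst i"] by linarith
        have "(\<tau> - u \<bullet> fst i)\<^sup>2 \<le> (snd i)\<^sup>2" using main[OF z(1)] 3
          by (smt (verit) zero_le_power2)
        then have 4: "\<bar>\<tau> - u \<bullet> fst i\<bar> \<le> snd i" using 5 by (simp add: power2_le_iff_abs_le)
        have "(norm (z - (fst i + (\<tau> - u \<bullet> fst i) *\<^sub>R u)))\<^sup>2 \<le> (snd i)\<^sup>2 - (\<tau> - u \<bullet> fst i)\<^sup>2"
          using main[OF z(1)] 3 by linarith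
        then show ?thesis using 4 by (auto simp: \<rho>_def intro: real_le_rsqrt)
      qed
      have "U i \<subseteq> cball (c i) (k * \<rho> i)"
      proof
        fix y assume "y \<in> U i"
        then obtain z where z: "u \<bullet> z = \<tau>" "z \<in> ball (fst i) (snd i)" "y = k *\<^sub>R z" by (auto simp: U_def)
        have "dist (c i) y = k * norm (z - (fst i + (\<tau> - u \<bullet> fst i) *\<^sub>R u))"
          unfolding c_def z(3) dist_norm scaleR_diff_right[symmetric] using k by (simp add: norm_minus_commute)
        then show "y \<in> cball (c i) (k * \<rho> i)" using in_ball[OF z(1,2)] k by simp
      qed
      moreover obtain z where "u \<bullet> z = \<tau>" "z \<in> ball (fst i) (snd i)" using False unfolding U_def by blast
      then have "\<bar>\<tau> - u \<bullet> fst i\<bar> \<le> snd i" using in_ball by blast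
      ultimately show ?thesis by blast
    qed simp
    have \<rho>: "0 \<le> k * \<rho> i \<and> 2 * (k * \<rho> i) \<le> \<delta>" if "\<bar>\<tau> - u \<bullet> fst i\<bar> \<le> snd i" "i \<in> D" for i
    proof -
      have 1: "0 \<le> \<rho> i" using that by (auto simp: \<rho>_def power2_le_iff_abs_le)
      have "\<rho> i \<le> snd i" using that unfolding \<rho>_def by (intro real_le_lsqrt) auto
      then have "k * \<rho> i \<le> k * (lam * \<delta> / 2)" using D(2)[OF that(2)] k by (intro mult_left_mono) auto
      also have "\<dots> = (k * lam) * \<delta> / 2" by simp
      also have "\<dots> \<le> 1 * \<delta> / 2" using k \<delta> by (intro divide_right_mono mult_right_mono) auto
      finally show ?thesis using 1 k by simp
    qed
    have cov: "F \<subseteq> (\<Union>i\<in>D. U i)"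
    proof
      fix x assume x: "x \<in> F"
      have "(\<tau> / h) *\<^sub>R x \<in> C" unfolding C using x \<tau> \<tau>0 h
        by (intro image_eqI[of _ _ "(\<tau>/h, x)"]) auto
      then obtain i where i: "i \<in> D" "(\<tau> / h) *\<^sub>R x \<in> ball (fst i) (snd i)" using D(3) by blast
      moreover have "u \<bullet> ((\<tau> / h) *\<^sub>R x) = \<tau>" using F(2) x h by auto
      moreover have "x = k *\<^sub>R ((\<tau> / h) *\<^sub>R x)" using \<tau>0 h by (simp add: k_def)
      ultimately show "x \<in> (\<Union>i\<in>D. U i)" unfolding U_def by blast
    qed
    have bd: "bounded (U i) \<and> diameter (U i) \<le> \<delta>" if "i \<in> D" for i
    proof (cases "U i = {}")
      case False
      then have 1: "\<bar>\<tau> - u \<bullet> fst i\<bar> \<le> snd i" "U i \<subseteq> cball (c i) (k * \<rho> i)" using U[of i] by auto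
      have "diameter (U i) \<le> diameter (cball (c i) (k * \<rho> i))"
        by (rule diameter_subset[OF 1(2) bounded_cball])
      then show ?thesis using \<rho>[OF 1(1) that] 1(2) bounded_subset[OF bounded_cball]
        by (auto simp: diameter_cball)
    qed (use \<delta> in auto)
    have "?P \<le> (\<integral>\<^sup>+ i. hausdorff_weight m (U i) \<partial>count_space D)"
      using D(1) cov bd \<delta> by (intro hausdorff_pre_countable) auto
    also have "\<dots> \<le> (\<integral>\<^sup>+ i. ennreal (k ^ m) * ennreal (unit_ball_vol (real m) * s i \<tau>) \<partial>count_space D)"
    proof (intro nn_integral_mono)
      fix i assume "i \<in> space (count_space D)"
      then have i: "i \<in> D" by simp
      show "hausdorff_weight m (U i) \<le> ennreal (k ^ m) * ennreal (unit_ball_vol (real m) * s i \<tau>)"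
      proof (cases "U i = {}")
        case False
        then have 1: "\<bar>\<tau> - u \<bullet> fst i\<bar> \<le> snd i" "U i \<subseteq> cball (c i) (k * \<rho> i)" using U[of i] by auto
        have "hausdorff_weight m (U i) \<le> hausdorff_weight m (cball (c i) (k * \<rho> i))"
          by (rule hausdorff_weight_mono[OF 1(2) bounded_cball])
        also have "\<dots> = ennreal (unit_ball_vol (real m) * (k * \<rho> i) ^ m)"
          using \<rho>[OF 1(1) i] by (auto simp: hausdorff_weight_def diameter_cball)
        also have "\<dots> = ennreal (k ^ m) * ennreal (unit_ball_vol (real m) * s i \<tau>)"
          using 1(1) k s0[OF i] by (simp add: s_def \<rho>_def power_mult_distrib mult_ac flip: ennreal_mult')
        finally show ?thesis .
      qed (simp add: hausdorff_weight_def)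
    qed
    also have "\<dots> = ennreal (k ^ m) * ?area \<tau>"
      by (subst nn_integral_cmult) auto
    finally have "?P * ennreal ((\<tau> / h) ^ m) \<le>
       ennreal (k ^ m) * ?area \<tau> * ennreal ((\<tau> / h) ^ m)"
      by (intro mult_right_mono) auto
    also have "\<dots> = ennreal (k ^ m * (\<tau> / h) ^ m) * ?area \<tau>"
      using \<tau>0 h k by (subst ennreal_mult) (auto simp: mult_ac)
    also have "k ^ m * (\<tau> / h) ^ m = 1" using \<tau>0 h by (simp add: k_def flip: power_mult_distrib)
    finally show ?thesis by simp
  qed
  have int: "(\<integral>\<^sup>+ \<tau>. ennreal (indicator {lam * h..h} \<tau> * (\<tau> / h) ^ m) \<partial>lborel) = ennreal (h / real (Suc m) * (1 - lam ^ Suc m))"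
  proof -
    have "((\<lambda>\<tau>. (\<tau> / h) ^ m) has_integral (h / real (Suc m) * (h / h) ^ Suc m - h / real (Suc m) * (lam * h / h) ^ Suc m)) {lam * h..h}"
    proof (rule fundamental_theorem_of_calculus)
      show "lam * h \<le> h" using lam h by simp
      fix x
      have "((\<lambda>\<tau>. h / real (Suc m) * (\<tau> / h) ^ Suc m) has_real_derivative (x / h) ^ m) (at x within {lam * h..h})"
      proof -
        have "((\<lambda>\<tau>. \<tau> / h) has_real_derivative 1 / h) (at x within {lam * h..h})"
          using h by (auto intro!: derivative_eq_intros)
        from DERIV_cmult[OF DERIV_power_Suc[OF this, of m], of "h / real (Suc m)"]
        have *: "((\<lambda>\<tau>. h / real (Suc m) * (\<tau> / h) ^ Suc m) has_real_derivative
           h / real (Suc m) * ((1 + real m) * (1 / h * (x / h) ^ m))) (at x within {lam * h..h})" by simp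
        have "h / k * (k * (1 / h * y)) = y" if "k \<noteq> 0" for k y
          using h that by simp
        from this[of "1 + real m"]
        have "h / real (Suc m) * ((1 + real m) * (1 / h * y)) = y" for y
          by (simp add: add_eq_0_iff)
        then show ?thesis using * by simp
      qed
      then show "((\<lambda>\<tau>. h / real (Suc m) * (\<tau> / h) ^ Suc m) has_vector_derivative (x / h) ^ m) (at x within {lam * h..h})"
        by (simp add: has_real_derivative_iff_has_vector_derivative)
    qed
    moreover have "h / real (Suc m) * (h / h) ^ Suc m - h / real (Suc m) * (lam * h / h) ^ Suc m = h / real (Suc m) * (1 - lam ^ Suc m)"
      using h by (simp add: right_diff_distrib)
    ultimately have "((\<lambda>\<tau>. (\<tau> / h) ^ m) has_integral h / real (Suc m) * (1 - lam ^ Suc m)) {lam * h..h}" by simp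
    moreover have "0 \<le> (\<tau> / h) ^ m" if "\<tau> \<in> {lam * h..h}" for \<tau>
      using that lam h by (smt (verit) atLeastAtMost_iff mult_pos_pos divide_nonneg_pos zero_le_power)
    ultimately show ?thesis by (intro nn_integral_has_integral_lebesgue)
  qed
  have "?P * ennreal (h / real (Suc m) * (1 - lam ^ Suc m))
     = (\<integral>\<^sup>+ \<tau>. ?P * ennreal (indicator {lam * h..h} \<tau> * (\<tau> / h) ^ m) \<partial>lborel)"
    unfolding int[symmetric] by (subst nn_integral_cmult) auto
  also have "\<dots> \<le> (\<integral>\<^sup>+ \<tau>. ?area \<tau> \<partial>lborel)"
    using slice by (intro nn_integral_mono) (auto simp: indicator_def)
  also have "\<dots> = (\<integral>\<^sup>+ i. (\<integral>\<^sup>+ \<tau>. ennreal (unit_ball_vol (real m) * s i \<tau>) \<partial>lborel) \<partial>count_space D)"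
    by (rule nn_integral_count_space_nn_integral[OF D(1)]) (simp add: s_def)
  also have "\<dots> = ball_cost D"
    unfolding ball_cost_def
  proof (intro nn_integral_cong)
    fix i assume "i \<in> space (count_space D)"
    then have "0 \<le> snd i" using D(2) by (simp add: less_imp_le)
    from nn_integral_ball_slices[OF this, of m "u \<bullet> fst i"]
    show "(\<integral>\<^sup>+ \<tau>. ennreal (unit_ball_vol (real m) * s i \<tau>) \<partial>lborel) = ennreal (unit_ball_vol (real DIM('a)) * snd i ^ DIM('a))"
      unfolding s_def n .
  qed
  also note D(4)
  finally show "hausdorff_pre (DIM('a) - 1) \<delta> F * ennreal (h / real DIM('a) * (1 - lam ^ DIM('a)))
           \<le> emeasure lborel C + ennreal \<epsilon>"
    unfolding n by simp
qed

text \<open>The limits \<open>\<delta> \<rightarrow> 0\<close> and then \<open>lam \<rightarrow> 0\<close>. The factor \<open>h / n\<close> is the one in the volume of a cone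
  of height \<open>h\<close>, so the estimate is sharp.\<close>

lemma cone_over_hausdorff_bound:
  fixes u :: "'a::euclidean_space"
  assumes u: "norm u = 1" and h: "0 < h" and F: "compact F" "F \<subseteq> {x. u \<bullet> x = h}"
    and C: "C = (\<lambda>(t, x). t *\<^sub>R x) ` ({0..1} \<times> F)" and dim: "2 \<le> DIM('a)"
  shows "hausdorff_measure (DIM('a) - 1) F * ennreal h \<le> ennreal (real DIM('a)) * emeasure lborel C"
proof -
  let ?n = "DIM('a)" and ?H = "hausdorff_measure (DIM('a) - 1) F"
  have le: "?H * ennreal (h / real ?n * (1 - lam ^ ?n)) \<le> emeasure lborel C"
    if lam: "0 < lam" "lam < 1" for lam
    unfolding hausdorff_measure_def SUP_mult_right_ennreal
    by (intro SUP_least cone_over_hausdorff_pre_bound[OF u h F C lam _ dim]) simp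
  have le2: "?H * ennreal (h * (1 - lam ^ ?n)) \<le> ennreal (real ?n) * emeasure lborel C"
    if lam: "0 < lam" "lam < 1" for lam
  proof -
    have "ennreal (real ?n) * (?H * ennreal (h / real ?n * (1 - lam ^ ?n))) \<le> ennreal (real ?n) * emeasure lborel C"
      by (intro mult_left_mono le lam) simp
    moreover have "ennreal (real ?n) * (?H * ennreal (h / real ?n * (1 - lam ^ ?n))) = ?H * ennreal (real ?n * (h / real ?n * (1 - lam ^ ?n)))"
      using h lam by (subst ennreal_mult) (auto simp: mult_ac power_le_one)
    ultimately show ?thesis by (simp add: mult_ac)
  qed
  have "compact C" unfolding C
    by (intro compact_continuous_image compact_Times F) (auto simp: case_prod_beta intro!: continuous_intros)
  then have fin: "emeasure lborel C < top"
    using emeasure_compact_finite by auto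
  have "?H < top"
  proof (rule ccontr)
    assume "\<not> ?H < top"
    then have "?H = top" using less_top by blast
    moreover have "(1/2::real) ^ ?n < 1" by (intro power_less_one_iff[THEN iffD2]) auto
    then have "h * (1 - (1/2) ^ ?n) > 0" using h by simp
    then have "ennreal (h * (1 - (1/2) ^ ?n)) \<noteq> 0" by (simp only: ennreal_eq_0_iff not_le)
    ultimately have "?H * ennreal (h * (1 - (1/2) ^ ?n)) = top" by (simp only: ennreal_top_mult if_False)
    moreover have "ennreal (real ?n) * emeasure lborel C < top" using fin by (simp add: ennreal_mult_less_top)
    ultimately show False using le2[of "1/2"] by (simp add: top_unique)
  qed
  have "((\<lambda>lam. ?H * ennreal (h * (1 - lam ^ ?n))) \<longlongrightarrow> ?H * ennreal (h * (1 - 0 ^ ?n))) (at_right (0::real))"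
    using \<open>?H < top\<close> by (intro ennreal_tendsto_cmult tendsto_ennrealI tendsto_intros) auto
  moreover have "\<forall>\<^sub>F lam in at_right (0::real). ?H * ennreal (h * (1 - lam ^ ?n)) \<le> ennreal (real ?n) * emeasure lborel C"
    using le2 by (auto simp: eventually_at_right_field intro!: exI[of _ 1])
  ultimately show ?thesis
    by (simp add: tendsto_upperbound power_0_left)
qed

section \<open>The surface area measure of a polytope\<close>

lemma support_fun_upper:
  fixes K :: "'a::euclidean_space set"
  assumes "bounded K" "x \<in> K"
  shows "u \<bullet> x \<le> support_fun K u"
proof -
  obtain B where B: "\<And>y. y \<in> K \<Longrightarrow> norm y \<le> B" using assms(1) by (auto simp: bounded_iff)
  have "bdd_above ((\<lambda>y. u \<bullet> y) ` K)"
  proof (rule bdd_aboveI2)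
    fix y assume "y \<in> K"
    then show "u \<bullet> y \<le> norm u * B"
      using B norm_cauchy_schwarz[of u y] mult_left_mono[of "norm y" B "norm u"] by force
  qed
  then show ?thesis unfolding support_fun_def using assms(2) by (rule cSUP_upper2) auto
qed

lemma support_fun_least:
  fixes K :: "'a::euclidean_space set"
  assumes "K \<noteq> {}" "\<And>x. x \<in> K \<Longrightarrow> u \<bullet> x \<le> b"
  shows "support_fun K u \<le> b"
  unfolding support_fun_def using assms by (intro cSUP_least) auto

lemma origin_polytopeD:
  assumes "origin_polytope K"
  shows "compact K" "convex K" "closed K" "bounded K" "0 \<in> K" "K \<noteq> {}"
  using assms interior_subset[of K]
  by (auto simp: origin_polytope_def polytope_imp_compact polytope_imp_convex polytope_imp_closed polytope_imp_bounded)

lemma support_fun_nonneg: "origin_polytope K \<Longrightarrow> 0 \<le> support_fun K u"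
  using support_fun_upper[of K 0 u] by (simp add: origin_polytopeD)

lemma support_fun_pos:
  assumes "origin_polytope K" "u \<noteq> 0"
  shows "0 < support_fun K u"
proof -
  obtain e where e: "e > 0" "cball 0 e \<subseteq> K"
    using assms(1) by (auto simp: origin_polytope_def mem_interior_cball)
  have "(e / norm u) *\<^sub>R u \<in> K" using e assms(2) by (intro subsetD[OF e(2)]) simp
  then have "u \<bullet> ((e / norm u) *\<^sub>R u) \<le> support_fun K u"
    by (intro support_fun_upper origin_polytopeD assms)
  moreover have "u \<bullet> ((e / norm u) *\<^sub>R u) = e * norm u"
    using assms(2) by (simp add: power2_norm_eq_inner[symmetric] power2_eq_square)
  ultimately show ?thesis using e assms(2) by (smt (verit) mult_pos_pos zero_less_norm_iff)
qed

lemma support_fun_scaleR: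
  assumes "origin_polytope K" "0 \<le> t"
  shows "support_fun K (t *\<^sub>R u) = t * support_fun K u"
proof (rule antisym)
  note K = origin_polytopeD[OF assms(1)]
  have *: "support_fun K (s *\<^sub>R v) \<le> s * support_fun K v" if "0 \<le> s" for s v
    using that by (intro support_fun_least K) (auto intro!: mult_left_mono support_fun_upper K)
  show "support_fun K (t *\<^sub>R u) \<le> t * support_fun K u" using * assms(2) .
  show "t * support_fun K u \<le> support_fun K (t *\<^sub>R u)"
  proof (cases "t = 0")
    case False
    then show ?thesis using *[of "1/t" "t *\<^sub>R u"] assms(2) by (simp add: field_simps)
  qed (simp add: support_fun_nonneg[OF assms(1)])
qed

lemma continuous_support_fun:
  fixes K :: "'a::euclidean_space set"
  assumes "origin_polytope K"
  shows "continuous_on UNIV (support_fun K)"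
proof -
  note K = origin_polytopeD[OF assms]
  obtain B where B: "\<And>y. y \<in> K \<Longrightarrow> norm y \<le> B" using K(4) by (auto simp: bounded_iff)
  have B0: "0 \<le> B" using B[OF K(5)] by simp
  have *: "support_fun K x \<le> support_fun K y + B * dist x y" for x y
  proof (rule support_fun_least[OF K(6)])
    fix z assume z: "z \<in> K"
    have "x \<bullet> z = y \<bullet> z + (x - y) \<bullet> z" by (simp add: inner_diff_left)
    also have "\<dots> \<le> support_fun K y + norm (x - y) * norm z"
      by (intro add_mono support_fun_upper K z norm_cauchy_schwarz)
    also have "\<dots> \<le> support_fun K y + norm (x - y) * B"
      by (intro add_left_mono mult_left_mono B z) simp
    finally show "x \<bullet> z \<le> support_fun K y + B * dist x y" by (simp add: dist_norm mult.commute)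
  qed
  have "B-lipschitz_on UNIV (support_fun K)"
  proof (rule lipschitz_onI)
    show "dist (support_fun K x) (support_fun K y) \<le> B * dist x y" for x y
      using *[of x y] *[of y x] by (auto simp: dist_real_def dist_commute)
  qed (rule B0)
  then show ?thesis by (rule lipschitz_on_continuous_on)
qed

text \<open>Replacing the right-hand side of each inequality that describes \<open>K\<close> by the value of the support
  function makes the description tight, which removes the ambiguity of two constraints with the
  same normal.\<close>

lemma origin_polytope_facets:
  fixes K :: "'a::euclidean_space set"
  assumes "origin_polytope K"
  obtains U where "finite U" "\<And>u. u \<in> U \<Longrightarrow> norm u = 1"
    "K = {x. \<forall>u\<in>U. u \<bullet> x \<le> support_fun K u}"
proof -
  note K = origin_polytopeD[OF assms]
  have "polyhedron K" using assms by (simp add: origin_polytope_def polytope_imp_polyhedron)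
  then obtain F where F: "finite F" "K = \<Inter>F" "\<forall>h\<in>F. \<exists>a b. a \<noteq> 0 \<and> h = {x. a \<bullet> x \<le> b}"
    by (auto simp: polyhedron_def)
  then obtain a b where ab: "\<And>h. h \<in> F \<Longrightarrow> a h \<noteq> 0 \<and> h = {x. a h \<bullet> x \<le> b h}" by metis
  define v where "v h = a h /\<^sub>R norm (a h)" for h
  have "K = {x. \<forall>u\<in>v ` F. u \<bullet> x \<le> support_fun K u}"
  proof (intro equalityI subsetI CollectI ballI)
    fix x assume x: "x \<in> {x. \<forall>u\<in>v ` F. u \<bullet> x \<le> support_fun K u}"
    have "x \<in> h" if h: "h \<in> F" for h
    proof -
      have n: "norm (a h) > 0" using ab[OF h] by simp
      have "v h \<bullet> x \<le> support_fun K (v h)" using x h by auto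
      also have "\<dots> \<le> b h / norm (a h)"
      proof (rule support_fun_least[OF K(6)])
        fix y assume "y \<in> K"
        then have "a h \<bullet> y \<le> b h" using F(2) ab[OF h] h by blast
        then show "v h \<bullet> y \<le> b h / norm (a h)" using n by (simp add: v_def divide_simps)
      qed
      finally have "a h \<bullet> x \<le> b h" using n by (simp add: v_def divide_simps)
      then show ?thesis using ab[OF h] by blast
    qed
    then show "x \<in> K" using F(2) by blast
  qed (auto intro: support_fun_upper K)
  moreover have "norm u = 1" if "u \<in> v ` F" for u
    using that ab by (auto simp: v_def)
  ultimately show thesis using F(1) that[of "v ` F"] by blast
qed

lemma hausdorff_measure_mono: "A \<subseteq> B \<Longrightarrow> hausdorff_measure k A \<le> hausdorff_measure k B"
  unfolding hausdorff_measure_def hausdorff_pre_def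
  by (intro SUP_mono' INF_superset_mono) auto

lemma hausdorff_pre_Un:
  fixes A B :: "'a::euclidean_space set"
  assumes "0 \<le> \<delta>"
  shows "hausdorff_pre k \<delta> (A \<union> B) \<le> hausdorff_pre k \<delta> A + hausdorff_pre k \<delta> B"
proof -
  have *: "hausdorff_pre k \<delta> (A \<union> B) \<le> (\<Sum>i. hausdorff_weight k (V i)) + (\<Sum>i. hausdorff_weight k (W i))"
    if V: "A \<subseteq> (\<Union>i. V i)" "\<forall>i. bounded (V i) \<and> diameter (V i) \<le> \<delta>"
      and W: "B \<subseteq> (\<Union>i. W i)" "\<forall>i. bounded (W i) \<and> diameter (W i) \<le> \<delta>" for V W :: "nat \<Rightarrow> 'a set"
  proof -
    define Z where "Z = case_sum V W"
    let ?f = "\<lambda>i. hausdorff_weight k (Z i)"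
    have "A \<union> B \<subseteq> (\<Union>i. Z i)"
    proof
      fix x assume "x \<in> A \<union> B"
      then obtain i where "x \<in> V i \<or> x \<in> W i" using V W by blast
      then have "x \<in> Z (Inl i) \<or> x \<in> Z (Inr i)" by (simp add: Z_def)
      then show "x \<in> (\<Union>i. Z i)" by blast
    qed
    then have "hausdorff_pre k \<delta> (A \<union> B) \<le> (\<integral>\<^sup>+ i. ?f i \<partial>count_space UNIV)"
      using V W assms by (intro hausdorff_pre_countable) (auto simp: Z_def split: sum.split)
    also have "\<dots> = (\<integral>\<^sup>+ i. ?f i * indicator (range Inl) i + ?f i * indicator (range Inr) i \<partial>count_space UNIV)"
      by (intro nn_integral_cong, rename_tac i, case_tac i) (auto simp: indicator_def)
    also have "\<dots> = (\<integral>\<^sup>+ i. ?f i \<partial>count_space (range Inl)) + (\<integral>\<^sup>+ i. ?f i \<partial>count_space (range Inr))"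
      by (subst nn_integral_add) (auto simp: nn_integral_count_space_indicator)
    also have "\<dots> = (\<integral>\<^sup>+ i. ?f (Inl i) \<partial>count_space UNIV) + (\<integral>\<^sup>+ i. ?f (Inr i) \<partial>count_space UNIV)"
      by (intro arg_cong2[where f="(+)"] nn_integral_bij_count_space[symmetric] inj_on_imp_bij_betw) auto
    finally show ?thesis by (simp add: Z_def nn_integral_count_space_nat)
  qed
  have approx: "\<exists>V. X \<subseteq> (\<Union>i. V i) \<and> (\<forall>i. bounded (V i) \<and> diameter (V i) \<le> \<delta>) \<and>
      (\<Sum>i. hausdorff_weight k (V i)) \<le> hausdorff_pre k \<delta> X + ennreal e"
    if "0 < e" "hausdorff_pre k \<delta> X < top" for e and X :: "'a set"
  proof -
    have "hausdorff_pre k \<delta> X < hausdorff_pre k \<delta> X + ennreal e"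
      using that by (simp add: ennreal_less_zero_iff less_top)
    then show ?thesis
      unfolding hausdorff_pre_def[of k \<delta> X] INF_less_iff by (auto intro: less_imp_le)
  qed
  show ?thesis
  proof (rule ennreal_le_epsilon)
    fix e :: real assume e: "0 < e" and fin: "hausdorff_pre k \<delta> A + hausdorff_pre k \<delta> B < top"
    obtain V W where V: "A \<subseteq> (\<Union>i. V i)" "\<forall>i. bounded (V i) \<and> diameter (V i) \<le> \<delta>"
        "(\<Sum>i. hausdorff_weight k (V i)) \<le> hausdorff_pre k \<delta> A + ennreal (e/2)"
      and W: "B \<subseteq> (\<Union>i. W i)" "\<forall>i. bounded (W i) \<and> diameter (W i) \<le> \<delta>"
        "(\<Sum>i. hausdorff_weight k (W i)) \<le> hausdorff_pre k \<delta> B + ennreal (e/2)"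
      using approx[of "e/2" A] approx[of "e/2" B] e fin by auto
    have "hausdorff_pre k \<delta> (A \<union> B)
        \<le> (hausdorff_pre k \<delta> A + ennreal (e/2)) + (hausdorff_pre k \<delta> B + ennreal (e/2))"
      using *[OF V(1,2) W(1,2)] add_mono[OF V(3) W(3)] by (rule order_trans)
    also have "\<dots> = hausdorff_pre k \<delta> A + hausdorff_pre k \<delta> B + (ennreal (e/2) + ennreal (e/2))"
      by (simp only: ac_simps)
    also have "ennreal (e/2) + ennreal (e/2) = ennreal e" using e by (simp flip: ennreal_plus)
    finally show "hausdorff_pre k \<delta> (A \<union> B) \<le> hausdorff_pre k \<delta> A + hausdorff_pre k \<delta> B + ennreal e" .
  qed
qed

lemma hausdorff_measure_null_iff: "hausdorff_measure k A = 0 \<longleftrightarrow> (\<forall>\<delta>>0. hausdorff_pre k \<delta> A = 0)"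
  by (auto simp: hausdorff_measure_def SUP_eq_iff bot_ennreal[symmetric] SUP_bot_conv simp del: bot_ennreal)

text \<open>For the pairwise intersections of the facets of a polytope.\<close>

lemma hausdorff_measure_null_Union:
  fixes A :: "'i \<Rightarrow> 'a::euclidean_space set"
  assumes "finite I" "\<And>i. i \<in> I \<Longrightarrow> hausdorff_measure k (A i) = 0"
  shows "hausdorff_measure k (\<Union>i\<in>I. A i) = 0"
  using assms
proof (induction I)
  case empty
  have "hausdorff_pre k \<delta> ({}::'a set) \<le> 0" if "\<delta> > 0" for \<delta>
    using hausdorff_pre_countable[of "{}::nat set" "{}::'a set" "\<lambda>_. {}" \<delta> k] that by simp
  then show ?case by (simp add: hausdorff_measure_null_iff)
next
  case (insert i I)
  have "hausdorff_pre k \<delta> (A i \<union> (\<Union>i\<in>I. A i)) \<le> 0" if "\<delta> > 0" for \<delta>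
    using hausdorff_pre_Un[of \<delta> k "A i" "\<Union>i\<in>I. A i"] insert that
    by (simp add: hausdorff_measure_null_iff)
  then show ?case by (simp add: hausdorff_measure_null_iff)
qed

text \<open>A measure built from a set function that is not countably additive is 0, so the inequality holds
  whether or not additivity has been established.\<close>

lemma emeasure_surface_area_measure_le:
  fixes K :: "'a::euclidean_space set"
  assumes "X \<in> sets (surface_area_measure K)"
  shows "emeasure (surface_area_measure K) X
    \<le> hausdorff_measure (DIM('a) - 1) {x \<in> frontier K. \<exists>u\<in>X. outer_unit_normal K x u}"
  unfolding surface_area_measure_def by (simp add: emeasure_measure_of_conv)

lemma sets_surface_area_measure:
  fixes K :: "'a::euclidean_space set"
  shows "sets (surface_area_measure K) = sets (restrict_space borel (sphere 0 1))"
  unfolding surface_area_measure_def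
  using sets.space_closed[of "restrict_space borel (sphere 0 1 :: 'a set)"]
    sets.sigma_sets_eq[of "restrict_space borel (sphere 0 1 :: 'a set)"]
  by (simp add: space_restrict_space)

lemma space_surface_area_measure: "space (surface_area_measure K) = sphere 0 1"
  using sets_eq_imp_space_eq[OF sets_surface_area_measure] by (simp add: space_restrict_space)

text \<open>If \<open>u\<close> is the only active constraint at \<open>x\<close>, then \<open>K\<close> is a half-space near \<open>x\<close>. Moving from \<open>x\<close> a
  little in the direction \<open>v - u\<close> stays in that half-space, so \<open>v \<bullet> (v - u) \<le> 0\<close> for each outer unit
  normal \<open>v\<close>, which forces \<open>v = u\<close>.\<close>

lemma outer_unit_normal_eq_or_two_active:
  fixes K :: "'a::euclidean_space set"
  assumes K: "origin_polytope K" and U: "finite U" "\<And>u. u \<in> U \<Longrightarrow> norm u = 1"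
    "K = {x. \<forall>u\<in>U. u \<bullet> x \<le> support_fun K u}"
    and x: "x \<in> frontier K" "outer_unit_normal K x v"
  shows "v \<in> U \<and> v \<bullet> x = support_fun K v \<or>
    (\<exists>u\<in>U. \<exists>w\<in>U. u \<noteq> w \<and> u \<bullet> x = support_fun K u \<and> w \<bullet> x = support_fun K w)"
proof -
  note K' = origin_polytopeD[OF K]
  have xK: "x \<in> K" using x(1) K'(3) by (simp add: frontier_def)
  have nv: "norm v = 1" and v: "\<And>y. y \<in> K \<Longrightarrow> v \<bullet> (y - x) \<le> 0" using x(2) by (auto simp: outer_unit_normal_def)
  have vx: "v \<bullet> x = support_fun K v"
  proof (rule antisym)
    show "v \<bullet> x \<le> support_fun K v" by (intro support_fun_upper K' xK)
    show "support_fun K v \<le> v \<bullet> x" using v by (intro support_fun_least K') (auto simp: inner_diff_right)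
  qed
  define A where "A = {u\<in>U. u \<bullet> x = support_fun K u}"
  define Q where "Q = (\<Inter>w\<in>U - A. {z. w \<bullet> z < support_fun K w})"
  have "open Q" unfolding Q_def using U(1) by (intro open_INT finite_Diff ballI open_halfspace_lt)
  moreover have "x \<in> Q"
  proof -
    have "w \<bullet> x < support_fun K w" if "w \<in> U - A" for w
      using that support_fun_upper[OF K'(4) xK, of w] by (auto simp: A_def)
    then show ?thesis by (auto simp: Q_def)
  qed
  ultimately obtain e where e: "e > 0" "ball x e \<subseteq> Q" using openE by blast
  have inK: "x + d \<in> K" if "norm d < e" "\<And>u. u \<in> A \<Longrightarrow> u \<bullet> d \<le> 0" for d
  proof -
    have "x + d \<in> Q" using that(1) by (intro subsetD[OF e(2)]) (simp add: dist_norm)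
    then have "u \<bullet> (x + d) \<le> support_fun K u" if "u \<in> U" for u
      using that \<open>\<And>u. u \<in> A \<Longrightarrow> u \<bullet> d \<le> 0\<close>[of u]
      by (cases "u \<in> A") (auto simp: A_def Q_def inner_add_right less_imp_le)
    then show ?thesis using U(3) by blast
  qed
  have "A \<noteq> {}"
  proof
    assume "A = {}"
    have "ball x e \<subseteq> K"
    proof
      fix y assume "y \<in> ball x e"
      then show "y \<in> K" using inK[of "y - x"] \<open>A = {}\<close> by (simp add: dist_norm norm_minus_commute)
    qed
    then have "x \<in> interior K" using e(1) mem_interior by blast
    then show False using x(1) by (simp add: frontier_def)
  qed
  then obtain u where u: "u \<in> A" by blast
  show ?thesis
  proof (cases "A = {u}")
    case True
    have nu: "norm u = 1" using u U(2) by (auto simp: A_def)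
    have uv: "u \<bullet> v \<le> 1" using norm_cauchy_schwarz[of u v] nu nv by simp
    have uu: "u \<bullet> u = 1" and vv: "v \<bullet> v = 1" using nu nv by (auto simp: norm_eq_1)
    \<comment> \<open>A step \<open>s\<close> with \<open>2 * s < e\<close> stays inside the ball, as \<open>v - u\<close> has norm at most 2.\<close>
    define s where "s = e / 4"
    have "norm (s *\<^sub>R (v - u)) \<le> s * 2"
      using e norm_triangle_ineq4[of v u] nu nv by (auto simp: s_def)
    then have "norm (s *\<^sub>R (v - u)) < e" using e by (simp add: s_def)
    moreover have "u \<bullet> (s *\<^sub>R (v - u)) \<le> 0"
      using uv uu e by (simp add: inner_diff_right s_def mult_nonneg_nonpos)
    ultimately have "x + s *\<^sub>R (v - u) \<in> K" using inK True by blast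
    from v[OF this] have "s * (1 - u \<bullet> v) \<le> 0" using vv by (simp add: inner_diff_right inner_commute)
    then have "u \<bullet> v \<ge> 1" using e by (simp add: s_def mult_le_0_iff)
    then have "(u - v) \<bullet> (u - v) \<le> 0" using uu vv by (simp add: inner_diff_left inner_diff_right inner_commute)
    then have "u = v" using inner_ge_zero[of "u - v"] by (metis antisym inner_eq_zero_iff right_minus_eq)
    then show ?thesis using u by (auto simp: A_def)
  next
    case False
    then obtain w where "w \<in> A" "w \<noteq> u" using u by blast
    then show ?thesis using u by (auto simp: A_def)
  qed
qed

text \<open>The cones over the facets lie in \<open>K\<close> and overlap in null sets: a common point is the same multiple of
  a point in either facet, hence lies in the hyperplane where \<open>u / h u\<close> and \<open>v / h v\<close> agree. The
  mass of the surface area measure sits on the finitely many facet normals.\<close>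

lemma nn_integral_support_surface_le:
  fixes K :: "'a::euclidean_space set"
  assumes K: "origin_polytope K" and dim: "2 \<le> DIM('a)"
  shows "(\<integral>\<^sup>+ u. ennreal (support_fun K u) \<partial>surface_area_measure K)
    \<le> ennreal (real DIM('a) * measure lebesgue K)"
proof -
  let ?n = "DIM('a)" and ?S = "surface_area_measure K" and ?h = "support_fun K"
  note K' = origin_polytopeD[OF K]
  obtain U where U: "finite U" "\<And>u. u \<in> U \<Longrightarrow> norm u = 1" "K = {x. \<forall>u\<in>U. u \<bullet> x \<le> ?h u}"
    using origin_polytope_facets[OF K] by blast
  have hpos: "?h u > 0" if "u \<in> U" for u using U(2)[OF that] by (intro support_fun_pos K) auto
  define F where "F u = K \<inter> {x. u \<bullet> x = ?h u}" for u
  define cone where "cone A = (\<lambda>(t, x). t *\<^sub>R x) ` ({0..1::real} \<times> A)" for A :: "'a set"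
  have compF: "compact (F u)" for u
    unfolding F_def by (intro compact_Int_closed K' closed_hyperplane)
  have comp_cone: "compact (cone A)" if "compact A" for A
    unfolding cone_def
    by (intro compact_continuous_image compact_Times that) (auto simp: case_prod_beta intro!: continuous_intros)
  have cone_sub: "cone (F u) \<subseteq> K" for u
  proof
    fix z assume "z \<in> cone (F u)"
    then obtain t x where "0 \<le> t" "t \<le> 1" "x \<in> K" "z = t *\<^sub>R x" by (auto simp: cone_def F_def)
    then show "z \<in> K" using convexD_alt[OF K'(2,5), of x t] by simp
  qed
  have meet: "negligible (cone (F u) \<inter> cone (F v))" if uv: "u \<in> U" "v \<in> U" "u \<noteq> v" for u v
  proof -
    define a where "a = u /\<^sub>R ?h u - v /\<^sub>R ?h v"
    have "a \<noteq> 0"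
    proof
      assume "a = 0"
      then have eq: "u /\<^sub>R ?h u = v /\<^sub>R ?h v" by (simp add: a_def)
      then have "norm (u /\<^sub>R ?h u) = norm (v /\<^sub>R ?h v)" by simp
      then have "?h u = ?h v" using uv U(2) hpos[OF uv(1)] hpos[OF uv(2)] by simp
      then show False using eq uv hpos[OF uv(1)] by simp
    qed
    moreover have "cone (F u) \<inter> cone (F v) \<subseteq> {z. a \<bullet> z = 0}"
    proof
      fix z assume "z \<in> cone (F u) \<inter> cone (F v)"
      then obtain t x s y where z: "0 \<le> t" "x \<in> F u" "z = t *\<^sub>R x" "0 \<le> s" "y \<in> F v" "z = s *\<^sub>R y"
        by (auto simp: cone_def)
      have uz: "u \<bullet> z = t * ?h u" "v \<bullet> z = s * ?h v" using z(2,5) by (simp add: z(3) F_def, simp add: z(6) F_def)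
      have "v \<bullet> z \<le> t * ?h v" using z(1,2) unfolding z(3)
        by (auto simp: F_def intro!: mult_left_mono support_fun_upper K')
      then have st: "s \<le> t" using uz(2) hpos[OF uv(2)] by simp
      have "u \<bullet> z \<le> s * ?h u" using z(4,5) unfolding z(6)
        by (auto simp: F_def intro!: mult_left_mono support_fun_upper K')
      then have "t \<le> s" using uz(1) hpos[OF uv(1)] by simp
      then have "t = s" using st by simp
      then show "z \<in> {z. a \<bullet> z = 0}" using uz hpos[OF uv(1)] hpos[OF uv(2)]
        by (simp add: a_def inner_diff_left field_simps)
    qed
    ultimately show ?thesis by (metis negligible_hyperplane negligible_subset)
  qed
  have bad: "hausdorff_measure (?n - 1) (F u \<inter> F v) = 0" if uv: "u \<in> U" "v \<in> U" "u \<noteq> v" for u v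
  proof -
    have comp: "compact (F u \<inter> F v)" using compF by (intro compact_Int)
    have "negligible (cone (F u \<inter> F v))"
      by (rule negligible_subset[OF meet[OF uv]]) (auto simp: cone_def)
    moreover have "cone (F u \<inter> F v) \<in> sets borel" using comp_cone[OF comp] by (simp add: borel_compact)
    ultimately have "emeasure lborel (cone (F u \<inter> F v)) = 0"
      by (auto simp: negligible_iff_null_sets null_sets_def)
    then have "hausdorff_measure (?n - 1) (F u \<inter> F v) * ennreal (?h u) \<le> 0"
      using cone_over_hausdorff_bound[OF U(2)[OF uv(1)] hpos[OF uv(1)] comp _ cone_def dim] by (auto simp: F_def)
    then show ?thesis using hpos[OF uv(1)] by simp
  qed
  define Bad where "Bad = (\<Union>i\<in>{i\<in>U \<times> U. fst i \<noteq> snd i}. F (fst i) \<inter> F (snd i))"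
  have Bad0: "hausdorff_measure (?n - 1) Bad = 0"
    unfolding Bad_def using U(1) bad by (intro hausdorff_measure_null_Union) auto
  have front: "x \<in> K" if "x \<in> frontier K" for x using that K'(3) by (simp add: frontier_def)
  have cases: "v \<in> U \<and> x \<in> F v \<or> x \<in> Bad" if x: "x \<in> frontier K" "outer_unit_normal K x v" for x v
    using outer_unit_normal_eq_or_two_active[OF K U x] front[OF x(1)] by (fastforce simp: F_def Bad_def)
  have Usph: "U \<subseteq> sphere 0 1" using U(2) by auto
  have sets_fin: "A \<in> sets ?S" if "A \<subseteq> U" for A
  proof -
    have "finite A" using that U(1) finite_subset by blast
    then have "A \<in> sets borel" by (simp add: finite_imp_closed borel_closed)
    then show ?thesis using that Usph by (auto simp: sets_surface_area_measure sets_restrict_space_iff)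
  qed
  have "sphere 0 1 - U \<in> sets ?S"
    using sets.compl_sets[OF sets_fin[of U]] by (simp add: space_surface_area_measure)
  moreover have "emeasure ?S (sphere 0 1 - U) \<le> hausdorff_measure (?n - 1) Bad"
    by (rule order_trans[OF emeasure_surface_area_measure_le[OF calculation] hausdorff_measure_mono]) (use cases in blast)
  ultimately have "sphere 0 1 - U \<in> null_sets ?S" using Bad0 by (auto simp: null_sets_def)
  then have AE: "AE u in ?S. u \<in> U"
    by (rule AE_I') (auto simp: space_surface_area_measure)
  have facet: "ennreal (?h v) * emeasure ?S {v} \<le> ennreal (real ?n * measure lebesgue (cone (F v)))" if v: "v \<in> U" for v
  proof -
    have "emeasure ?S {v} \<le> hausdorff_measure (?n - 1) {x \<in> frontier K. \<exists>u\<in>{v}. outer_unit_normal K x u}"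
      using v by (intro emeasure_surface_area_measure_le sets_fin) auto
    also have "\<dots> \<le> hausdorff_measure (?n - 1) (F v)"
    proof (intro hausdorff_measure_mono subsetI)
      fix x assume "x \<in> {x \<in> frontier K. \<exists>u\<in>{v}. outer_unit_normal K x u}"
      then have x: "x \<in> frontier K" "outer_unit_normal K x v" by auto
      have "?h v \<le> v \<bullet> x" using x(2)
        by (intro support_fun_least K') (auto simp: outer_unit_normal_def inner_diff_right)
      then show "x \<in> F v" using front[OF x(1)] support_fun_upper[OF K'(4) front[OF x(1)], of v] by (auto simp: F_def)
    qed
    finally have "ennreal (?h v) * emeasure ?S {v} \<le> hausdorff_measure (?n - 1) (F v) * ennreal (?h v)"
      by (subst mult.commute) (intro mult_right_mono, auto)
    also have "\<dots> \<le> ennreal (real ?n) * emeasure lborel (cone (F v))"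
      by (rule cone_over_hausdorff_bound[OF U(2)[OF v] hpos[OF v] compF _ cone_def dim]) (auto simp: F_def)
    also have "emeasure lborel (cone (F v)) = emeasure lebesgue (cone (F v))"
      using comp_cone[OF compF] by (simp add: borel_compact)
    also have "\<dots> = ennreal (measure lebesgue (cone (F v)))"
      by (rule emeasure_eq_measure2[OF lmeasurable_compact[OF comp_cone[OF compF]]])
    finally show ?thesis by (simp add: ennreal_mult')
  qed
  have "(\<integral>\<^sup>+ u. ennreal (?h u) \<partial>?S) = (\<integral>\<^sup>+ u. (\<Sum>v\<in>U. ennreal (?h v) * indicator {v} u) \<partial>?S)"
  proof (intro nn_integral_cong_AE eventually_mono[OF AE])
    fix u assume u: "u \<in> U"
    have "(\<Sum>v\<in>U. ennreal (?h v) * indicator {v} u) = (\<Sum>v\<in>U. if v = u then ennreal (?h v) else 0)"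
      by (intro sum.cong) (auto simp: indicator_def)
    then show "ennreal (?h u) = (\<Sum>v\<in>U. ennreal (?h v) * indicator {v} u)" using u U(1) by simp
  qed
  also have "\<dots> = (\<Sum>v\<in>U. ennreal (?h v) * emeasure ?S {v})"
    using sets_fin by (subst nn_integral_sum) (auto intro!: sum.cong nn_integral_cmult_indicator)
  also have "\<dots> \<le> (\<Sum>v\<in>U. ennreal (real ?n * measure lebesgue (cone (F v))))"
    by (intro sum_mono facet)
  also have "\<dots> = ennreal (real ?n * (\<Sum>v\<in>U. measure lebesgue (cone (F v))))"
    by (simp add: sum_ennreal sum_distrib_left)
  also have "(\<Sum>v\<in>U. measure lebesgue (cone (F v))) = measure lebesgue (\<Union>v\<in>U. cone (F v))"
    using meet comp_cone[OF compF] U(1)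
    by (intro measure_negligible_finite_Union_image[symmetric]) (auto simp: pairwise_def intro: lmeasurable_compact)
  also have "ennreal (real ?n * measure lebesgue (\<Union>v\<in>U. cone (F v))) \<le> ennreal (real ?n * measure lebesgue K)"
  proof (intro ennreal_leI mult_left_mono measure_mono_fmeasurable)
    show "(\<Union>v\<in>U. cone (F v)) \<in> sets lebesgue"
      using U(1) lmeasurable_compact[OF comp_cone[OF compF]] by (intro sets.finite_UN) auto
    show "K \<in> lmeasurable" by (rule lmeasurable_compact[OF K'(1)])
  qed (use cone_sub in auto)
  finally show ?thesis .
qed

text \<open>The support function is itself an admissible test function.\<close>

theorem Lp_polytope_energy_le:
  fixes K :: "'a::euclidean_space set"
  assumes pK: "is_Lp_polytope_of p f K" and dim: "2 \<le> DIM('a)"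
  shows "(LINT x|lebesgue. support_fun K (- grad f x) powr p) \<le> measure lebesgue K"
proof -
  let ?h = "support_fun K" and ?S = "surface_area_measure K"
  have K: "origin_polytope K" using pK by (simp add: is_Lp_polytope_of_def)
  have h_borel[measurable]: "?h \<in> borel_measurable borel"
    using continuous_support_fun[OF K] by (rule borel_measurable_continuous_onI)
  have "sets ?S = sets (restrict_space borel (sphere 0 1))" by (rule sets_surface_area_measure)
  then have meas: "g \<in> borel_measurable ?S" if "g \<in> borel_measurable borel" for g :: "'a \<Rightarrow> real"
    using that measurable_restrict_space1 measurable_cong_sets by blast
  have meas': "g \<in> borel_measurable ?S" if "g \<in> borel_measurable borel" for g :: "'a \<Rightarrow> ennreal"
    using that measurable_restrict_space1 measurable_cong_sets sets_surface_area_measure by blast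
  have "real DIM('a) * (LINT x|lebesgue. ?h (- grad f x) powr p)
      = (LINT u|Lp_surface_area_measure p K. ?h u powr p)"
    using pK continuous_support_fun[OF K] support_fun_nonneg[OF K] support_fun_scaleR[OF K]
    unfolding is_Lp_polytope_of_def by blast
  also have "\<dots> = enn2real (\<integral>\<^sup>+ u. ennreal (?h u powr p) \<partial>Lp_surface_area_measure p K)"
    unfolding Lp_surface_area_measure_def by (intro integral_eq_nn_integral) (auto intro!: meas)
  also have "(\<integral>\<^sup>+ u. ennreal (?h u powr p) \<partial>Lp_surface_area_measure p K)
     = (\<integral>\<^sup>+ u. ennreal (?h u powr (1 - p)) * ennreal (?h u powr p) \<partial>?S)"
    unfolding Lp_surface_area_measure_def by (intro nn_integral_density meas') auto
  also have "\<dots> = (\<integral>\<^sup>+ u. ennreal (?h u) \<partial>?S)"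
  proof (intro nn_integral_cong)
    fix u assume "u \<in> space ?S"
    then have "u \<noteq> 0" by (auto simp: space_surface_area_measure)
    then have "?h u > 0" by (rule support_fun_pos[OF K])
    then show "ennreal (?h u powr (1 - p)) * ennreal (?h u powr p) = ennreal (?h u)"
      by (simp flip: ennreal_mult' powr_add)
  qed
  also have "enn2real \<dots> \<le> real DIM('a) * measure lebesgue K"
    by (rule enn2real_leI[OF _ nn_integral_support_surface_le[OF K dim]]) simp
  finally show ?thesis by simp
qed

section \<open>Monotone rearrangement on an interval\<close>

text \<open>The monotone map that carries the measure with density \<open>a\<close> to the one with density \<open>b\<close>, both
  normalised on \<open>{-R..R}\<close>. Clamping the argument makes it continuous on the whole line, so that
  compositions never leave the domain.\<close>

definition transport :: "real \<Rightarrow> (real \<Rightarrow> real) \<Rightarrow> (real \<Rightarrow> real) \<Rightarrow> real \<Rightarrow> real" where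
  "transport R a b s = (THE t. t \<in> {-R..R} \<and>
     integral {-R..R} a * integral {-R..t} b = integral {-R..R} b * integral {-R..max (-R) (min R s)} a)"

definition transport_deriv :: "real \<Rightarrow> (real \<Rightarrow> real) \<Rightarrow> (real \<Rightarrow> real) \<Rightarrow> real \<Rightarrow> real" where
  "transport_deriv R a b s =
     a s / integral {-R..R} a * (integral {-R..R} b / b (transport R a b s))"

lemma integral_pos_continuous:
  fixes f :: "real \<Rightarrow> real"
  assumes "continuous_on UNIV f" "\<And>x. 0 < f x" "u < v"
  shows "0 < integral {u..v} f"
proof -
  have cf: "continuous_on {u..v} f" using assms(1) continuous_on_subset by blast
  then obtain m where m: "m \<in> {u..v}" "\<And>x. x \<in> {u..v} \<Longrightarrow> f m \<le> f x"
    using continuous_attains_inf[of "{u..v}" f] assms(3) by auto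
  have "0 < f m * (v - u)" using assms by simp
  also have "\<dots> = integral {u..v} (\<lambda>_. f m)" using assms(3) by simp
  also have "\<dots> \<le> integral {u..v} f"
    using m by (intro integral_le integrable_continuous_real cf) auto
  finally show ?thesis .
qed

lemma integral_upto_strict_mono:
  fixes f :: "real \<Rightarrow> real"
  assumes f: "continuous_on UNIV f" "\<And>x. 0 < f x" and "u \<le> s" "s < t"
  shows "integral {u..s} f < integral {u..t} f"
proof -
  have "f integrable_on {u..t}"
    using f(1) by (intro integrable_continuous_real) (rule continuous_on_subset, auto)
  then have "integral {u..s} f + integral {s..t} f = integral {u..t} f"
    using assms by (intro Henstock_Kurzweil_Integration.integral_combine) auto
  then show ?thesis using integral_pos_continuous[OF f \<open>s < t\<close>] by simp
qed

lemma continuous_on_compose_pair: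
  assumes "continuous_on UNIV h" "continuous_on S f" "continuous_on S g"
  shows "continuous_on S (\<lambda>z. h (f z, g z))"
  by (rule continuous_on_compose2[OF assms(1) continuous_on_Pair[OF assms(2,3)]]) simp

lemma continuous_on_section:
  assumes "continuous_on UNIV (\<lambda>(p, s). f p s)"
  shows "continuous_on S (f p)"
proof -
  have "continuous_on S (\<lambda>s. (\<lambda>(p, s). f p s) (p, s))"
    by (rule continuous_on_compose2[OF assms])
       (intro continuous_on_Pair continuous_on_const continuous_on_id, simp)
  then show ?thesis by simp
qed

text \<open>Continuity in the upper limit and in the parameter at once follows from the theorem for fixed
  limits after replacing \<open>a p z\<close> by \<open>a p (min z s)\<close>, which only adds a rectangle.\<close>

lemma continuous_integral_upto_param:
  fixes a :: "'p::topological_space \<Rightarrow> real \<Rightarrow> real"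
  assumes a: "continuous_on UNIV (\<lambda>(p, s). a p s)"
    and R: "0 < R"
  shows "continuous_on UNIV (\<lambda>(p, s). integral {-R..max (-R) (min R s)} (a p))"
proof -
  let ?c = "\<lambda>s::real. max (-R) (min R s)"
  note cont = continuous_on_section[OF a]
  have eq: "integral {-R..?c s} (a p) = integral {-R..R} (\<lambda>z. a p (min z (?c s))) - (R - ?c s) * a p (?c s)" for p s
  proof -
    have c: "-R \<le> ?c s" "?c s \<le> R" using R by auto
    have "(\<lambda>z. a p (min z (?c s))) integrable_on {-R..R}"
      by (intro integrable_continuous_real continuous_on_compose2[OF cont[of UNIV]] continuous_intros) auto
    then have "integral {-R..R} (\<lambda>z. a p (min z (?c s))) =
       integral {-R..?c s} (\<lambda>z. a p (min z (?c s))) + integral {?c s..R} (\<lambda>z. a p (min z (?c s)))"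
      using c by (intro Henstock_Kurzweil_Integration.integral_combine[symmetric]) auto
    also have "integral {-R..?c s} (\<lambda>z. a p (min z (?c s))) = integral {-R..?c s} (a p)"
      by (intro integral_cong) auto
    also have "integral {?c s..R} (\<lambda>z. a p (min z (?c s))) = integral {?c s..R} (\<lambda>z. a p (?c s))"
      by (intro integral_cong) auto
    finally show ?thesis using c by simp
  qed
  have "continuous_on UNIV (\<lambda>q. integral (cbox (-R) R) (\<lambda>z. a (fst q) (min z (?c (snd q)))))"
    by (rule integral_continuous_on_param, unfold case_prod_beta)
       (rule continuous_on_compose2[OF a[unfolded case_prod_beta], of _ "\<lambda>w. (fst (fst w), min (snd w) (?c (snd (fst w))))", simplified],
        auto intro!: continuous_intros)
  moreover have "continuous_on UNIV (\<lambda>q. a (fst q) (?c (snd q)))"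
    by (rule continuous_on_compose2[OF a[unfolded case_prod_beta], of _ "\<lambda>w. (fst w, ?c (snd w))", simplified])
       (auto intro!: continuous_intros)
  ultimately show ?thesis
    unfolding eq case_prod_beta by (auto intro!: continuous_intros)
qed

text \<open>For a strictly increasing function, lying on one side of the root is an open condition on the
  parameter.\<close>

lemma continuous_root:
  fixes \<Phi> :: "'z::topological_space \<Rightarrow> real \<Rightarrow> real"
  assumes cont: "\<And>t. t \<in> {u..v} \<Longrightarrow> continuous_on UNIV (\<lambda>z. \<Phi> z t)"
    and mono: "\<And>z s t. u \<le> s \<Longrightarrow> s < t \<Longrightarrow> t \<le> v \<Longrightarrow> \<Phi> z s < \<Phi> z t"
    and root: "\<And>z. g z \<in> {u..v} \<and> \<Phi> z (g z) = 0"
  shows "continuous_on UNIV g"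
  unfolding continuous_on_def
proof (intro ballI order_tendstoI)
  fix z0 l assume l: "l < g z0"
  show "\<forall>\<^sub>F z in at z0 within UNIV. l < g z"
  proof (cases "l < u")
    case True
    then show ?thesis using root by (auto intro!: always_eventually intro: less_le_trans)
  next
    case False
    then have l': "l \<in> {u..v}" using l root[of z0] by auto
    have "\<Phi> z0 l < 0" using mono[of l "g z0" z0] l l' root[of z0] by auto
    then have "\<forall>\<^sub>F z in at z0 within UNIV. \<Phi> z l < 0"
      using cont[OF l'] unfolding continuous_on_def by (intro order_tendstoD) auto
    then show ?thesis
    proof (rule eventually_mono)
      fix z assume z: "\<Phi> z l < 0"
      show "l < g z"
      proof (rule ccontr)
        assume "\<not> l < g z"
        then have "g z = l \<or> g z < l" by auto
        then show False using z mono[of "g z" l z] root[of z] l' by auto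
      qed
    qed
  qed
next
  fix z0 l assume l: "g z0 < l"
  show "\<forall>\<^sub>F z in at z0 within UNIV. g z < l"
  proof (cases "v < l")
    case True
    then show ?thesis using root by (auto intro!: always_eventually intro: le_less_trans)
  next
    case False
    then have l': "l \<in> {u..v}" using l root[of z0] by auto
    have "\<Phi> z0 l > 0" using mono[of "g z0" l z0] l l' root[of z0] by auto
    then have "\<forall>\<^sub>F z in at z0 within UNIV. \<Phi> z l > 0"
      using cont[OF l'] unfolding continuous_on_def by (intro order_tendstoD) auto
    then show ?thesis
    proof (rule eventually_mono)
      fix z assume z: "\<Phi> z l > 0"
      show "g z < l"
      proof (rule ccontr)
        assume "\<not> g z < l"
        then have "g z = l \<or> g z > l" by auto
        then show False using z mono[of l "g z" z] root[of z] l' by auto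
      qed
    qed
  qed
qed

lemma transport_root:
  assumes a: "continuous_on UNIV a" "\<And>s. 0 < a s" and b: "continuous_on UNIV b" "\<And>s. 0 < b s" and R: "0 < R"
  shows "transport R a b s \<in> {-R..R} \<and>
     integral {-R..R} a * integral {-R..transport R a b s} b
       = integral {-R..R} b * integral {-R..max (-R) (min R s)} a"
  unfolding transport_def
proof (rule theI')
  let ?c = "max (-R) (min R s)"
  have A0: "0 < integral {-R..R} a" and B0: "0 < integral {-R..R} b"
    using R by (auto intro!: integral_pos_continuous a b)
  have cont: "continuous_on {-R..R} (\<lambda>t. integral {-R..R} a * integral {-R..t} b)"
    by (intro continuous_intros indefinite_integral_continuous_1 integrable_continuous_real continuous_on_subset[OF b(1)]) auto
  have Ac: "0 \<le> integral {-R..?c} a \<and> integral {-R..?c} a \<le> integral {-R..R} a"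
  proof
    show "0 \<le> integral {-R..?c} a"
      using a(2) by (intro integral_nonneg integrable_continuous_real continuous_on_subset[OF a(1)]) (auto intro: less_imp_le)
    show "integral {-R..?c} a \<le> integral {-R..R} a"
      using a(2) by (intro integral_subset_le integrable_continuous_real continuous_on_subset[OF a(1)]) (auto intro: less_imp_le R)
  qed
  have "\<exists>t. -R \<le> t \<and> t \<le> R \<and> integral {-R..R} a * integral {-R..t} b = integral {-R..R} b * integral {-R..?c} a"
  proof (rule IVT')
    show "integral {-R..R} a * integral {-R..-R} b \<le> integral {-R..R} b * integral {-R..?c} a"
      using Ac B0 by simp
    show "integral {-R..R} b * integral {-R..?c} a \<le> integral {-R..R} a * integral {-R..R} b"
      using Ac B0 by (simp add: mult.commute)
  qed (use R cont in auto)
  moreover have "s = t" if "s \<in> {-R..R}" "t \<in> {-R..R}"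
    "integral {-R..R} a * integral {-R..s} b = integral {-R..R} a * integral {-R..t} b" for s t
    using that A0 integral_upto_strict_mono[OF b, of "-R" s t] integral_upto_strict_mono[OF b, of "-R" t s]
    by (cases s t rule: linorder_cases) auto
  ultimately show "\<exists>!t. t \<in> {-R..R} \<and> integral {-R..R} a * integral {-R..t} b = integral {-R..R} b * integral {-R..?c} a"
    by (metis atLeastAtMost_iff)
qed

text \<open>The transport map is the root of a function that depends continuously on the densities and is
  strictly increasing.\<close>

lemma continuous_transport:
  fixes a b :: "'p::topological_space \<Rightarrow> real \<Rightarrow> real"
  assumes a: "continuous_on UNIV (\<lambda>(p, s). a p s)" "\<And>p s. 0 < a p s"
    and b: "continuous_on UNIV (\<lambda>(p, s). b p s)" "\<And>p s. 0 < b p s" and R: "0 < R"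
  shows "continuous_on UNIV (\<lambda>(p, s). transport R (a p) (b p) s)"
proof -
  note a1 = continuous_on_section[OF a(1)] and b1 = continuous_on_section[OF b(1)]
  have upto: "continuous_on UNIV (\<lambda>p. integral {-R..t} (f p))"
    if "continuous_on UNIV (\<lambda>(p, s). f p s)" "t \<in> {-R..R}" for f :: "'p \<Rightarrow> real \<Rightarrow> real" and t
    using continuous_on_compose_pair[OF continuous_integral_upto_param[OF that(1) R]
        continuous_on_id continuous_on_const[of UNIV t]] that(2) by simp
  have upto2: "continuous_on UNIV (\<lambda>z. integral {-R..t} (f (fst z)))"
    if "continuous_on UNIV (\<lambda>(p, s). f p s)" "t \<in> {-R..R}" for f :: "'p \<Rightarrow> real \<Rightarrow> real" and t
    by (rule continuous_on_compose2[OF upto[OF that]]) (auto intro!: continuous_intros)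
  have "continuous_on UNIV (\<lambda>z. transport R (a (fst z)) (b (fst z)) (snd z))"
  proof (rule continuous_root[where u="-R" and v=R and \<Phi>="\<lambda>z t. integral {-R..R} (a (fst z)) * integral {-R..t} (b (fst z))
       - integral {-R..R} (b (fst z)) * integral {-R..max (-R) (min R (snd z))} (a (fst z))"])
    fix t assume "t \<in> {-R..R}"
    then show "continuous_on UNIV (\<lambda>z. integral {-R..R} (a (fst z)) * integral {-R..t} (b (fst z))
       - integral {-R..R} (b (fst z)) * integral {-R..max (-R) (min R (snd z))} (a (fst z)))"
      using R continuous_integral_upto_param[OF a(1) R, unfolded case_prod_beta]
      by (intro continuous_intros upto2 a b) auto
  next
    fix z :: "'p \<times> real" and s t assume "-R \<le> s" "s < t" "t \<le> R"
    then have "integral {-R..s} (b (fst z)) < integral {-R..t} (b (fst z))"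
      by (intro integral_upto_strict_mono b1 b)
    moreover have "0 < integral {-R..R} (a (fst z))"
      using R by (intro integral_pos_continuous a1 a) auto
    ultimately show "integral {-R..R} (a (fst z)) * integral {-R..s} (b (fst z))
       - integral {-R..R} (b (fst z)) * integral {-R..max (-R) (min R (snd z))} (a (fst z))
     < integral {-R..R} (a (fst z)) * integral {-R..t} (b (fst z))
       - integral {-R..R} (b (fst z)) * integral {-R..max (-R) (min R (snd z))} (a (fst z))" by simp
  next
    fix z :: "'p \<times> real"
    show "transport R (a (fst z)) (b (fst z)) (snd z) \<in> {-R..R} \<and>
       integral {-R..R} (a (fst z)) * integral {-R..transport R (a (fst z)) (b (fst z)) (snd z)} (b (fst z))
       - integral {-R..R} (b (fst z)) * integral {-R..max (-R) (min R (snd z))} (a (fst z)) = 0"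
      using transport_root[OF a1 a(2) b1 b(2) R, of "fst z" "fst z" "snd z"] by simp
  qed
  then show ?thesis by (simp add: case_prod_beta)
qed

text \<open>Divide the difference quotient of \<open>B \<circ> t\<close> by that of \<open>B\<close>. In contrast to the inverse function rule
  this also works at the ends of an interval.\<close>

lemma has_real_derivative_implicit:
  fixes B t :: "real \<Rightarrow> real"
  assumes B: "(B has_real_derivative d) (at (t s0) within T)" "d \<noteq> 0"
    and t: "continuous (at s0 within S) t" "\<And>s. s \<in> S \<Longrightarrow> t s \<in> T"
    and inj: "\<And>s. s \<in> S \<Longrightarrow> t s \<noteq> t s0 \<Longrightarrow> B (t s) \<noteq> B (t s0)"
    and Bt: "((\<lambda>s. B (t s)) has_real_derivative D) (at s0 within S)"
  shows "(t has_real_derivative D / d) (at s0 within S)"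
proof -
  define q where "q y = (if y = t s0 then d else (B y - B (t s0)) / (y - t s0))" for y
  have "((\<lambda>y. (B y - B (t s0)) / (y - t s0)) \<longlongrightarrow> d) (at (t s0) within T)"
    using B(1) by (simp add: has_field_derivative_iff)
  then have "(q \<longlongrightarrow> d) (at (t s0) within T)"
    by (rule Lim_transform_eventually) (auto simp: q_def eventually_at_filter)
  then have "continuous (at (t s0) within T) q"
    by (simp add: continuous_within q_def)
  then have "continuous (at (t s0) within t ` S) q"
    by (rule continuous_within_subset) (use t(2) in auto)
  then have "continuous (at s0 within S) (\<lambda>s. q (t s))"
    using continuous_within_compose[OF t(1)] by (simp add: o_def)
  then have qt: "((\<lambda>s. q (t s)) \<longlongrightarrow> d) (at s0 within S)"
    by (simp add: continuous_within q_def)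
  have "((\<lambda>s. (B (t s) - B (t s0)) / (s - s0)) \<longlongrightarrow> D) (at s0 within S)"
    using Bt by (simp add: has_field_derivative_iff)
  from tendsto_divide[OF this qt B(2)]
  have "((\<lambda>s. (t s - t s0) / (s - s0)) \<longlongrightarrow> D / d) (at s0 within S)"
  proof (rule Lim_transform_eventually)
    show "\<forall>\<^sub>F s in at s0 within S. (B (t s) - B (t s0)) / (s - s0) / q (t s) = (t s - t s0) / (s - s0)"
      unfolding eventually_at_filter
    proof (rule always_eventually, intro allI impI)
      fix s assume "s \<in> S"
      then show "(B (t s) - B (t s0)) / (s - s0) / q (t s) = (t s - t s0) / (s - s0)"
        using inj[of s] by (auto simp: q_def)
    qed
  qed
  then show ?thesis by (simp add: has_field_derivative_iff)
qed

lemma transport_has_derivative: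
  assumes a: "continuous_on UNIV a" "\<And>s. 0 < a s" and b: "continuous_on UNIV b" "\<And>s. 0 < b s"
    and R: "0 < R" and s: "s \<in> {-R..R}"
  shows "(transport R a b has_real_derivative transport_deriv R a b s) (at s within {-R..R})"
proof -
  let ?t = "transport R a b" and ?A0 = "integral {-R..R} a" and ?B0 = "integral {-R..R} b"
  have A0: "0 < ?A0" and B0: "0 < ?B0" using R by (auto intro!: integral_pos_continuous a b)
  have t: "?t z \<in> {-R..R}" "integral {-R..?t z} b = ?B0 / ?A0 * integral {-R..max (-R) (min R z)} a" for z
    using transport_root[OF a b R, of z] A0 by (auto simp: field_simps)
  have cont: "continuous_on UNIV ?t"
  proof -
    have "continuous_on UNIV (\<lambda>(p::real, s). transport R a b s)"
      using a b R
      by (intro continuous_transport) (auto simp: case_prod_beta intro!: continuous_intros continuous_on_compose2[of UNIV a] continuous_on_compose2[of UNIV b])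
    from continuous_on_section[OF this] show ?thesis .
  qed
  have "(?t has_real_derivative (?B0 / ?A0 * a s) / b (?t s)) (at s within {-R..R})"
  proof (rule has_real_derivative_implicit[where B="\<lambda>y. integral {-R..y} b" and T="{-R..R}"])
    show "((\<lambda>y. integral {-R..y} b) has_real_derivative b (?t s)) (at (?t s) within {-R..R})"
      using t by (intro integral_has_real_derivative continuous_on_subset[OF b(1)]) auto
    show "b (?t s) \<noteq> 0" using b(2)[of "?t s"] by simp
    show "continuous (at s within {-R..R}) ?t"
      using cont by (meson continuous_on_eq_continuous_within continuous_within_subset UNIV_I subset_UNIV)
    show "?t z \<in> {-R..R}" for z by (rule t)
    show "integral {-R..?t z} b \<noteq> integral {-R..?t s} b" if "?t z \<noteq> ?t s" for z
      using that integral_upto_strict_mono[OF b, of "-R" "?t z" "?t s"] integral_upto_strict_mono[OF b, of "-R" "?t s" "?t z"]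
        t(1)[of s] t(1)[of z] by (cases "?t z" "?t s" rule: linorder_cases) auto
    have "((\<lambda>z. ?B0 / ?A0 * integral {-R..z} a) has_real_derivative ?B0 / ?A0 * a s) (at s within {-R..R})"
      using s by (intro DERIV_cmult integral_has_real_derivative continuous_on_subset[OF a(1)]) auto
    then show "((\<lambda>z. integral {-R..?t z} b) has_real_derivative ?B0 / ?A0 * a s) (at s within {-R..R})"
      by (rule has_field_derivative_transform_within[OF _ zero_less_one s]) (simp add: t(2))
  qed
  then show ?thesis by (simp add: transport_deriv_def mult_ac)
qed

lemma transport_endpoints:
  assumes a: "continuous_on UNIV a" "\<And>s. 0 < a s" and b: "continuous_on UNIV b" "\<And>s. 0 < b s" and R: "0 < R"
  shows "transport R a b (-R) = -R" "transport R a b R = R"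
proof -
  let ?t = "transport R a b"
  have A0: "0 < integral {-R..R} a" using R by (auto intro!: integral_pos_continuous a b)
  show "?t (-R) = -R"
    using transport_root[OF a b R, of "-R"] integral_upto_strict_mono[OF b, of "-R" "-R" "?t (-R)"] A0 R
    by (cases "?t (-R) > -R") auto
  show "?t R = R"
    using transport_root[OF a b R, of R] integral_upto_strict_mono[OF b, of "-R" "?t R" R] A0 R
    by (cases "?t R < R") auto
qed

lemma integral_transport_substitution:
  assumes a: "continuous_on UNIV a" "\<And>s. 0 < a s" and b: "continuous_on UNIV b" "\<And>s. 0 < b s"
    and R: "0 < R" and \<phi>: "continuous_on UNIV \<phi>"
  shows "integral {-R..R} (\<lambda>s. transport_deriv R a b s * \<phi> (transport R a b s)) = integral {-R..R} \<phi>"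
proof -
  have "((\<lambda>s. transport_deriv R a b s *\<^sub>R \<phi> (transport R a b s)) has_integral
      integral {transport R a b (-R)..transport R a b R} \<phi>) {-R..R}"
    using R transport_root[OF a b R]
    by (intro has_integral_substitution[where c="-R" and d=R] transport_has_derivative a b continuous_on_subset[OF \<phi>])
       (auto simp: transport_endpoints[OF a b R])
  then show ?thesis unfolding transport_endpoints[OF a b R] by (auto intro: integral_unique)
qed

section \<open>The Knothe map\<close>

text \<open>Sets the coordinate \<open>b\<close> of \<open>x\<close> to \<open>s\<close>, for a basis vector \<open>b\<close>.\<close>

definition upd :: "'a::euclidean_space \<Rightarrow> 'a \<Rightarrow> real \<Rightarrow> 'a" where
  "upd x b s = x + (s - x \<bullet> b) *\<^sub>R b"

text \<open>Integrates out the listed coordinates over \<open>{-R..R}\<close>. The result still is a function on the whole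
  space, which spares a change of type when the dimension drops.\<close>

primrec marg :: "real \<Rightarrow> 'a::euclidean_space list \<Rightarrow> ('a \<Rightarrow> real) \<Rightarrow> 'a \<Rightarrow> real" where
  "marg R [] \<phi> x = \<phi> x"
| "marg R (b # bs) \<phi> x = integral {-R..R} (\<lambda>s. marg R bs \<phi> (upd x b s))"

text \<open>The coordinate \<open>b\<close> of the image comes from the monotone rearrangement between the conditional
  densities of \<open>F\<close> given the earlier coordinates of \<open>x\<close> and of \<open>G\<close> given those of \<open>y\<close>.\<close>

definition knothe_step :: "real \<Rightarrow> ('a::euclidean_space \<Rightarrow> real) \<Rightarrow> ('a \<Rightarrow> real) \<Rightarrow> 'a list \<Rightarrow> 'a \<Rightarrow> 'a \<Rightarrow> 'a \<Rightarrow> 'a" where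
  "knothe_step R F G bs b x y = upd y b
     (transport R (\<lambda>s. marg R bs F (upd x b s)) (\<lambda>s. marg R bs G (upd y b s)) (x \<bullet> b))"

text \<open>The list holds the coordinates still to be determined, and \<open>y\<close> carries the coordinates of the image
  found so far.\<close>

primrec knothe :: "real \<Rightarrow> ('a::euclidean_space \<Rightarrow> real) \<Rightarrow> ('a \<Rightarrow> real) \<Rightarrow> 'a list \<Rightarrow> 'a \<Rightarrow> 'a \<Rightarrow> 'a" where
  "knothe R F G [] x y = y"
| "knothe R F G (b # bs) x y = knothe R F G bs x (knothe_step R F G bs b x y)"

text \<open>The diagonal entry \<open>c\<close> of the derivative of the Knothe map: the partial derivative of the
  coordinate \<open>c\<close> of the image with respect to the coordinate \<open>c\<close> of \<open>x\<close>.\<close>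

primrec knothe_deriv :: "real \<Rightarrow> ('a::euclidean_space \<Rightarrow> real) \<Rightarrow> ('a \<Rightarrow> real) \<Rightarrow> 'a list \<Rightarrow> 'a \<Rightarrow> 'a \<Rightarrow> 'a \<Rightarrow> real" where
  "knothe_deriv R F G [] c x y = 1"
| "knothe_deriv R F G (b # bs) c x y =
     (if c = b
      then transport_deriv R (\<lambda>s. marg R bs F (upd x b s)) (\<lambda>s. marg R bs G (upd y b s)) (x \<bullet> b)
      else knothe_deriv R F G bs c x (knothe_step R F G bs b x y))"

lemma upd_inner: "b \<in> Basis \<Longrightarrow> c \<in> Basis \<Longrightarrow> upd x b s \<bullet> c = (if c = b then s else x \<bullet> c)"
  by (auto simp: upd_def inner_add_left inner_Basis)

lemma upd_same [simp]: "upd x b (x \<bullet> b) = x"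
  by (simp add: upd_def)

lemma upd_upd [simp]: "b \<in> Basis \<Longrightarrow> upd (upd x b s) b t = upd x b t"
  by (simp add: euclidean_eq_iff[where 'a='a] upd_inner)

lemma continuous_on_upd [continuous_intros]:
  assumes "continuous_on S f" "continuous_on S g"
  shows "continuous_on S (\<lambda>z. upd (f z) b (g z))"
  unfolding upd_def by (intro continuous_intros assms)

lemma continuous_marg:
  assumes "continuous_on UNIV \<phi>"
  shows "continuous_on UNIV (marg R bs \<phi>)"
proof (induction bs)
  case (Cons b bs)
  have "continuous_on UNIV (\<lambda>x. integral (cbox (-R) R) (\<lambda>s. marg R bs \<phi> (upd x b s)))"
    by (rule integral_continuous_on_param, unfold case_prod_beta)
       (rule continuous_on_compose2[OF Cons], auto intro!: continuous_intros)
  then show ?case by simp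
qed (use assms in simp)

lemma marg_section_continuous:
  "continuous_on UNIV \<phi> \<Longrightarrow> continuous_on S (\<lambda>s. marg R bs \<phi> (upd x b s))"
  by (rule continuous_on_compose2[OF continuous_marg, of \<phi> S "\<lambda>s. upd x b s"]) (auto intro!: continuous_intros)

lemma marg_pos:
  assumes "continuous_on UNIV \<phi>" "\<And>x. 0 < \<phi> x" "0 < R"
  shows "0 < marg R bs \<phi> x"
proof (induction bs arbitrary: x)
  case (Cons b bs)
  then show ?case using assms(3)
    by (auto intro!: integral_pos_continuous marg_section_continuous assms(1))
qed (use assms in simp)

lemma marg_cong:
  assumes "set bs \<subseteq> Basis" "distinct bs"
    and "\<And>x'. (\<And>c. c \<in> Basis \<Longrightarrow> c \<notin> set bs \<Longrightarrow> x' \<bullet> c = x \<bullet> c) \<Longrightarrow>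
           (\<And>c. c \<in> set bs \<Longrightarrow> x' \<bullet> c \<in> {-R..R}) \<Longrightarrow> \<phi> x' = \<psi> x'"
  shows "marg R bs \<phi> x = marg R bs \<psi> x"
  using assms
proof (induction bs arbitrary: x)
  case (Cons b bs)
  have b: "b \<in> Basis" "b \<notin> set bs" using Cons.prems by auto
  have "marg R bs \<phi> (upd x b s) = marg R bs \<psi> (upd x b s)" if s: "s \<in> {-R..R}" for s
  proof (rule Cons.IH)
    fix x' assume x': "\<And>c. c \<in> Basis \<Longrightarrow> c \<notin> set bs \<Longrightarrow> x' \<bullet> c = upd x b s \<bullet> c"
      "\<And>c. c \<in> set bs \<Longrightarrow> x' \<bullet> c \<in> {-R..R}"
    show "\<phi> x' = \<psi> x'"
    proof (rule Cons.prems(3))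
      show "x' \<bullet> c = x \<bullet> c" if "c \<in> Basis" "c \<notin> set (b # bs)" for c
        using x'(1)[of c] that b by (auto simp: upd_inner)
      show "x' \<bullet> c \<in> {-R..R}" if "c \<in> set (b # bs)" for c
        using x'(2)[of c] x'(1)[of b] b s that by (auto simp: upd_inner)
    qed
  qed (use Cons.prems in auto)
  then show ?case by (auto intro: integral_cong)
qed (auto)

lemma marg_agree:
  assumes "set bs \<subseteq> Basis" "\<And>c. c \<in> Basis \<Longrightarrow> c \<notin> set bs \<Longrightarrow> x \<bullet> c = x' \<bullet> c"
  shows "marg R bs \<phi> x = marg R bs \<phi> x'"
  using assms
proof (induction bs arbitrary: x x')
  case Nil
  then have "x = x'" by (auto intro: euclidean_eqI)
  then show ?case by simp
next
  case (Cons b bs)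
  have b: "b \<in> Basis" using Cons.prems by auto
  have "marg R bs \<phi> (upd x b s) = marg R bs \<phi> (upd x' b s)" for s
    using Cons.prems b by (intro Cons.IH) (auto simp: upd_inner)
  then show ?case by simp
qed

lemma knothe_other:
  "set bs \<subseteq> Basis \<Longrightarrow> c \<in> Basis \<Longrightarrow> c \<notin> set bs \<Longrightarrow> knothe R F G bs x y \<bullet> c = y \<bullet> c"
  by (induction bs arbitrary: y) (auto simp: upd_inner knothe_step_def)

context
  fixes R :: real and F G :: "'a::euclidean_space \<Rightarrow> real"
  assumes R: "0 < R" and F: "continuous_on UNIV F" "\<And>x. 0 < F x"
    and G: "continuous_on UNIV G" "\<And>x. 0 < G x"
begin

lemma transport_marg_root:
  "transport R (\<lambda>s. marg R bs F (upd x b s)) (\<lambda>s. marg R bs G (upd y b s)) s \<in> {-R..R}"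
  using transport_root[OF marg_section_continuous[OF F(1)] marg_pos[OF F R]
    marg_section_continuous[OF G(1)] marg_pos[OF G R] R] by blast

lemma knothe_in_cube:
  assumes "set bs \<subseteq> Basis" "distinct bs" "c \<in> set bs"
  shows "knothe R F G bs x y \<bullet> c \<in> {-R..R}"
  using assms
proof (induction bs arbitrary: y)
  case (Cons b bs)
  show ?case
  proof (cases "c = b")
    case True
    then show ?thesis using Cons.prems transport_marg_root[of bs x b y]
      by (simp add: knothe_other upd_inner knothe_step_def)
  next
    case False
    then show ?thesis using Cons by auto
  qed
qed simp

lemma continuous_knothe_step: "continuous_on UNIV (\<lambda>z. knothe_step R F G bs b (fst z) (snd z))"
proof -
  have "continuous_on UNIV (\<lambda>(p, s). transport R (\<lambda>s. marg R bs F (upd (fst p) b s))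
      (\<lambda>s. marg R bs G (upd (snd p) b s)) s)"
    by (rule continuous_transport; (unfold case_prod_beta)?; (intro marg_pos F G R)?;
      (rule continuous_on_compose2[OF continuous_marg[OF F(1)]] continuous_on_compose2[OF continuous_marg[OF G(1)]])?)
      (auto intro!: continuous_intros)
  from continuous_on_compose_pair[OF this continuous_on_id, where g = "\<lambda>z. fst z \<bullet> b"]
  have "continuous_on UNIV (\<lambda>z. transport R (\<lambda>s. marg R bs F (upd (fst z) b s))
      (\<lambda>s. marg R bs G (upd (snd z) b s)) (fst z \<bullet> b))"
    by (simp add: continuous_on_inner continuous_on_fst continuous_on_id)
  then show ?thesis
    unfolding knothe_step_def by (intro continuous_on_upd continuous_on_snd continuous_on_id)
qed

lemma continuous_knothe: "continuous_on UNIV (\<lambda>z. knothe R F G bs (fst z) (snd z))"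
proof (induction bs)
  case (Cons b bs)
  show ?case
    using continuous_on_compose_pair[OF Cons continuous_on_fst[OF continuous_on_id] continuous_knothe_step] by simp
qed (auto intro!: continuous_intros)

text \<open>Each factor is a quotient of consecutive marginals, so that the product over all coordinates
  telescopes.\<close>

lemma transport_deriv_marg:
  "transport_deriv R (\<lambda>s. marg R bs F (upd x b s)) (\<lambda>s. marg R bs G (upd y b s)) (x \<bullet> b)
    = marg R bs F x / marg R (b # bs) F x * (marg R (b # bs) G y / marg R bs G (knothe_step R F G bs b x y))"
  by (simp add: transport_deriv_def knothe_step_def)

lemma continuous_knothe_deriv:
  assumes "set bs \<subseteq> Basis"
  shows "continuous_on UNIV (\<lambda>z. knothe_deriv R F G bs c (fst z) (snd z))"
  using assms
proof (induction bs)
  case (Cons b bs)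
  note mF = continuous_on_compose2[OF continuous_marg[OF F(1)]] and mG = continuous_on_compose2[OF continuous_marg[OF G(1)]]
  have nz: "marg R bs' F x \<noteq> 0" "marg R bs' G x \<noteq> 0" for bs' x
    using marg_pos[OF F R, of bs' x] marg_pos[OF G R, of bs' x] by auto
  show ?case
  proof (cases "c = b")
    case True
    have "continuous_on UNIV (\<lambda>z. marg R bs F (fst z) / marg R (b # bs) F (fst z) * (marg R (b # bs) G (snd z) /
        marg R bs G (knothe_step R F G bs b (fst z) (snd z))))"
      by (intro continuous_on_mult continuous_on_divide mF mG ballI nz)
         (auto intro!: continuous_intros continuous_knothe_step)
    then show ?thesis using True transport_deriv_marg by simp
  next
    case False
    then show ?thesis
      using continuous_on_compose_pair[OF Cons.IH continuous_on_fst[OF continuous_on_id] continuous_knothe_step]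
        Cons.prems by simp
  qed
qed simp

lemma knothe_deriv_pos: "0 < knothe_deriv R F G bs c x y"
proof (induction bs arbitrary: y)
  case (Cons b bs)
  have "0 < integral {-R..R} (\<lambda>s. marg R bs F (upd x b s))" "0 < integral {-R..R} (\<lambda>s. marg R bs G (upd y b s))" for x y
    using R by (auto intro!: integral_pos_continuous marg_section_continuous marg_pos F G)
  then show ?case using Cons marg_pos[OF F R] marg_pos[OF G R] by (auto simp: transport_deriv_def)
qed simp

lemma prod_knothe_deriv:
  assumes "set bs \<subseteq> Basis" "distinct bs"
  shows "(\<Prod>c\<in>set bs. knothe_deriv R F G bs c x y)
     = F x / marg R bs F x * (marg R bs G y / G (knothe R F G bs x y))"
  using assms
proof (induction bs arbitrary: y)
  case Nil
  then show ?case using F(2)[of x] G(2)[of y] by simp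
next
  case (Cons b bs)
  let ?y = "knothe_step R F G bs b x y"
  have "(\<Prod>c\<in>set (b # bs). knothe_deriv R F G (b # bs) c x y)
     = knothe_deriv R F G (b # bs) b x y * (\<Prod>c\<in>set bs. knothe_deriv R F G bs c x ?y)"
    using Cons.prems by (simp, intro disjI2 prod.cong) auto
  also have "\<dots> = marg R bs F x / marg R (b # bs) F x * (marg R (b # bs) G y / marg R bs G ?y) *
      (F x / marg R bs F x * (marg R bs G ?y / G (knothe R F G bs x ?y)))"
    using Cons transport_deriv_marg[of bs x b y] by simp
  also have "\<dots> = F x / marg R (b # bs) F x * (marg R (b # bs) G y / G (knothe R F G (b # bs) x y))"
    using marg_pos[OF F R, of bs x] marg_pos[OF G R, of bs ?y] by simp
  finally show ?case .
qed

text \<open>The coordinates of the image determined before \<open>c\<close> do not see \<open>x \<bullet> c\<close>, because it has been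
  integrated out of the marginals that define them.\<close>

lemma knothe_has_derivative:
  assumes "set bs \<subseteq> Basis" "distinct bs" "c \<in> set bs" "x \<bullet> c \<in> {-R..R}"
  shows "((\<lambda>s. knothe R F G bs (upd x c s) y \<bullet> c) has_real_derivative knothe_deriv R F G bs c x y)
           (at (x \<bullet> c) within {-R..R})"
  using assms
proof (induction bs arbitrary: y)
  case (Cons b bs)
  have b: "b \<in> Basis" "b \<notin> set bs" "c \<in> Basis" using Cons.prems by auto
  let ?t = "transport R (\<lambda>s. marg R bs F (upd x b s)) (\<lambda>s. marg R bs G (upd y b s))"
  show ?case
  proof (cases "c = b")
    case True
    have "knothe R F G (b # bs) (upd x b s) y \<bullet> b = ?t s" for s
      using b Cons.prems by (simp add: knothe_other upd_inner knothe_step_def)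
    then show ?thesis using True Cons.prems R
      by (simp, intro transport_has_derivative marg_section_continuous marg_pos F G) auto
  next
    case False
    then have c: "c \<in> set bs" using Cons.prems by simp
    have "marg R bs F (upd (upd x c s) b z) = marg R bs F (upd x b z)" for s z
      using b c Cons.prems by (intro marg_agree) (auto simp: upd_inner)
    moreover have "upd x c s \<bullet> b = x \<bullet> b" for s using b False by (simp add: upd_inner)
    ultimately have "knothe R F G (b # bs) (upd x c s) y = knothe R F G bs (upd x c s) (knothe_step R F G bs b x y)" for s
      by (simp add: knothe_step_def)
    then show ?thesis using Cons False c by simp
  qed
qed simp

text \<open>By induction over the coordinates, each step being a substitution on the line. The factor of the
  transport derivative that depends on the image cancels the marginal of \<open>G\<close> which the induction
  hypothesis puts into the denominator.\<close>

lemma knothe_pushforward: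
  assumes "set bs \<subseteq> Basis" "distinct bs" and \<phi>: "continuous_on UNIV \<phi>"
  shows "marg R bs (\<lambda>x. F x * \<phi> (knothe R F G bs x y)) x
     = marg R bs F x / marg R bs G y * marg R bs (\<lambda>y. G y * \<phi> y) y"
  using assms(1,2)
proof (induction bs arbitrary: x y)
  case Nil
  then show ?case using G(2)[of y] by simp
next
  case (Cons b bs)
  have b: "b \<in> Basis" "b \<notin> set bs" using Cons.prems by auto
  define a where "a = (\<lambda>s. marg R bs F (upd x b s))"
  define g where "g = (\<lambda>s. marg R bs G (upd y b s))"
  define \<Phi> where "\<Phi> = (\<lambda>s. marg R bs (\<lambda>y. G y * \<phi> y) (upd y b s))"
  let ?t = "transport R a g"
  have a: "continuous_on UNIV a" "\<And>s. 0 < a s" and g: "continuous_on UNIV g" "\<And>s. 0 < g s"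
    unfolding a_def g_def by (intro marg_section_continuous marg_pos F G R)+
  have A0: "0 < integral {-R..R} a" and B0: "0 < integral {-R..R} g"
    using R by (auto intro!: integral_pos_continuous a g)
  have \<Phi>: "continuous_on UNIV \<Phi>" unfolding \<Phi>_def by (intro marg_section_continuous continuous_intros G \<phi>)
  have "marg R (b # bs) (\<lambda>x. F x * \<phi> (knothe R F G (b # bs) x y)) x
     = integral {-R..R} (\<lambda>s. marg R bs (\<lambda>x. F x * \<phi> (knothe R F G (b # bs) x y)) (upd x b s))" by simp
  also have "\<dots> = integral {-R..R} (\<lambda>s. integral {-R..R} a / integral {-R..R} g * (transport_deriv R a g s * \<Phi> (?t s)))"
  proof (rule integral_cong)
    fix s assume s: "s \<in> {-R..R}"
    have "marg R bs (\<lambda>x. F x * \<phi> (knothe R F G (b # bs) x y)) (upd x b s)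
       = marg R bs (\<lambda>x. F x * \<phi> (knothe R F G bs x (upd y b (?t s)))) (upd x b s)"
    proof (rule marg_cong)
      fix x' assume x': "\<And>c. c \<in> Basis \<Longrightarrow> c \<notin> set bs \<Longrightarrow> x' \<bullet> c = upd x b s \<bullet> c"
      have "x' \<bullet> b = s" using x'[of b] b by (simp add: upd_inner)
      moreover have "marg R bs F (upd x' b z) = marg R bs F (upd x b z)" for z
        using b x' Cons.prems by (intro marg_agree) (auto simp: upd_inner)
      ultimately show "F x' * \<phi> (knothe R F G (b # bs) x' y) = F x' * \<phi> (knothe R F G bs x' (upd y b (?t s)))"
        by (simp add: a_def g_def knothe_step_def)
    qed (use Cons.prems in auto)
    also have "\<dots> = a s / g (?t s) * \<Phi> (?t s)"
      using Cons by (simp add: a_def g_def \<Phi>_def)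
    also have "\<dots> = integral {-R..R} a / integral {-R..R} g * (transport_deriv R a g s * \<Phi> (?t s))"
      using A0 B0 by (simp add: transport_deriv_def)
    finally show "marg R bs (\<lambda>x. F x * \<phi> (knothe R F G (b # bs) x y)) (upd x b s)
      = integral {-R..R} a / integral {-R..R} g * (transport_deriv R a g s * \<Phi> (?t s))" .
  qed
  also have "\<dots> = integral {-R..R} a / integral {-R..R} g * integral {-R..R} \<Phi>"
    by (simp add: integral_transport_substitution[OF a g R \<Phi>])
  also have "\<dots> = marg R (b # bs) F x / marg R (b # bs) G y * marg R (b # bs) (\<lambda>y. G y * \<phi> y) y"
    by (simp add: a_def g_def \<Phi>_def)
  finally show ?case .
qed

end

section \<open>Iterated integrals over a cube\<close>

definition cube :: "real \<Rightarrow> 'a::euclidean_space set" where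
  "cube R = {x. \<forall>b\<in>Basis. x \<bullet> b \<in> {-R..R}}"

lemma cube_eq_cbox: "cube R = cbox (- R *\<^sub>R One) (R *\<^sub>R One)"
  by (auto simp: cube_def mem_box inner_sum_left inner_Basis sum.If_cases)

lemma cube_mono: "M \<le> R \<Longrightarrow> cube M \<subseteq> cube R"
  unfolding cube_def by force

lemma compact_cube: "compact (cube R)"
  by (simp add: cube_eq_cbox compact_cbox)

lemma cube_borel [measurable]: "cube R \<in> sets borel"
  by (simp add: cube_eq_cbox)

lemma bounded_on_cube:
  fixes \<phi> :: "'a::euclidean_space \<Rightarrow> real"
  assumes "continuous_on UNIV \<phi>"
  obtains C where "\<And>x. x \<in> cube R \<Longrightarrow> \<bar>\<phi> x\<bar> \<le> C"
  using compact_imp_bounded[OF compact_continuous_image[OF continuous_on_subset[OF assms subset_UNIV] compact_cube[of R]]]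
  by (auto simp: bounded_iff)

text \<open>Identifies functions on the basis with points, as in the description of Lebesgue measure as a
  product measure.\<close>

definition point_of :: "('a::euclidean_space \<Rightarrow> real) \<Rightarrow> 'a" where
  "point_of f = (\<Sum>b\<in>Basis. f b *\<^sub>R b)"

lemma point_of_inner [simp]: "b \<in> Basis \<Longrightarrow> point_of f \<bullet> b = f b"
  by (simp add: point_of_def inner_sum_left inner_Basis sum.If_cases if_distrib cong: if_cong)

lemma measurable_point_of_override [measurable]:
  "(\<lambda>f. point_of (\<lambda>c. if c \<in> J then f c else x c)) \<in> borel_measurable (\<Pi>\<^sub>M c\<in>J. lborel)"
  unfolding point_of_def
proof (intro borel_measurable_sum borel_measurable_scaleR)
  fix c :: 'a
  show "(\<lambda>f. if c \<in> J then f c else x c) \<in> borel_measurable (\<Pi>\<^sub>M c\<in>J. lborel)"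
    by (cases "c \<in> J") auto
qed auto

text \<open>Tonelli's theorem, one coordinate at a time. The coordinates outside \<open>bs\<close> are frozen at those
  of \<open>x\<close>.\<close>

lemma nn_integral_PiM_eq_marg:
  fixes \<phi> :: "'a::euclidean_space \<Rightarrow> real"
  assumes \<phi>: "continuous_on UNIV \<phi>" "\<And>x. 0 \<le> \<phi> x" and bs: "set bs \<subseteq> Basis" "distinct bs"
  shows "(\<integral>\<^sup>+ f. ennreal (\<phi> (point_of (\<lambda>b. if b \<in> set bs then f b else x \<bullet> b)) * indicator {f. \<forall>b\<in>set bs. f b \<in> {-R..R}} f)
            \<partial>(\<Pi>\<^sub>M b\<in>set bs. lborel)) = ennreal (marg R bs \<phi> x)"
  using bs
proof (induction bs arbitrary: x)
  case Nil
  have "point_of (\<lambda>b. x \<bullet> b) = x" by (simp add: point_of_def euclidean_representation)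
  then show ?case by (simp add: space_PiM emeasure_PiM_empty[unfolded PiE_def])
next
  case (Cons b bs)
  interpret product_sigma_finite "\<lambda>_::'a. lborel :: real measure" by standard
  have b: "b \<in> Basis" "b \<notin> set bs" using Cons.prems by auto
  have [measurable]: "\<phi> \<in> borel_measurable borel" using \<phi>(1) by (rule borel_measurable_continuous_onI)
  define H where "H f = ennreal (\<phi> (point_of (\<lambda>c. if c \<in> set (b # bs) then f c else x \<bullet> c)) *
       indicator {f. \<forall>c\<in>set (b # bs). f c \<in> {-R..R}} f)" for f
  have H: "H \<in> borel_measurable (\<Pi>\<^sub>M c\<in>insert b (set bs). lborel)"
  proof -
    have [measurable]: "(\<lambda>f. point_of (\<lambda>c. if c \<in> set (b # bs) then f c else x \<bullet> c)) \<in> borel_measurable (\<Pi>\<^sub>M c\<in>insert b (set bs). lborel)"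
      using measurable_point_of_override[of "set (b # bs)" "\<lambda>c. x \<bullet> c"] by simp
    have [measurable]: "Measurable.pred (\<Pi>\<^sub>M c\<in>insert b (set bs). lborel) (\<lambda>f. \<forall>c\<in>set (b # bs). f c \<in> {-R..R})"
      by (intro pred_intros_finite) auto
    show ?thesis unfolding H_def by measurable
  qed
  have step: "H (f(b := s)) = indicator {-R..R} s * ennreal (\<phi> (point_of (\<lambda>c. if c \<in> set bs then f c else upd x b s \<bullet> c)) *
       indicator {f. \<forall>c\<in>set bs. f c \<in> {-R..R}} f)" for f s
  proof -
    have "point_of (\<lambda>c. if c \<in> set (b # bs) then (f(b := s)) c else x \<bullet> c) = point_of (\<lambda>c. if c \<in> set bs then f c else upd x b s \<bullet> c)"
      unfolding point_of_def using b by (intro sum.cong) (auto simp: upd_inner)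
    moreover have "(\<forall>c\<in>set (b # bs). (f(b := s)) c \<in> {-R..R}) \<longleftrightarrow> s \<in> {-R..R} \<and> (\<forall>c\<in>set bs. f c \<in> {-R..R})"
      using b by auto
    ultimately show ?thesis unfolding H_def by (auto simp: indicator_def)
  qed
  have "(\<integral>\<^sup>+ f. H f \<partial>(\<Pi>\<^sub>M c\<in>set (b # bs). lborel)) = (\<integral>\<^sup>+ s. (\<integral>\<^sup>+ f. H (f(b := s)) \<partial>(\<Pi>\<^sub>M c\<in>set bs. lborel)) \<partial>lborel)"
    using b H by (simp add: product_nn_integral_insert_rev)
  also have "\<dots> = (\<integral>\<^sup>+ s. indicator {-R..R} s * ennreal (marg R bs \<phi> (upd x b s)) \<partial>lborel)"
  proof (intro nn_integral_cong)
    fix s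
    have "(\<lambda>f. ennreal (\<phi> (point_of (\<lambda>c. if c \<in> set bs then f c else upd x b s \<bullet> c)) *
       indicator {f. \<forall>c\<in>set bs. f c \<in> {-R..R}} f)) \<in> borel_measurable (\<Pi>\<^sub>M c\<in>set bs. lborel)"
    proof -
      have [measurable]: "Measurable.pred (\<Pi>\<^sub>M c\<in>set bs. lborel) (\<lambda>f. \<forall>c\<in>set bs. f c \<in> {-R..R})"
        by (intro pred_intros_finite) auto
      show ?thesis by measurable
    qed
    then show "(\<integral>\<^sup>+ f. H (f(b := s)) \<partial>(\<Pi>\<^sub>M c\<in>set bs. lborel)) = indicator {-R..R} s * ennreal (marg R bs \<phi> (upd x b s))"
      unfolding step using Cons by (subst nn_integral_cmult) auto
  qed
  also have "\<dots> = (\<integral>\<^sup>+ s. ennreal (indicator {-R..R} s * marg R bs \<phi> (upd x b s)) \<partial>lborel)"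
    by (intro nn_integral_cong) (auto simp: indicator_def)
  also have "\<dots> = ennreal (marg R (b # bs) \<phi> x)"
  proof (rule nn_integral_has_integral_lebesgue)
    have "0 \<le> marg R bs \<phi> y" for y
    proof (induction bs arbitrary: y)
      case (Cons c cs)
      then show ?case
        by (auto intro!: integral_nonneg integrable_continuous_real marg_section_continuous \<phi>)
    qed (simp add: \<phi>)
    then show "0 \<le> marg R bs \<phi> (upd x b s)" for s .
    show "((\<lambda>s. marg R bs \<phi> (upd x b s)) has_integral marg R (b # bs) \<phi> x) {-R..R}"
      by (simp add: integrable_integral integrable_continuous_real marg_section_continuous \<phi>)
  qed
  finally show ?case unfolding H_def .
qed

lemma nn_integral_cube_eq_marg:
  fixes \<phi> :: "'a::euclidean_space \<Rightarrow> real"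
  assumes \<phi>: "continuous_on UNIV \<phi>" "\<And>x. 0 \<le> \<phi> x" and bs: "set bs = Basis" "distinct bs"
  shows "(\<integral>\<^sup>+ x. ennreal (indicator (cube R) x * \<phi> x) \<partial>lborel) = ennreal (marg R bs \<phi> x0)"
proof -
  have [measurable]: "\<phi> \<in> borel_measurable borel" using \<phi>(1) by (rule borel_measurable_continuous_onI)
  have "(\<integral>\<^sup>+ x. ennreal (indicator (cube R) x * \<phi> x) \<partial>lborel)
     = (\<integral>\<^sup>+ f. ennreal (indicator (cube R) (point_of f) * \<phi> (point_of f)) \<partial>(\<Pi>\<^sub>M (b::'a)\<in>Basis. lborel))"
    unfolding point_of_def by (subst lborel_eq, subst nn_integral_distr) auto
  also have "\<dots> = (\<integral>\<^sup>+ f. ennreal (\<phi> (point_of (\<lambda>b. if b \<in> set bs then f b else x0 \<bullet> b)) * indicator {f. \<forall>b\<in>set bs. f b \<in> {-R..R}} f)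
            \<partial>(\<Pi>\<^sub>M b\<in>set bs. lborel))"
  proof -
    have "point_of (\<lambda>b. if b \<in> set bs then f b else x0 \<bullet> b) = point_of f" for f :: "'a \<Rightarrow> real"
      unfolding point_of_def using bs by (intro sum.cong) auto
    moreover have "indicator (cube R) (point_of f) = (indicator {f. \<forall>b\<in>set bs. f b \<in> {-R..R}} f :: real)" for f :: "'a \<Rightarrow> real"
      using bs by (auto simp: indicator_def cube_def)
    ultimately show ?thesis using bs by (simp add: mult.commute)
  qed
  also have "\<dots> = ennreal (marg R bs \<phi> x0)"
    using bs by (intro nn_integral_PiM_eq_marg \<phi>) auto
  finally show ?thesis .
qed

lemma integrable_cube:
  fixes \<phi> :: "'a::euclidean_space \<Rightarrow> real"
  assumes [measurable]: "\<phi> \<in> borel_measurable borel" and "\<And>x. x \<in> cube R \<Longrightarrow> \<bar>\<phi> x\<bar> \<le> C"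
  shows "integrable lborel (\<lambda>x. indicator (cube R) x * \<phi> x)"
proof -
  have fin: "emeasure lborel (cube R :: 'a set) < \<infinity>" using emeasure_compact_finite[OF compact_cube] by auto
  have "integrable lborel (\<lambda>x. indicator (cube R) x *\<^sub>R \<phi> x)"
    using assms fin by (intro integrableI_bounded_set_indicator[where B=C]) (auto intro!: AE_I2)
  then show ?thesis by simp
qed

lemma integrable_cube_continuous:
  fixes \<phi> :: "'a::euclidean_space \<Rightarrow> real"
  assumes "continuous_on UNIV \<phi>"
  shows "integrable lborel (\<lambda>x. indicator (cube R) x * \<phi> x)"
  using borel_integrable_compact[OF compact_cube continuous_on_subset[OF assms], of R] by (simp add: mult.commute)

lemma integral_cube_eq_marg:
  fixes \<phi> :: "'a::euclidean_space \<Rightarrow> real"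
  assumes \<phi>: "continuous_on UNIV \<phi>" "\<And>x. 0 \<le> \<phi> x" and bs: "set bs = Basis" "distinct bs" and R: "0 < R"
  shows "(LINT x|lborel. indicator (cube R) x * \<phi> x) = marg R bs \<phi> x0"
proof -
  have nn: "0 \<le> marg R cs \<phi> y" for cs y
  proof (induction cs arbitrary: y)
    case (Cons c cs)
    then show ?case
      by (auto intro!: integral_nonneg integrable_continuous_real marg_section_continuous \<phi>)
  qed (simp add: \<phi>)
  have "ennreal (LINT x|lborel. indicator (cube R) x * \<phi> x) = (\<integral>\<^sup>+ x. ennreal (indicator (cube R) x * \<phi> x) \<partial>lborel)"
    using integrable_cube_continuous[OF \<phi>(1)] \<phi>(2) by (intro nn_integral_eq_integral[symmetric]) auto
  also have "\<dots> = ennreal (marg R bs \<phi> x0)" by (rule nn_integral_cube_eq_marg[OF \<phi> bs])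
  finally show ?thesis using nn \<phi>(2) by (subst (asm) ennreal_inj) (auto intro!: integral_nonneg_AE)
qed

text \<open>Almost every line in direction \<open>b\<close> contains a point outside the null set \<open>N\<close>, and one such point
  determines the line.\<close>

lemma integral_zero_by_lines:
  fixes \<phi> :: "'a::euclidean_space \<Rightarrow> real"
  assumes \<phi>: "integrable lborel \<phi>" and b: "b \<in> Basis" and N: "N \<in> null_sets lborel"
    and line: "\<And>x. x \<notin> N \<Longrightarrow> (LINT s|lborel. \<phi> (upd x b s)) = 0"
  shows "integral\<^sup>L lborel \<phi> = 0"
proof -
  interpret product_sigma_finite "\<lambda>_::'a. lborel :: real measure" by standard
  let ?I = "Basis - {b}"
  have I: "finite ?I" "b \<notin> ?I" "insert b ?I = Basis" using b by auto
  have [measurable]: "(\<lambda>f. point_of f) \<in> borel_measurable (\<Pi>\<^sub>M b\<in>Basis. lborel)"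
    unfolding point_of_def by measurable
  have [measurable]: "\<phi> \<in> borel_measurable borel" using \<phi> by auto
  have [measurable]: "N \<in> sets borel" using N by auto
  have lb: "lborel = distr (\<Pi>\<^sub>M (b::'a)\<in>Basis. lborel) borel point_of"
    unfolding point_of_def[abs_def] by (rule lborel_eq)
  have upd_pt: "upd (point_of (f(b := s))) b t = point_of (f(b := t))" for f s t
    using b by (auto simp: euclidean_eq_iff[where 'a='a] upd_inner)
  have int: "integrable (\<Pi>\<^sub>M b\<in>insert b ?I. lborel) (\<lambda>f. \<phi> (point_of f))"
    using \<phi> unfolding I(3) by (subst (asm) lb, subst (asm) integrable_distr_eq) auto
  have "integral\<^sup>L lborel \<phi> = (LINT f|(\<Pi>\<^sub>M b\<in>insert b ?I. lborel). \<phi> (point_of f))"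
    unfolding I(3) by (subst lb, subst integral_distr) auto
  also have "\<dots> = (LINT f|(\<Pi>\<^sub>M b\<in>?I. lborel). (LINT s|lborel. \<phi> (point_of (f(b := s)))))"
    by (rule product_integral_insert[OF I(1,2) int])
  also have "\<dots> = 0"
  proof (rule integral_eq_zero_AE)
    have m: "(\<lambda>f. indicator N (point_of f) :: ennreal) \<in> borel_measurable (\<Pi>\<^sub>M b\<in>insert b ?I. lborel)"
      unfolding I(3) by measurable
    have "(\<integral>\<^sup>+ x. indicator N x \<partial>lborel) = (0::ennreal)" using N by auto
    then have "(\<integral>\<^sup>+ f. indicator N (point_of f) \<partial>(\<Pi>\<^sub>M b\<in>insert b ?I. lborel)) = 0"
      unfolding I(3) by (subst (asm) lb, subst (asm) nn_integral_distr) auto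
    then have "(\<integral>\<^sup>+ f. (\<integral>\<^sup>+ s. indicator N (point_of (f(b := s))) \<partial>lborel) \<partial>(\<Pi>\<^sub>M b\<in>?I. lborel)) = 0"
      using product_nn_integral_insert[OF I(1,2) m] by simp
    moreover have "(\<lambda>f. \<integral>\<^sup>+ s. indicator N (point_of (f(b := s))) \<partial>lborel) \<in> borel_measurable (\<Pi>\<^sub>M b\<in>?I. lborel)"
    proof -
      have "(\<lambda>(f, s). indicator N (point_of (f(b := s))) :: ennreal) \<in> borel_measurable ((\<Pi>\<^sub>M b\<in>?I. lborel) \<Otimes>\<^sub>M lborel)"
        using measurable_compose[OF measurable_add_dim m] by (simp add: case_prod_beta')
      then show ?thesis by (intro lborel.borel_measurable_nn_integral)
    qed
    ultimately have "AE f in (\<Pi>\<^sub>M b\<in>?I. lborel). (\<integral>\<^sup>+ s. indicator N (point_of (f(b := s))) \<partial>lborel) = 0"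
      by (subst (asm) nn_integral_0_iff_AE) auto
    then show "AE f in (\<Pi>\<^sub>M b\<in>?I. lborel). (LINT s|lborel. \<phi> (point_of (f(b := s)))) = 0"
    proof (rule eventually_mono)
      fix f assume f: "(\<integral>\<^sup>+ s. indicator N (point_of (f(b := s))) \<partial>lborel) = 0"
      have "\<exists>s. point_of (f(b := s)) \<notin> N"
      proof (rule ccontr)
        assume "\<not> ?thesis"
        then have "(\<integral>\<^sup>+ s. indicator N (point_of (f(b := s))) \<partial>lborel) = (\<integral>\<^sup>+ s. 1 \<partial>(lborel :: real measure))"
          by (intro nn_integral_cong) auto
        then show False using f by simp
      qed
      then obtain s where "point_of (f(b := s)) \<notin> N" by blast
      from line[OF this] show "(LINT s|lborel. \<phi> (point_of (f(b := s)))) = 0" by (simp only: upd_pt)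
    qed
  qed
  finally show ?thesis .
qed

section \<open>Piecewise affine functions and integration by parts\<close>

lemma GDERIV_unique:
  fixes f :: "'a::euclidean_space \<Rightarrow> real"
  assumes "GDERIV f x :> D" "GDERIV f x :> E"
  shows "D = E"
proof -
  have "(\<lambda>h. h \<bullet> D) = (\<lambda>h. h \<bullet> E)"
    using assms unfolding gderiv_def by (rule has_derivative_unique)
  then have "(D - E) \<bullet> D = (D - E) \<bullet> E" by metis
  then have "(D - E) \<bullet> (D - E) = 0" by (simp add: inner_diff_right)
  then show ?thesis by simp
qed

lemma grad_eq: "GDERIV f x :> D \<Longrightarrow> grad f x = D"
  unfolding grad_def by (rule the_equality) (auto intro: GDERIV_unique)

lemma GDERIV_line:
  assumes "GDERIV f (upd x b s) :> D"
  shows "((\<lambda>t. f (upd x b t)) has_real_derivative D \<bullet> b) (at s)"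
proof -
  have "((\<lambda>t. upd x b t) has_derivative (\<lambda>h. h *\<^sub>R b)) (at s)"
    unfolding upd_def by (auto intro!: derivative_eq_intros)
  from diff_chain_at[OF this, of f "\<lambda>h. h \<bullet> D"] assms
  have "((\<lambda>t. f (upd x b t)) has_derivative (\<lambda>h. h * (D \<bullet> b))) (at s)"
    by (simp add: gderiv_def o_def inner_commute)
  then show ?thesis by (simp add: has_field_derivative_def mult.commute[of _ "D \<bullet> b"] mult_commute_abs)
qed

text \<open>The condition on lines does not follow from \<open>N\<close> being a null set. It allows differentiating along
  coordinate lines and integrating back by the fundamental theorem of calculus.\<close>

definition ae_gradient :: "('a::euclidean_space \<Rightarrow> real) \<Rightarrow> ('a \<Rightarrow> 'a) \<Rightarrow> 'a set \<Rightarrow> bool" where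
  "ae_gradient f g N \<longleftrightarrow> N \<in> null_sets lborel \<and> (\<forall>x. x \<notin> N \<longrightarrow> GDERIV f x :> g x) \<and>
     (\<forall>x b. x \<notin> N \<longrightarrow> b \<in> Basis \<longrightarrow> finite {s. upd x b s \<in> N}) \<and>
     g \<in> borel_measurable borel \<and> bounded (range g)"

lemma ae_gradientD:
  assumes "ae_gradient f g N"
  shows "N \<in> null_sets lborel" "\<And>x. x \<notin> N \<Longrightarrow> GDERIV f x :> g x"
    "\<And>x b. x \<notin> N \<Longrightarrow> b \<in> Basis \<Longrightarrow> finite {s. upd x b s \<in> N}"
    "g \<in> borel_measurable borel" "\<exists>B. \<forall>x. norm (g x) \<le> B"
  using assms by (auto simp: ae_gradient_def bounded_iff)

lemma ae_gradient_uminus: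
  assumes "ae_gradient f g N"
  shows "ae_gradient (\<lambda>x. - f x) (\<lambda>x. - g x) N"
  using assms by (auto simp: ae_gradient_def bounded_iff intro: GDERIV_minus)

text \<open>\<open>N\<close> is the union of the hyperplanes that bound the half-spaces of which the simplices are finite
  intersections. A line through a point
  outside \<open>N\<close> is contained in none of these hyperplanes, so it meets each of them at most once.\<close>

lemma piecewise_affine_structure:
  fixes f :: "'a::euclidean_space \<Rightarrow> real"
  assumes "piecewise_affine f"
  obtains g :: "'a \<Rightarrow> 'a" and N M where
    "ae_gradient f g N" "0 < M" "\<And>x. x \<notin> cube M \<Longrightarrow> f x = 0 \<and> g x = 0" "continuous_on UNIV f"
proof -
  obtain \<T> where cont: "continuous_on UNIV f" and fin: "finite \<T>"
    and simp: "\<And>T. T \<in> \<T> \<Longrightarrow> int DIM('a) simplex T"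
    and disj: "pairwise (\<lambda>S T. interior S \<inter> interior T = {}) \<T>"
    and aff: "\<And>T. T \<in> \<T> \<Longrightarrow> \<exists>a b. \<forall>x\<in>T. f x = a \<bullet> x + b"
    and zero: "\<And>x. x \<notin> \<Union>\<T> \<Longrightarrow> f x = 0"
  proof -
    from assms obtain \<T> where *: "finite \<T> \<and> (\<forall>T\<in>\<T>. int DIM('a) simplex T) \<and>
        pairwise (\<lambda>S T. interior S \<inter> interior T = {}) \<T> \<and>
        (\<forall>T\<in>\<T>. \<exists>a b. \<forall>x\<in>T. f x = a \<bullet> x + b) \<and>
        (\<forall>x. x \<notin> \<Union>\<T> \<longrightarrow> f x = 0)" and c: "continuous_on UNIV f"
      unfolding piecewise_affine_def by (elim conjE exE) simp
    show thesis by (rule that[OF c, of \<T>]) (use * in simp_all)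
  qed
  have poly: "polytope T" if "T \<in> \<T>" for T using simplex_imp_polytope simp[OF that] by blast
  have clos: "closed T" "bounded T" if "T \<in> \<T>" for T
    using poly[OF that] polytope_imp_closed polytope_imp_bounded by auto
  obtain a b where ab: "\<And>T x. T \<in> \<T> \<Longrightarrow> x \<in> T \<Longrightarrow> f x = a T \<bullet> x + b T" using aff by metis
  have "\<exists>H. finite H \<and> (\<forall>(c,d)\<in>H. c \<noteq> 0) \<and> T = {x. \<forall>(c,d)\<in>H. c \<bullet> x \<le> d}" if T: "T \<in> \<T>" for T
  proof -
    have "polyhedron T" using poly[OF T] by (rule polytope_imp_polyhedron)
    then obtain F where F: "finite F" "T = \<Inter>F" "\<forall>h\<in>F. \<exists>a b. a \<noteq> 0 \<and> h = {x. a \<bullet> x \<le> b}"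
      by (auto simp: polyhedron_def)
    then obtain c d where cd: "\<And>h. h \<in> F \<Longrightarrow> c h \<noteq> 0 \<and> h = {x. c h \<bullet> x \<le> d h}" by metis
    have "T = {x. \<forall>h\<in>F. c h \<bullet> x \<le> d h}"
      unfolding F(2) using cd by blast
    then show ?thesis using F(1) cd by (intro exI[of _ "(\<lambda>h. (c h, d h)) ` F"]) auto
  qed
  then have "\<forall>T. \<exists>H. T \<in> \<T> \<longrightarrow> finite H \<and> (\<forall>(c,d)\<in>H. c \<noteq> 0) \<and> T = {x. \<forall>(c,d)\<in>H. c \<bullet> x \<le> d}"
    by blast
  from choice[OF this] obtain H where H': "\<And>T. T \<in> \<T> \<Longrightarrow> finite (H T) \<and> (\<forall>(c,d)\<in>H T. c \<noteq> 0) \<and> T = {x. \<forall>(c,d)\<in>H T. c \<bullet> x \<le> d}"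
    by blast
  have H: "\<And>T. T \<in> \<T> \<Longrightarrow> finite (H T)" "\<And>T c d. T \<in> \<T> \<Longrightarrow> (c,d) \<in> H T \<Longrightarrow> c \<noteq> 0"
    "\<And>T. T \<in> \<T> \<Longrightarrow> T = {x. \<forall>(c,d)\<in>H T. c \<bullet> x \<le> d}"
    using H' by blast+
  define P where "P = (\<Union>T\<in>\<T>. H T)"
  have P: "finite P" "\<And>c d. (c,d) \<in> P \<Longrightarrow> c \<noteq> 0" using fin H(1,2) unfolding P_def by auto
  define N where "N = (\<Union>(c,d)\<in>P. {x. c \<bullet> x = d})"
  have "closed N" unfolding N_def using P(1) by (intro closed_UN) (auto intro: closed_hyperplane)
  moreover have "negligible N" unfolding N_def using P by (intro negligible_Union) (auto intro!: negligible_hyperplane)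
  ultimately have N: "N \<in> null_sets lborel"
    by (auto simp: negligible_iff_null_sets null_sets_def borel_closed)
  have inter: "x \<in> interior T" if "x \<in> T" "x \<notin> N" "T \<in> \<T>" for x T
  proof (rule interiorI)
    let ?O = "\<Inter>(c,d)\<in>H T. {x. c \<bullet> x < d}"
    show "open ?O" using H(1)[OF that(3)] by (intro open_INT) (auto intro: open_halfspace_lt)
    have mem: "x \<in> {x. \<forall>(c,d)\<in>H T. c \<bullet> x \<le> d}"
      by (rule H(3)[OF that(3), THEN equalityD1, THEN subsetD, OF that(1)])
    have le: "c \<bullet> x \<le> d" if "(c,d) \<in> H T" for c d
      using mem that by blast
    have neq: "c \<bullet> x \<noteq> d" if "(c,d) \<in> H T" for c d
    proof -
      have "(c,d) \<in> P" using that \<open>T \<in> \<T>\<close> unfolding P_def by blast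
      then show ?thesis using \<open>x \<notin> N\<close> unfolding N_def by blast
    qed
    show "x \<in> ?O" using le neq by (auto simp: less_le)
    show "?O \<subseteq> T" by (subst H(3)[OF that(3)]) (auto intro: less_imp_le)
  qed
  define g where "g x = (\<Sum>T\<in>\<T>. indicator (interior T) x *\<^sub>R a T)" for x
  have g_in: "g x = a T" if "x \<in> interior T" "T \<in> \<T>" for x T
  proof -
    have "g x = (\<Sum>S\<in>\<T>. if S = T then a T else 0)"
      unfolding g_def using that disj by (intro sum.cong) (auto simp: pairwise_def indicator_def)
    then show ?thesis using that fin by simp
  qed
  have g_out: "g x = 0" if "x \<notin> \<Union>\<T>" for x
    unfolding g_def using that interior_subset by (intro sum.neutral) (auto simp: indicator_def)
  have der: "GDERIV f x :> g x" if "x \<notin> N" for x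
  proof (cases "x \<in> \<Union>\<T>")
    case True
    then obtain T where T: "T \<in> \<T>" "x \<in> T" by blast
    have xi: "x \<in> interior T" by (rule inter[OF T(2) that T(1)])
    have "((\<lambda>y. a T \<bullet> y + b T) has_derivative (\<lambda>h. h \<bullet> a T)) (at x)"
      by (auto intro!: derivative_eq_intros simp: inner_commute)
    then have "(f has_derivative (\<lambda>h. h \<bullet> a T)) (at x)"
      by (rule has_derivative_transform_within_open[OF _ open_interior xi])
         (simp add: ab[OF T(1)] subsetD[OF interior_subset])
    then show ?thesis using g_in[OF xi T(1)] by (simp add: gderiv_def)
  next
    case False
    have "((\<lambda>y. 0::real) has_derivative (\<lambda>h. h \<bullet> 0)) (at x)" by simp
    moreover have "open (- \<Union>\<T>)" using fin clos by (intro open_Compl closed_Union) auto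
    moreover have "x \<in> - \<Union>\<T>" using False by simp
    ultimately have "(f has_derivative (\<lambda>h. h \<bullet> 0)) (at x)"
      using zero by (elim has_derivative_transform_within_open) auto
    then show ?thesis using g_out[OF False] by (simp add: gderiv_def)
  qed
  have lines: "finite {s. upd x e s \<in> N}" if "x \<notin> N" "e \<in> Basis" for x e
  proof (rule finite_subset)
    show "{s. upd x e s \<in> N} \<subseteq> (\<lambda>(c,d). (d - c \<bullet> x) / (c \<bullet> e) + x \<bullet> e) ` P"
    proof
      fix s assume "s \<in> {s. upd x e s \<in> N}"
      then obtain c d where cd: "(c,d) \<in> P" "c \<bullet> upd x e s = d" unfolding N_def by auto
      have eq: "c \<bullet> x + (s - x \<bullet> e) * (c \<bullet> e) = d"
        using cd(2) by (simp add: upd_def inner_add_right)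
      have "c \<bullet> x \<noteq> d" using cd(1) \<open>x \<notin> N\<close> unfolding N_def by blast
      then have "c \<bullet> e \<noteq> 0" using eq by auto
      then have "s = (d - c \<bullet> x) / (c \<bullet> e) + x \<bullet> e" using eq by (auto simp: field_simps)
      then show "s \<in> (\<lambda>(c,d). (d - c \<bullet> x) / (c \<bullet> e) + x \<bullet> e) ` P" using cd(1) by force
    qed
  qed (use P in simp)
  have "bounded (\<Union>\<T>)" using fin clos by (intro bounded_Union) auto
  then obtain M0 where M0: "\<And>x. x \<in> \<Union>\<T> \<Longrightarrow> norm x \<le> M0" by (auto simp: bounded_iff)
  define M where "M = max 1 M0"
  have out: "x \<notin> \<Union>\<T>" if "x \<notin> cube M" for x
  proof
    assume "x \<in> \<Union>\<T>"
    then have "norm x \<le> M" using M0 by (force simp: M_def)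
    then have "\<bar>x \<bullet> e\<bar> \<le> M" if "e \<in> Basis" for e using Basis_le_norm[OF that, of x] by linarith
    then show False using that by (auto simp: cube_def abs_le_iff minus_le_iff)
  qed
  show thesis
  proof (rule that)
    have "g \<in> borel_measurable borel" unfolding g_def
      by (intro borel_measurable_sum borel_measurable_scaleR borel_measurable_indicator) auto
    moreover have "norm (g x) \<le> (\<Sum>T\<in>\<T>. norm (a T))" for x
      unfolding g_def by (intro order_trans[OF norm_sum] sum_mono) (auto simp: indicator_def)
    ultimately show "ae_gradient f g N"
      unfolding ae_gradient_def bounded_iff using N der lines by blast
    show "0 < M" by (simp add: M_def)
    show "f x = 0 \<and> g x = 0" if "x \<notin> cube M" for x using out[OF that] zero g_out by blast
  qed (use cont in auto)
qed

text \<open>Power of the positive part. For \<open>r > 1\<close> it is continuously differentiable on the whole line, so that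
  the positive part of a function never has to be differentiated.\<close>

definition ppow :: "real \<Rightarrow> real \<Rightarrow> real" where
  "ppow r y = (max y 0) powr r"

lemma ppow_nonneg [simp]: "0 \<le> ppow r y" by (simp add: ppow_def)
lemma ppow_nonpos [simp]: "y \<le> 0 \<Longrightarrow> ppow r y = 0" by (simp add: ppow_def max_def)
lemma ppow_pos: "0 < y \<Longrightarrow> ppow r y = y powr r" by (simp add: ppow_def max_def)

lemma ppow_add: "ppow (r + s) y = ppow r y * ppow s y" by (simp add: ppow_def powr_add)
lemma ppow_powr: "ppow r y powr s = ppow (r * s) y" by (simp add: ppow_def powr_powr)

lemma continuous_ppow:
  assumes "0 < r" "continuous_on S f"
  shows "continuous_on S (\<lambda>x. ppow r (f x))"
  unfolding ppow_def by (intro continuous_on_powr' continuous_intros assms) (use assms in auto)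

lemma ppow_has_derivative:
  assumes r: "1 < r"
  shows "(ppow r has_real_derivative r * ppow (r - 1) y) (at y)"
proof -
  consider "y > 0" | "y < 0" | "y = 0" by linarith
  then show ?thesis
  proof cases
    case 1
    have "((\<lambda>z. z powr r) has_real_derivative r * y powr (r - 1)) (at y)"
      using 1 by (rule has_real_derivative_powr)
    then have "(ppow r has_real_derivative r * y powr (r - 1)) (at y)"
      by (rule has_field_derivative_transform_within_open[of _ _ _ "{0<..}"]) (use 1 in \<open>auto simp: ppow_pos\<close>)
    then show ?thesis using 1 by (simp add: ppow_pos)
  next
    case 2
    have "((\<lambda>z. 0) has_real_derivative 0) (at y)" by simp
    then have "(ppow r has_real_derivative 0) (at y)"
      by (rule has_field_derivative_transform_within_open[of _ _ _ "{..<0}"]) (use 2 in auto)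
    then show ?thesis using 2 by simp
  next
    case 3
    have "continuous_on UNIV (ppow (r - 1))"
      using continuous_ppow[of "r - 1" UNIV "\<lambda>x. x"] r by simp
    then have "((\<lambda>h. ppow (r - 1) h) \<longlongrightarrow> ppow (r - 1) 0) (at 0)"
      unfolding continuous_on_def by blast
    then have lim: "((\<lambda>h. ppow (r - 1) h) \<longlongrightarrow> 0) (at 0)" by simp
    have "((\<lambda>h. (ppow r h - ppow r 0) / (h - 0)) \<longlongrightarrow> 0) (at 0)"
    proof (rule Lim_transform_eventually[OF lim])
      show "\<forall>\<^sub>F h in at 0. ppow (r - 1) h = (ppow r h - ppow r 0) / (h - 0)"
        unfolding eventually_at_filter
      proof (rule always_eventually, intro allI impI)
        fix h :: real assume "h \<noteq> 0"
        then show "ppow (r - 1) h = (ppow r h - ppow r 0) / (h - 0)"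
          by (cases "h > 0") (auto simp: ppow_pos powr_diff)
      qed
    qed
    then show ?thesis using 3 by (simp add: has_field_derivative_iff)
  qed
qed

text \<open>On almost every line the function \<open>ppow r f * \<tau>\<close> is continuous, vanishes at both ends of the cube,
  and has the obvious derivative up to finitely many points.\<close>

lemma integration_by_parts_on_lines:
  fixes f :: "'a::euclidean_space \<Rightarrow> real"
  assumes grd: "ae_gradient f g N"
    and f: "continuous_on UNIV f" "\<And>x. b \<in> Basis \<Longrightarrow> \<bar>x \<bullet> b\<bar> = R \<Longrightarrow> f x = 0"
    and b: "b \<in> Basis" and R: "0 < R" and r: "1 < r"
    and \<tau>: "continuous_on UNIV \<tau>" "continuous_on UNIV d"
      "\<And>x. x \<bullet> b \<in> {-R..R} \<Longrightarrow> ((\<lambda>s. \<tau> (upd x b s)) has_real_derivative d x) (at (x \<bullet> b) within {-R..R})"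
  shows "(LINT x|lborel. indicator (cube R) x * (ppow r (f x) * d x)) =
     - (LINT x|lborel. indicator (cube R) x * (r * ppow (r - 1) (f x) * (g x \<bullet> b) * \<tau> x))"
proof -
  note N = ae_gradientD(1-3)[OF grd] and g1 = ae_gradientD(4)[OF grd]
  obtain B where B: "\<And>x. norm (g x) \<le> B" using ae_gradientD(5)[OF grd] by blast
  let ?u = "\<lambda>x. ppow r (f x) * d x" and ?v = "\<lambda>x. r * ppow (r - 1) (f x) * (g x \<bullet> b) * \<tau> x"
  have cpp: "continuous_on UNIV (\<lambda>x. ppow r (f x))" "continuous_on UNIV (\<lambda>x. ppow (r - 1) (f x))"
    using r by (auto intro!: continuous_ppow f)
  have iu: "integrable lborel (\<lambda>x. indicator (cube R) x * ?u x)"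
    by (intro integrable_cube_continuous continuous_intros cpp \<tau>)
  have cv: "continuous_on UNIV (\<lambda>x. r * ppow (r - 1) (f x) * \<tau> x)"
    by (intro continuous_intros cpp \<tau>)
  obtain C where C: "\<And>x. x \<in> cube R \<Longrightarrow> \<bar>r * ppow (r - 1) (f x) * \<tau> x\<bar> \<le> C"
    using compact_imp_bounded[OF compact_continuous_image[OF continuous_on_subset[OF cv subset_UNIV] compact_cube[of R]]]
    by (auto simp: bounded_iff)
  have [measurable]: "f \<in> borel_measurable borel" "\<tau> \<in> borel_measurable borel" "d \<in> borel_measurable borel"
      "g \<in> borel_measurable borel" "(\<lambda>x. ppow (r - 1) (f x)) \<in> borel_measurable borel"
    using f(1) \<tau>(1,2) g1 cpp by (auto intro: borel_measurable_continuous_onI)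
  have iv: "integrable lborel (\<lambda>x. indicator (cube R) x * ?v x)"
  proof (rule integrable_cube)
    show "?v \<in> borel_measurable borel" by measurable
    fix x :: 'a assume x: "x \<in> cube R"
    have "\<bar>g x \<bullet> b\<bar> \<le> B" using Basis_le_norm[OF b, of "g x"] B[of x] by linarith
    then have "\<bar>r * ppow (r - 1) (f x) * \<tau> x\<bar> * \<bar>g x \<bullet> b\<bar> \<le> C * B"
      using C[OF x] by (intro mult_mono) auto
    then show "\<bar>?v x\<bar> \<le> C * B" by (simp add: abs_mult mult_ac)
  qed
  have "(LINT x|lborel. indicator (cube R) x * ?u x + indicator (cube R) x * ?v x) = 0"
  proof (rule integral_zero_by_lines[OF _ b N(1)])
    show "integrable lborel (\<lambda>x. indicator (cube R) x * ?u x + indicator (cube R) x * ?v x)" using iu iv by simp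
    fix x assume x: "x \<notin> N"
    let ?P = "\<lambda>s. ppow r (f (upd x b s)) * \<tau> (upd x b s)"
    let ?I = "\<lambda>s. ?u (upd x b s) + ?v (upd x b s)"
    have "(?I has_integral ?P R - ?P (-R)) {-R..R}"
    proof (rule fundamental_theorem_of_calculus_interior_strong[OF N(3)[OF x b]])
      show "-R \<le> R" using R by simp
      show "continuous_on {-R..R} ?P"
        by (intro continuous_intros continuous_on_compose2[OF cpp(1)] continuous_on_compose2[OF \<tau>(1)]) auto
      fix s assume s: "s \<in> {-R<..<R} - {s. upd x b s \<in> N}"
      have df: "((\<lambda>t. ppow r (f (upd x b t))) has_real_derivative r * ppow (r - 1) (f (upd x b s)) * (g (upd x b s) \<bullet> b)) (at s)"
        using s by (intro DERIV_chain2[OF ppow_has_derivative[OF r]] GDERIV_line N(2)) auto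
      have "((\<lambda>t. \<tau> (upd (upd x b s) b t)) has_real_derivative d (upd x b s)) (at (upd x b s \<bullet> b) within {-R..R})"
        using s b by (intro \<tau>(3)) (auto simp: upd_inner)
      then have "((\<lambda>t. \<tau> (upd x b t)) has_real_derivative d (upd x b s)) (at s)"
        using b s at_within_Icc_at[of "-R" s R] by (simp add: upd_inner)
      from DERIV_mult[OF df this]
      have "(?P has_real_derivative ?I s) (at s)" by (simp add: algebra_simps)
      then show "(?P has_vector_derivative ?I s) (at s)"
        by (simp add: has_real_derivative_iff_has_vector_derivative)
    qed
    moreover have "f (upd x b R) = 0" "f (upd x b (-R)) = 0"
      using b R by (auto intro!: f(2) simp: upd_inner)
    ultimately have hi: "(?I has_integral 0) {-R..R}" by simp
    have cube_upd: "upd x b s \<in> cube R \<longleftrightarrow> s \<in> {-R..R} \<and> (\<forall>c\<in>Basis - {b}. x \<bullet> c \<in> {-R..R})" for s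
      using b by (auto simp: cube_def upd_inner)
    show "(LINT s|lborel. indicator (cube R) (upd x b s) * ?u (upd x b s) + indicator (cube R) (upd x b s) * ?v (upd x b s)) = 0"
    proof (cases "\<forall>c\<in>Basis - {b}. x \<bullet> c \<in> {-R..R}")
      case False
      then have "upd x b s \<notin> cube R" for s using cube_upd by blast
      then show ?thesis by simp
    next
      case True
      let ?J = "\<lambda>s. indicator (cube R) (upd x b s) * ?u (upd x b s) + indicator (cube R) (upd x b s) * ?v (upd x b s)"
      have J: "?J = (\<lambda>s. if s \<in> {-R..R} then ?I s else 0)"
        using True cube_upd by (auto simp: fun_eq_iff indicator_def)
      show ?thesis
      proof (cases "integrable lborel ?J")
        case True
        from has_integral_integral_lborel[OF this]
        have "(?I has_integral (LINT s|lborel. ?J s)) {-R..R}"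
          unfolding J has_integral_restrict_UNIV .
        then show ?thesis using hi has_integral_unique by blast
      next
        case False
        then show ?thesis by (rule not_integrable_integral_eq)
      qed
    qed
  qed
  then show ?thesis using iu iv by simp
qed

section \<open>Integrals of the extremal function\<close>

definition pos_homogeneous :: "('a::euclidean_space \<Rightarrow> real) \<Rightarrow> bool" where
  "pos_homogeneous \<nu> \<longleftrightarrow> (\<forall>t\<ge>0. \<forall>x. \<nu> (t *\<^sub>R x) = t * \<nu> x)"

text \<open>For \<open>q\<close> the exponent conjugate to \<open>p\<close>, a power of this function is extremal in the Sobolev
  inequality. The power \<open>- n\<close> is the target density of the transport.\<close>

definition profile :: "('a::euclidean_space \<Rightarrow> real) \<Rightarrow> real \<Rightarrow> 'a \<Rightarrow> real" where
  "profile \<nu> q y = 1 + \<nu> y powr q"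

lemma emeasure_sublevel_scale:
  fixes \<nu> :: "'a::euclidean_space \<Rightarrow> real"
  assumes "continuous_on UNIV \<nu>" "pos_homogeneous \<nu>" "0 < \<rho>"
  shows "emeasure lborel {y. \<nu> y \<le> \<rho>} = ennreal (\<rho> ^ DIM('a)) * emeasure lborel {y. \<nu> y \<le> 1}"
proof -
  have sets: "{y. \<nu> y \<le> c} \<in> sets borel" for c
    using assms(1) by (intro borel_closed closed_Collect_le) (auto intro!: continuous_intros)
  have "{y. \<nu> y \<le> \<rho>} = (\<lambda>x. \<rho> *\<^sub>R x + 0) ` {y. \<nu> y \<le> 1}"
  proof (intro equalityI subsetI)
    fix y assume y: "y \<in> {y. \<nu> y \<le> \<rho>}"
    have "\<nu> ((1/\<rho>) *\<^sub>R y) = (1/\<rho>) * \<nu> y"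
      using assms(2,3) unfolding pos_homogeneous_def by (metis less_imp_le divide_nonneg_pos zero_le_one)
    then have "\<nu> ((1/\<rho>) *\<^sub>R y) \<le> (1/\<rho>) * \<rho>" using y assms(3) by simp
    then have "(1/\<rho>) *\<^sub>R y \<in> {y. \<nu> y \<le> 1}" using assms(3) by simp
    then show "y \<in> (\<lambda>x. \<rho> *\<^sub>R x + 0) ` {y. \<nu> y \<le> 1}"
      using assms(3) by (intro image_eqI[of _ _ "(1/\<rho>) *\<^sub>R y"]) auto
  next
    fix y assume "y \<in> (\<lambda>x. \<rho> *\<^sub>R x + 0) ` {y. \<nu> y \<le> 1}"
    then show "y \<in> {y. \<nu> y \<le> \<rho>}"
      using assms(2,3) by (auto simp: pos_homogeneous_def)
  qed
  then have "emeasure lebesgue {y. \<nu> y \<le> \<rho>} = \<bar>\<rho>\<bar> ^ DIM('a) * emeasure lebesgue {y. \<nu> y \<le> 1}"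
    using emeasure_lebesgue_affine[of \<rho> 0 "{y. \<nu> y \<le> 1}"] by simp
  then show ?thesis using assms(3) sets by simp
qed

lemma profile_measurable:
  assumes "continuous_on UNIV \<nu>"
  shows "profile \<nu> q \<in> borel_measurable borel"
proof -
  have [measurable]: "\<nu> \<in> borel_measurable borel" using assms by (rule borel_measurable_continuous_onI)
  show ?thesis unfolding profile_def[abs_def] by measurable
qed

lemma profile_ge_1: "1 \<le> profile \<nu> q y" by (simp add: profile_def)

text \<open>Write \<open>v powr (- k)\<close> as the integral of \<open>k * \<tau> powr (k - 1)\<close> over \<open>\<tau> \<le> 1 / v\<close> and exchange the
  integrals. The set of \<open>y\<close> with \<open>\<tau> \<le> 1 / v y\<close> is the dilate of the unit ball of \<open>\<nu>\<close> by
  \<open>((1 - \<tau>) / \<tau>) powr (1 / q)\<close>, which leaves a beta integral in \<open>\<tau>\<close>.\<close>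

lemma nn_integral_profile:
  fixes \<nu> :: "'a::euclidean_space \<Rightarrow> real"
  assumes \<nu>: "continuous_on UNIV \<nu>" "\<And>y. 0 \<le> \<nu> y" "pos_homogeneous \<nu>"
    and V: "emeasure lborel {y. \<nu> y \<le> 1} = ennreal V" "0 \<le> V"
    and q: "0 < q" and k: "real DIM('a) / q < k"
  shows "(\<integral>\<^sup>+ y. ennreal (profile \<nu> q y powr (- k)) \<partial>lborel)
     = ennreal (k * V * Beta (k - real DIM('a) / q) (real DIM('a) / q + 1))"
proof -
  let ?n = "real DIM('a)" and ?v = "profile \<nu> q"
  have k0: "k > 0" using k q by (smt (verit) divide_nonneg_pos of_nat_0_le_iff)
  have v1: "1 \<le> ?v y" for y by (rule profile_ge_1)
  have [measurable]: "?v \<in> borel_measurable borel" by (rule profile_measurable[OF \<nu>(1)])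
  have cake: "ennreal (?v y powr (- k)) = (\<integral>\<^sup>+ \<tau>. ennreal (indicator {0..1 / ?v y} \<tau> * (k * \<tau> powr (k - 1))) \<partial>lborel)" for y
  proof -
    have "((\<lambda>\<tau>. k * \<tau> powr (k - 1)) has_integral k * ((1 / ?v y) powr (k - 1 + 1) / (k - 1 + 1))) {0..1 / ?v y}"
      using v1[of y] k0 by (intro has_integral_mult_right has_integral_powr_from_0) auto
    moreover have "k * ((1 / ?v y) powr (k - 1 + 1) / (k - 1 + 1)) = ?v y powr (- k)"
      using k0 v1[of y] by (simp add: powr_minus_divide powr_divide)
    ultimately show ?thesis
      using k0 by (intro nn_integral_has_integral_lebesgue[symmetric]) auto
  qed
  have "(\<integral>\<^sup>+ y. ennreal (?v y powr (- k)) \<partial>lborel)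
     = (\<integral>\<^sup>+ y. (\<integral>\<^sup>+ \<tau>. ennreal (indicator {0..1 / ?v y} \<tau> * (k * \<tau> powr (k - 1))) \<partial>lborel) \<partial>lborel)"
    unfolding cake ..
  also have "\<dots> = (\<integral>\<^sup>+ \<tau>. (\<integral>\<^sup>+ y. ennreal (indicator {0..1 / ?v y} \<tau> * (k * \<tau> powr (k - 1))) \<partial>lborel) \<partial>lborel)"
  proof (rule lborel_pair.Fubini'[symmetric])
    have [measurable]: "Measurable.pred (lborel \<Otimes>\<^sub>M lborel) (\<lambda>z :: 'a \<times> real. 0 \<le> snd z \<and> snd z \<le> 1 / ?v (fst z))"
      by measurable
    have "(\<lambda>z :: 'a \<times> real. ennreal ((if 0 \<le> snd z \<and> snd z \<le> 1 / ?v (fst z) then 1 else 0) * (k * snd z powr (k - 1))))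
       \<in> borel_measurable (lborel \<Otimes>\<^sub>M lborel)" by measurable
    then show "(\<lambda>(y, \<tau>). ennreal (indicator {0..1 / ?v y} \<tau> * (k * \<tau> powr (k - 1)))) \<in> borel_measurable (lborel \<Otimes>\<^sub>M lborel)"
      by (simp add: case_prod_beta' indicator_def)
  qed
  also have "\<dots> = (\<integral>\<^sup>+ \<tau>. ennreal (indicator {0..1} \<tau> * (k * V * (\<tau> powr (k - ?n / q - 1) * (1 - \<tau>) powr (?n / q + 1 - 1)))) \<partial>lborel)"
  proof (rule nn_integral_cong_AE)
    have "AE \<tau> in lborel. \<tau> \<noteq> (0::real)" "AE \<tau> in lborel. \<tau> \<noteq> (1::real)" by (rule AE_lborel_singleton)+
    then show "AE \<tau> in lborel. (\<integral>\<^sup>+ y. ennreal (indicator {0..1 / ?v y} \<tau> * (k * \<tau> powr (k - 1))) \<partial>lborel)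
       = ennreal (indicator {0..1} \<tau> * (k * V * (\<tau> powr (k - ?n / q - 1) * (1 - \<tau>) powr (?n / q + 1 - 1))))"
    proof eventually_elim
      fix \<tau> :: real
      assume \<tau>: "\<tau> \<noteq> 0" "\<tau> \<noteq> 1"
      show "(\<integral>\<^sup>+ y. ennreal (indicator {0..1 / ?v y} \<tau> * (k * \<tau> powr (k - 1))) \<partial>lborel)
       = ennreal (indicator {0..1} \<tau> * (k * V * (\<tau> powr (k - ?n / q - 1) * (1 - \<tau>) powr (?n / q + 1 - 1))))"
      proof (cases "\<tau> \<in> {0..1}")
        case False
        have "1 / ?v y \<le> 1" for y using v1[of y] by simp
        then have "\<tau> \<notin> {0..1 / ?v y}" for y using False by (metis atLeastAtMost_iff order_trans)
        then show ?thesis using False by simp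
      next
        case True
        then have t: "0 < \<tau>" "\<tau> < 1" using \<tau> by auto
        define \<rho> where "\<rho> = ((1 - \<tau>) / \<tau>) powr (1 / q)"
        have \<rho>: "\<rho> > 0" using t by (simp add: \<rho>_def)
        have \<rho>q: "\<rho> powr q = (1 - \<tau>) / \<tau>" using t q by (simp add: \<rho>_def powr_powr)
        have iff: "\<tau> \<in> {0..1 / ?v y} \<longleftrightarrow> \<nu> y \<le> \<rho>" for y
        proof -
          have "\<tau> \<in> {0..1 / ?v y} \<longleftrightarrow> \<tau> * ?v y \<le> 1" using t v1[of y] by (simp add: pos_le_divide_eq)
          also have "\<dots> \<longleftrightarrow> \<nu> y powr q \<le> (1 - \<tau>) / \<tau>" using t by (simp add: profile_def field_simps)
          also have "\<dots> \<longleftrightarrow> \<nu> y \<le> \<rho>" unfolding \<rho>q[symmetric]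
            using q \<nu>(2)[of y] \<rho> by (smt (verit) powr_less_mono2 powr_mono2)
          finally show ?thesis .
        qed
        have \<rho>n: "\<rho> ^ DIM('a) = (1 - \<tau>) powr (?n / q) * \<tau> powr (- (?n / q))"
          using t \<rho> by (simp add: \<rho>_def powr_realpow[symmetric] powr_powr powr_divide powr_minus_divide mult.commute)
        have m: "{y. \<nu> y \<le> \<rho>} \<in> sets lborel"
          using \<nu>(1) by (auto intro!: borel_closed closed_Collect_le continuous_intros)
        have "(\<integral>\<^sup>+ y. ennreal (indicator {0..1 / ?v y} \<tau> * (k * \<tau> powr (k - 1))) \<partial>lborel)
           = (\<integral>\<^sup>+ y. ennreal (k * \<tau> powr (k - 1)) * indicator {y. \<nu> y \<le> \<rho>} y \<partial>lborel)"
          using iff by (intro nn_integral_cong) (auto simp: indicator_def)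
        also have "\<dots> = ennreal (k * \<tau> powr (k - 1)) * (ennreal (\<rho> ^ DIM('a)) * ennreal V)"
          using m by (simp add: nn_integral_cmult_indicator emeasure_sublevel_scale[OF \<nu>(1,3) \<rho>] V(1))
        also have "\<dots> = ennreal (k * \<tau> powr (k - 1) * (\<rho> ^ DIM('a) * V))"
          using k0 \<rho> V(2) by (simp add: ennreal_mult)
        also have "k * \<tau> powr (k - 1) * (\<rho> ^ DIM('a) * V) = k * V * (\<tau> powr (k - ?n / q - 1) * (1 - \<tau>) powr (?n / q + 1 - 1))"
        proof -
          have "k - ?n / q - 1 = (k - 1) + - (?n / q)" by simp
          then have "\<tau> powr (k - ?n / q - 1) = \<tau> powr (k - 1) * \<tau> powr (- (?n / q))"
            by (simp only: powr_add)
          then show ?thesis unfolding \<rho>n by simp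
        qed
        finally show ?thesis using True by simp
      qed
    qed
  qed
  also have "\<dots> = ennreal (k * V * Beta (k - ?n / q) (?n / q + 1))"
  proof (rule nn_integral_has_integral_lebesgue)
    show "0 \<le> k * V * (\<tau> powr (k - ?n / q - 1) * (1 - \<tau>) powr (?n / q + 1 - 1))" for \<tau>
      using k0 V(2) by simp
    show "((\<lambda>\<tau>. k * V * (\<tau> powr (k - ?n / q - 1) * (1 - \<tau>) powr (?n / q + 1 - 1))) has_integral
        k * V * Beta (k - ?n / q) (?n / q + 1)) {0..1}"
      using k q by (intro has_integral_mult_right has_integral_Beta_real) (auto simp: add_pos_nonneg intro!: add_nonneg_pos)
  qed
  finally show ?thesis .
qed

text \<open>Up to the volume of the unit ball, the first two values are the integrals of the powers \<open>- n\<close> and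
  \<open>- (n - 1)\<close> of the profile. Their quotient \<open>r\<close> is also the exponent for which \<open>ppow r f\<close> is the power
  \<open>1 - 1 / n\<close> of the source density, and this coincidence makes the constant come out sharp.\<close>

lemma extremal_mass_constants:
  fixes n p q r :: real
  assumes p: "1 < p" "p < n" and q: "q = p / (p - 1)" and r: "r = p * (n - 1) / (n - p)"
  shows "n * Beta (n - n / q) (n / q + 1) = Gamma (n / p) * Gamma (n + 1 - n / p) / Gamma n"
    and "(n - 1) * Beta (n - 1 - n / q) (n / q + 1) = r * (n * Beta (n - n / q) (n / q + 1))"
    and "n / q < n - 1"
proof -
  define x where "x = n / p"
  have nq: "n / q = n - x" using p unfolding q x_def by (simp add: field_simps)
  then have args: "n - n / q = x" "n / q + 1 = n + 1 - x" "n - 1 - n / q = x - 1" by simp_all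
  have n0: "n > 0" using p by simp
  have x1: "x > 1" using p by (simp add: x_def)
  show "n / q < n - 1" unfolding nq using x1 by simp
  have pos: "y \<notin> \<int>\<^sub>\<le>\<^sub>0" if "0 < y" for y :: real
    using that nonpos_Ints_nonpos[of y] by fastforce
  have G: "Gamma (n + 1) = n * Gamma n" using pos[OF n0] by (rule Gamma_plus1)
  have e: "x + (n + 1 - x) = n + 1" by simp
  have "n * Beta x (n + 1 - x) = Gamma x * Gamma (n + 1 - x) / Gamma n"
    unfolding Beta_def e G using n0 by simp
  then show "n * Beta (n - n / q) (n / q + 1) = Gamma (n / p) * Gamma (n + 1 - n / p) / Gamma n"
    unfolding args unfolding x_def .
  have B: "(x - 1 + (n + 1 - x)) * Beta (x - 1 + 1) (n + 1 - x) = (x - 1) * Beta (x - 1) (n + 1 - x)"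
    using x1 by (intro Beta_plus1_left pos) simp
  have "r * (x - 1) = n - 1" using p unfolding r x_def by (simp add: divide_simps)
  then have "(n - 1) * Beta (x - 1) (n + 1 - x) = r * ((x - 1) * Beta (x - 1) (n + 1 - x))"
    by (simp flip: mult.assoc)
  also have "\<dots> = r * (n * Beta x (n + 1 - x))"
    unfolding B[symmetric] by simp
  finally show "(n - 1) * Beta (n - 1 - n / q) (n / q + 1) = r * (n * Beta (n - n / q) (n / q + 1))"
    unfolding args .
qed

section \<open>The Sobolev inequality on a cube\<close>

text \<open>Young's inequality after normalising both functions. If one of the norms vanishes, the product is 0
  almost everywhere.\<close>

lemma Holder_integral:
  fixes X Y :: "'m \<Rightarrow> real"
  assumes pq: "1 < p" "1 < q" "1 / p + 1 / q = 1"
    and X: "\<And>x. 0 \<le> X x" "integrable M (\<lambda>x. X x powr p)"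
    and Y: "\<And>x. 0 \<le> Y x" "integrable M (\<lambda>x. Y x powr q)"
    and XY: "integrable M (\<lambda>x. X x * Y x)"
  shows "(\<integral>x. X x * Y x \<partial>M) \<le> (\<integral>x. X x powr p \<partial>M) powr (1 / p) * (\<integral>x. Y x powr q \<partial>M) powr (1 / q)"
proof -
  define A where "A = (\<integral>x. X x powr p \<partial>M)"
  define B where "B = (\<integral>x. Y x powr q \<partial>M)"
  have A: "0 \<le> A" and B: "0 \<le> B" unfolding A_def B_def by (auto intro!: integral_nonneg_AE)
  show ?thesis
  proof (cases "A = 0 \<or> B = 0")
    case True
    have "AE x in M. X x * Y x = 0"
    proof (cases "A = 0")
      case True
      then have "AE x in M. X x powr p = 0"
        using integral_nonneg_eq_0_iff_AE[OF X(2)] by (simp add: A_def)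
      then show ?thesis by eventually_elim simp
    next
      case False
      then have "AE x in M. Y x powr q = 0"
        using True integral_nonneg_eq_0_iff_AE[OF Y(2)] by (simp add: B_def)
      then show ?thesis by eventually_elim simp
    qed
    then have "(\<integral>x. X x * Y x \<partial>M) = 0" by (rule integral_eq_zero_AE)
    then show ?thesis by simp
  next
    case False
    then have A: "A > 0" and B: "B > 0" using A B by auto
    define a where "a = A powr (1 / p)"
    define b where "b = B powr (1 / q)"
    have ab: "a > 0" "b > 0" "a powr p = A" "b powr q = B"
      using A B pq by (auto simp: a_def b_def powr_powr)
    have "(\<integral>x. X x * Y x \<partial>M) \<le> (\<integral>x. a * b * (X x powr p / (p * A) + Y x powr q / (q * B)) \<partial>M)"
    proof (rule integral_mono[OF XY])
      show "integrable M (\<lambda>x. a * b * (X x powr p / (p * A) + Y x powr q / (q * B)))"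
        using X(2) Y(2) by auto
      fix x
      have "(X x / a) * (Y x / b) \<le> (X x / a) powr p / p + (Y x / b) powr q / q"
        using X(1)[of x] Y(1)[of x] ab by (intro Youngs_inequality pq) auto
      also have "\<dots> = X x powr p / (p * A) + Y x powr q / (q * B)"
        using X(1)[of x] Y(1)[of x] ab by (simp add: powr_divide mult.commute)
      finally have "a * b * ((X x / a) * (Y x / b)) \<le> a * b * (X x powr p / (p * A) + Y x powr q / (q * B))"
        using ab by (intro mult_left_mono) auto
      then show "X x * Y x \<le> a * b * (X x powr p / (p * A) + Y x powr q / (q * B))"
        using ab by simp
    qed
    also have "\<dots> = a * b * (A / (p * A) + B / (q * B))"
      using X(2) Y(2) by (simp add: A_def B_def)
    also have "\<dots> = a * b" using A B pq(3) by simp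
    finally show ?thesis by (simp add: a_def b_def A_def B_def)
  qed
qed

definition cint :: "real \<Rightarrow> ('a::euclidean_space \<Rightarrow> real) \<Rightarrow> real" where
  "cint R \<phi> = (LINT x|lborel. indicator (cube R) x * \<phi> x)"

lemma cint_add:
  assumes "continuous_on UNIV \<phi>" "continuous_on UNIV \<psi>"
  shows "cint R (\<lambda>x. \<phi> x + \<psi> x) = cint R \<phi> + cint R \<psi>"
  unfolding cint_def distrib_left
  by (intro Bochner_Integration.integral_add integrable_cube_continuous assms)

lemma cint_cmult: "cint R (\<lambda>x. c * \<phi> x) = c * cint R \<phi>"
  unfolding cint_def by (simp add: mult.left_commute)

lemma cint_mono:
  assumes "continuous_on UNIV \<phi>" "continuous_on UNIV \<psi>" "\<And>x. x \<in> cube R \<Longrightarrow> \<phi> x \<le> \<psi> x"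
  shows "cint R \<phi> \<le> cint R \<psi>"
  unfolding cint_def
proof (rule integral_mono)
  show "indicator (cube R) x * \<phi> x \<le> indicator (cube R) x * \<psi> x" for x
    using assms(3)[of x] by (auto simp: indicator_def)
qed (intro integrable_cube_continuous assms)+

lemma cint_nonneg: "(\<And>x. 0 \<le> \<phi> x) \<Longrightarrow> 0 \<le> cint R \<phi>"
  unfolding cint_def by (intro integral_nonneg_AE) auto

lemma cint_sum:
  assumes "\<And>i. i \<in> I \<Longrightarrow> continuous_on UNIV (\<phi> i)"
  shows "cint R (\<lambda>x. \<Sum>i\<in>I. \<phi> i x) = (\<Sum>i\<in>I. cint R (\<phi> i))"
  unfolding cint_def sum_distrib_left
  by (intro Bochner_Integration.integral_sum integrable_cube_continuous assms)

lemma continuous_profile: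
  assumes "continuous_on UNIV \<nu>" "\<And>y. 0 \<le> \<nu> y" "0 < q"
  shows "continuous_on UNIV (profile \<nu> q)"
  unfolding profile_def[abs_def] by (intro continuous_intros continuous_on_powr' assms) (use assms in auto)

text \<open>The transport argument. The added constant \<open>\<epsilon>\<close> makes the source density positive. It costs the term
  with \<open>C\<close>, where \<open>C\<close> bounds the profile on the cube and is independent of the map, so the term
  vanishes with \<open>\<epsilon>\<close>. The exponents match because \<open>r + p' / n = p'\<close> and \<open>(r - 1) * q = p'\<close>.\<close>

lemma sobolev_cube_perturbed:
  fixes f \<nu> h :: "'a::euclidean_space \<Rightarrow> real" and g :: "'a \<Rightarrow> 'a"
  defines "n \<equiv> real DIM('a)"
  assumes p: "1 < p" "p < n" and q: "q = p / (p - 1)" and r: "r = p * (n - 1) / (n - p)" and p': "p' = n * p / (n - p)"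
    and \<nu>: "continuous_on UNIV \<nu>" "\<And>y. 0 \<le> \<nu> y"
    and h: "continuous_on UNIV h" "\<And>z. 0 \<le> h z" "\<And>z y. z \<bullet> y \<le> h z * \<nu> y"
    and grd: "ae_gradient f g N"
    and f: "continuous_on UNIV f" "\<And>x. x \<notin> cube M \<Longrightarrow> f x = 0" and R: "0 < M" "M < R"
    and \<epsilon>: "0 < \<epsilon>"
    and C: "\<And>y. y \<in> cube R \<Longrightarrow> profile \<nu> q y \<le> C"
    and P\<epsilon>: "P\<epsilon> = cint R (\<lambda>x. ppow p' (f x)) + \<epsilon> * cint R (\<lambda>x::'a. 1)"
    and m: "m = cint R (\<lambda>y. profile \<nu> q y powr (- n))"
  shows "n * (m / P\<epsilon>) powr (1 / n) * (P\<epsilon> / m * cint R (\<lambda>y. profile \<nu> q y powr (- (n - 1))) - \<epsilon> * (C * cint R (\<lambda>x::'a. 1)))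
    \<le> r * (LINT x|lborel. (if 0 < f x then h (- g x) else 0) powr p) powr (1 / p)
        * (P\<epsilon> / m * cint R (\<lambda>y. profile \<nu> q y powr (- n) * \<nu> y powr q)) powr (1 / q)"
proof -
  note g1 = ae_gradientD(4)[OF grd]
  obtain B where B: "\<And>x. norm (g x) \<le> B" using ae_gradientD(5)[OF grd] by blast
  have R0: "0 < R" using R by simp
  have n0: "0 < n" and n1: "1 < n" using p by auto
  have q1: "1 < q" and pq: "1 / p + 1 / q = 1" using p unfolding q by (auto simp: field_simps)
  have r1: "1 < r"
  proof -
    have "n - p < p * (n - 1)" using p n1 by (simp add: algebra_simps)
    then show ?thesis unfolding r using p by simp
  qed
  have p'0: "0 < p'" using p n0 by (simp add: p')
  have rp': "r + p' / n = p'" using p n0 unfolding r p' by (simp add: divide_simps) (simp add: algebra_simps)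
  have rq: "(r - 1) * q = p'" using p unfolding r q p' by (simp add: divide_simps) (simp add: algebra_simps)
  let ?v = "profile \<nu> q"
  define F where "F x = ppow p' (f x)" for x
  define F\<epsilon> where "F\<epsilon> x = F x + \<epsilon>" for x
  define w where "w y = ?v y powr (- n)" for y
  have v1: "1 \<le> ?v y" for y by (rule profile_ge_1)
  have v0: "0 < ?v y" for y using v1[of y] by linarith
  have cv: "continuous_on UNIV ?v" by (rule continuous_profile[OF \<nu>]) (use q1 in simp)
  have cw: "continuous_on UNIV w" unfolding w_def[abs_def] using v0
    by (intro continuous_on_powr cv continuous_intros) (auto simp: less_imp_neq[symmetric])
  have w0: "0 < w y" for y using v0[of y] by (simp add: w_def)
  have cF: "continuous_on UNIV F" unfolding F_def[abs_def] by (rule continuous_ppow[OF p'0 f(1)])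
  have cF\<epsilon>: "continuous_on UNIV F\<epsilon>" unfolding F\<epsilon>_def[abs_def] by (intro continuous_intros cF)
  have F\<epsilon>0: "0 < F\<epsilon> x" for x using \<epsilon> by (simp add: F\<epsilon>_def F_def add_nonneg_pos)
  obtain bs :: "'a list" where bs: "set bs = Basis" "distinct bs"
    using finite_distinct_list[OF finite_Basis] by blast
  define T where "T x = knothe R F\<epsilon> w bs x 0" for x
  define d where "d b x = knothe_deriv R F\<epsilon> w bs b x 0" for b x
  note kn = R0 cF\<epsilon> F\<epsilon>0 cw w0
  have cT: "continuous_on UNIV T"
    using continuous_on_compose_pair[OF continuous_knothe[OF kn] continuous_on_id continuous_on_const[of UNIV 0]]
    by (simp add: T_def[abs_def])
  have cd: "continuous_on UNIV (d b)" for b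
    using continuous_on_compose_pair[OF continuous_knothe_deriv[OF kn, of bs b] continuous_on_id continuous_on_const[of UNIV 0]] bs
    by (simp add: d_def[abs_def])
  have Tcube: "T x \<in> cube R" for x
    unfolding cube_def T_def using knothe_in_cube[OF kn, of bs] bs by auto
  have d0: "0 < d b x" for b x unfolding d_def by (rule knothe_deriv_pos[OF kn])
  have marg_cint: "marg R bs \<phi> x = cint R \<phi>" if "continuous_on UNIV \<phi>" "\<And>x. 0 \<le> \<phi> x" for \<phi> x
    unfolding cint_def by (rule integral_cube_eq_marg[OF that bs R0, symmetric])
  have P\<epsilon>': "cint R F\<epsilon> = P\<epsilon>"
    unfolding P\<epsilon> F\<epsilon>_def[abs_def] using cint_add[OF cF continuous_on_const[of UNIV \<epsilon>], of R] cint_cmult[of R \<epsilon> "\<lambda>_. 1"]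
    by (simp add: F_def[abs_def])
  have m': "cint R w = m" unfolding m w_def ..
  have mF: "marg R bs F\<epsilon> x = P\<epsilon>" for x using marg_cint[OF cF\<epsilon>, of x] F\<epsilon>0 P\<epsilon>' by (simp add: less_imp_le)
  have mw: "marg R bs w x = m" for x using marg_cint[OF cw, of x] w0 m' by (simp add: less_imp_le)
  have P\<epsilon>0: "0 < P\<epsilon>" using marg_pos[OF cF\<epsilon> F\<epsilon>0 R0, of bs 0] mF by simp
  have m0: "0 < m" using marg_pos[OF cw w0 R0, of bs 0] mw by simp
  have push: "cint R (\<lambda>x. F\<epsilon> x * \<phi> (T x)) = P\<epsilon> / m * cint R (\<lambda>y. w y * \<phi> y)"
    if \<phi>: "continuous_on UNIV \<phi>" "\<And>y. 0 \<le> \<phi> y" for \<phi>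
  proof -
    have "cint R (\<lambda>x. F\<epsilon> x * \<phi> (T x)) = marg R bs (\<lambda>x. F\<epsilon> x * \<phi> (T x)) 0"
      using F\<epsilon>0 \<phi>(2)
      by (intro marg_cint[symmetric] continuous_intros cF\<epsilon> continuous_on_compose2[OF \<phi>(1) cT])
         (auto intro!: mult_nonneg_nonneg less_imp_le[OF F\<epsilon>0])
    also have "\<dots> = P\<epsilon> / m * marg R bs (\<lambda>y. w y * \<phi> y) 0"
      unfolding T_def using knothe_pushforward[OF kn _ bs(2) \<phi>(1), of 0 0] bs mF mw by simp
    also have "marg R bs (\<lambda>y. w y * \<phi> y) 0 = cint R (\<lambda>y. w y * \<phi> y)"
      using w0 \<phi>(2) by (intro marg_cint continuous_intros cw \<phi>(1)) (auto intro!: mult_nonneg_nonneg less_imp_le[OF w0])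
    finally show ?thesis .
  qed
  let ?K = "(m / P\<epsilon>) powr (1 / n)"
  define u where "u x = ppow r (f x)" for x
  have cu: "continuous_on UNIV u" unfolding u_def[abs_def] using r1 by (intro continuous_ppow f(1)) simp
  \<comment> \<open>The product of the diagonal entries is the quotient of the densities. Its \<open>n\<close>-th root contributes
    the missing power \<open>1 / n\<close> of the source density to \<open>u\<close>.\<close>
  have amgm: "n * ?K * (F x * ?v (T x)) \<le> u x * (\<Sum>b\<in>Basis. d b x)" for x
  proof -
    have "(\<Prod>b\<in>Basis. d b x) = F\<epsilon> x / P\<epsilon> * (m / w (T x))"
      using prod_knothe_deriv[OF kn _ bs(2), of x 0] bs mF mw by (simp add: d_def T_def)
    also have "\<dots> = m / P\<epsilon> * (F\<epsilon> x * ?v (T x) powr n)"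
      by (simp add: w_def powr_minus field_simps)
    finally have "(\<Prod>b\<in>Basis. d b x) = m / P\<epsilon> * (F\<epsilon> x * ?v (T x) powr n)" .
    moreover have "(m / P\<epsilon> * (F\<epsilon> x * ?v (T x) powr n)) powr (1 / n)
       = ?K * (F\<epsilon> x powr (1 / n) * (?v (T x) powr n) powr (1 / n))"
      using powr_mult[of "m / P\<epsilon>" "F\<epsilon> x * ?v (T x) powr n" "1 / n"]
        powr_mult[of "F\<epsilon> x" "?v (T x) powr n" "1 / n"] m0 P\<epsilon>0 F\<epsilon>0[of x] by simp
    moreover have "(?v (T x) powr n) powr (1 / n) = ?v (T x)"
      using v0[of "T x"] n0 by (simp add: powr_powr)
    ultimately have "(\<Prod>b\<in>Basis. d b x) powr (1 / n) = ?K * (F\<epsilon> x powr (1 / n) * ?v (T x))"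
      by (simp only:)
    moreover have "(\<Prod>b\<in>Basis. d b x) powr (1 / n) \<le> (\<Sum>b\<in>Basis. d b x / n)"
      unfolding n_def using d0 by (intro arith_geom_mean) (auto intro: less_imp_le)
    ultimately have "?K * (F\<epsilon> x powr (1 / n) * ?v (T x)) \<le> (\<Sum>b\<in>Basis. d b x) / n"
      by (simp add: sum_divide_distrib)
    then have le: "n * ?K * (F\<epsilon> x powr (1 / n) * ?v (T x)) \<le> (\<Sum>b\<in>Basis. d b x)"
      using n0 by (simp add: field_simps)
    have "F x = u x * F x powr (1 / n)"
      unfolding u_def F_def ppow_powr ppow_add[symmetric] using rp' by simp
    also have "\<dots> \<le> u x * F\<epsilon> x powr (1 / n)"
      using \<epsilon> n0 by (intro mult_left_mono powr_mono2) (auto simp: F\<epsilon>_def u_def F_def)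
    finally have "n * ?K * (F x * ?v (T x)) \<le> n * ?K * ((u x * F\<epsilon> x powr (1 / n)) * ?v (T x))"
      using n0 v0[of "T x"] by (intro mult_left_mono mult_right_mono) auto
    also have "\<dots> = u x * (n * ?K * (F\<epsilon> x powr (1 / n) * ?v (T x)))" by (simp add: mult_ac)
    also have "\<dots> \<le> u x * (\<Sum>b\<in>Basis. d b x)" using le by (intro mult_left_mono) (auto simp: u_def)
    finally show ?thesis .
  qed
  have cvT: "continuous_on UNIV (\<lambda>x. ?v (T x))" by (rule continuous_on_compose2[OF cv cT]) simp
  have lower: "n * ?K * (P\<epsilon> / m * cint R (\<lambda>y. ?v y powr (- (n - 1))) - \<epsilon> * (C * cint R (\<lambda>x::'a. 1)))
      \<le> cint R (\<lambda>x. u x * (\<Sum>b\<in>Basis. d b x))"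
  proof -
    have "cint R (\<lambda>x. F\<epsilon> x * ?v (T x)) = P\<epsilon> / m * cint R (\<lambda>y. w y * ?v y)"
      using v0 by (intro push cv) (auto intro: less_imp_le)
    also have "(\<lambda>y. w y * ?v y) = (\<lambda>y. ?v y powr (- (n - 1)))"
    proof
      fix y
      have "?v y powr (- (n - 1)) = ?v y powr (- n + 1)" by simp
      then show "w y * ?v y = ?v y powr (- (n - 1))" using v0[of y] by (simp only: powr_add w_def) simp
    qed
    finally have 1: "cint R (\<lambda>x. F\<epsilon> x * ?v (T x)) = P\<epsilon> / m * cint R (\<lambda>y. ?v y powr (- (n - 1)))" .
    have "cint R (\<lambda>x. ?v (T x)) \<le> cint R (\<lambda>x::'a. C * 1)"
      using C[OF Tcube] by (intro cint_mono cvT continuous_intros) auto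
    then have 2: "cint R (\<lambda>x. ?v (T x)) \<le> C * cint R (\<lambda>x::'a. 1)" by (simp only: cint_cmult)
    have "cint R (\<lambda>x. F x * ?v (T x)) = cint R (\<lambda>x. F\<epsilon> x * ?v (T x) + (- \<epsilon>) * ?v (T x))"
      by (simp add: F\<epsilon>_def algebra_simps)
    also have "\<dots> = cint R (\<lambda>x. F\<epsilon> x * ?v (T x)) + (- \<epsilon>) * cint R (\<lambda>x. ?v (T x))"
      by (subst cint_add) (auto intro!: continuous_intros cF\<epsilon> cvT simp only: cint_cmult)
    finally have "P\<epsilon> / m * cint R (\<lambda>y. ?v y powr (- (n - 1))) - \<epsilon> * (C * cint R (\<lambda>x::'a. 1)) \<le> cint R (\<lambda>x. F x * ?v (T x))"
      unfolding 1 using mult_left_mono[OF 2, of \<epsilon>] \<epsilon> by simp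
    then have "n * ?K * (P\<epsilon> / m * cint R (\<lambda>y. ?v y powr (- (n - 1))) - \<epsilon> * (C * cint R (\<lambda>x::'a. 1)))
       \<le> n * ?K * cint R (\<lambda>x. F x * ?v (T x))" using n0 by (intro mult_left_mono) auto
    also have "\<dots> = cint R (\<lambda>x. n * ?K * (F x * ?v (T x)))" by (simp only: cint_cmult)
    also have "\<dots> \<le> cint R (\<lambda>x. u x * (\<Sum>b\<in>Basis. d b x))"
      using amgm by (intro cint_mono continuous_intros cF cvT cu cd) auto
    finally show ?thesis .
  qed
  \<comment> \<open>After the integration by parts, \<open>X\<close> carries the energy and \<open>Y\<close> the transported density, and \<open>Y powr q\<close>
    can be integrated with the help of the push-forward formula.\<close>
  define Y where "Y x = indicator (cube R) x * (ppow (r - 1) (f x) * \<nu> (T x))" for x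
  define X where "X x = (if 0 < f x then h (- g x) else 0)" for x
  have bdry: "f x = 0" if "b \<in> Basis" "\<bar>x \<bullet> b\<bar> = R" for x b
    using that R by (intro f(2)) (auto simp: cube_def abs_le_iff intro!: bexI[of _ b])
  have cpr: "continuous_on UNIV (\<lambda>x. ppow (r - 1) (f x))" using r1 by (intro continuous_ppow f(1)) simp
  have cTb: "continuous_on UNIV (\<lambda>x. T x \<bullet> b)" for b by (intro continuous_intros cT)
  have [measurable]: "f \<in> borel_measurable borel" "g \<in> borel_measurable borel" "h \<in> borel_measurable borel"
      "(\<lambda>x. ppow (r - 1) (f x)) \<in> borel_measurable borel" "T \<in> borel_measurable borel" "\<nu> \<in> borel_measurable borel"
    using f(1) g1 h(1) cpr cT \<nu>(1) by (auto intro: borel_measurable_continuous_onI)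
  have iparts: "integrable lborel (\<lambda>x. indicator (cube R) x * (r * ppow (r - 1) (f x) * (g x \<bullet> b) * (T x \<bullet> b)))" if b: "b \<in> Basis" for b
  proof -
    obtain D where D: "\<And>x. x \<in> cube R \<Longrightarrow> \<bar>r * ppow (r - 1) (f x) * (T x \<bullet> b)\<bar> \<le> D"
      using bounded_on_cube[of "\<lambda>x. r * ppow (r - 1) (f x) * (T x \<bullet> b)" R]
        continuous_on_mult[OF continuous_on_mult[OF continuous_on_const[of UNIV r] cpr] cTb[of b]] by blast
    show ?thesis
    proof (rule integrable_cube)
      fix x :: 'a assume x: "x \<in> cube R"
      have "\<bar>g x \<bullet> b\<bar> \<le> B" using Basis_le_norm[OF b, of "g x"] B[of x] by linarith
      then have "\<bar>r * ppow (r - 1) (f x) * (T x \<bullet> b)\<bar> * \<bar>g x \<bullet> b\<bar> \<le> D * B"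
        using D[OF x] by (intro mult_mono) auto
      then show "\<bar>r * ppow (r - 1) (f x) * (g x \<bullet> b) * (T x \<bullet> b)\<bar> \<le> D * B" by (simp add: abs_mult mult_ac)
    qed measurable
  qed
  have X0: "0 \<le> X x" and Y0: "0 \<le> Y x" for x using h(2) \<nu>(2) by (auto simp: X_def Y_def)
  have Xm[measurable]: "X \<in> borel_measurable borel" unfolding X_def[abs_def] by measurable
  obtain D where D: "\<And>x. X x \<le> D"
  proof -
    have "bounded (h ` cball 0 B)"
      by (intro compact_imp_bounded compact_continuous_image continuous_on_subset[OF h(1)]) auto
    then obtain D where D: "\<And>z. z \<in> cball 0 B \<Longrightarrow> \<bar>h z\<bar> \<le> D"
      unfolding bounded_iff real_norm_def by blast
    have "X x \<le> D" for x
      using D[of "- g x"] h(2)[of "- g x"] B[of x] by (auto simp: X_def)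
    then show thesis by (rule that)
  qed
  have c\<nu>q: "continuous_on UNIV (\<lambda>y. \<nu> y powr q)"
    using \<nu> q1 by (intro continuous_on_powr' continuous_intros) auto
  have c\<nu>qT: "continuous_on UNIV (\<lambda>y. \<nu> (T y) powr q)" by (rule continuous_on_compose2[OF c\<nu>q cT]) simp
  have Yq: "Y x powr q = indicator (cube R) x * (F x * \<nu> (T x) powr q)" for x
    using \<nu>(2)[of "T x"] q1 rq by (simp add: Y_def indicator_def powr_mult ppow_powr F_def)
  have iXp: "integrable lborel (\<lambda>x. X x powr p)"
  proof -
    have eq: "X x powr p = indicator (cube R) x * X x powr p" for x
    proof (cases "x \<in> cube R")
      case False
      then have "x \<notin> cube M" using R cube_mono[of M R] by auto
      then show ?thesis using f(2)[of x] by (simp add: X_def)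
    qed simp
    show ?thesis
      by (subst eq, rule integrable_cube[where C="D powr p"]) (use X0 D p in \<open>auto intro!: powr_mono2\<close>)
  qed
  have iYq: "integrable lborel (\<lambda>x. Y x powr q)"
    unfolding Yq by (intro integrable_cube_continuous continuous_intros cF c\<nu>qT)
  have iXY: "integrable lborel (\<lambda>x. X x * Y x)"
  proof -
    have c\<nu>T: "continuous_on UNIV (\<lambda>x. ppow (r - 1) (f x) * \<nu> (T x))"
      by (intro continuous_intros cpr continuous_on_compose2[OF \<nu>(1) cT]) simp
    obtain E where E: "\<And>x. x \<in> cube R \<Longrightarrow> \<bar>ppow (r - 1) (f x) * \<nu> (T x)\<bar> \<le> E"
      using bounded_on_cube[OF c\<nu>T] by blast
    have "integrable lborel (\<lambda>x. indicator (cube R) x * (X x * (ppow (r - 1) (f x) * \<nu> (T x))))"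
    proof (rule integrable_cube[where C="D * E"])
      fix x :: 'a assume "x \<in> cube R"
      then show "\<bar>X x * (ppow (r - 1) (f x) * \<nu> (T x))\<bar> \<le> D * E"
        unfolding abs_mult[of "X x"] using X0[of x] D[of x] E[of x] by (intro mult_mono) auto
    qed measurable
    moreover have "indicator (cube R) x * (X x * (ppow (r - 1) (f x) * \<nu> (T x))) = X x * Y x" for x
      by (simp add: Y_def)
    ultimately show ?thesis by (simp only:)
  qed
  have "cint R (\<lambda>x. u x * (\<Sum>b\<in>Basis. d b x)) = (\<Sum>b\<in>Basis. cint R (\<lambda>x. u x * d b x))"
    unfolding sum_distrib_left by (intro cint_sum continuous_intros cu cd)
  also have "\<dots> = (\<Sum>b\<in>Basis. - (LINT x|lborel. indicator (cube R) x * (r * ppow (r - 1) (f x) * (g x \<bullet> b) * (T x \<bullet> b))))"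
  proof (rule sum.cong)
    fix b :: 'a assume b: "b \<in> Basis"
    show "cint R (\<lambda>x. u x * d b x) = - (LINT x|lborel. indicator (cube R) x * (r * ppow (r - 1) (f x) * (g x \<bullet> b) * (T x \<bullet> b)))"
      unfolding cint_def u_def
    proof (rule integration_by_parts_on_lines[OF grd f(1) bdry b R0 r1 cTb cd])
      fix x :: 'a assume "x \<bullet> b \<in> {-R..R}"
      then show "((\<lambda>s. T (upd x b s) \<bullet> b) has_real_derivative d b x) (at (x \<bullet> b) within {-R..R})"
        unfolding T_def d_def using knothe_has_derivative[OF kn _ bs(2), of b x 0] bs b by simp
    qed (use b in auto)
  qed simp
  also have "\<dots> = - (LINT x|lborel. (\<Sum>b\<in>Basis. indicator (cube R) x * (r * ppow (r - 1) (f x) * (g x \<bullet> b) * (T x \<bullet> b))))"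
    using iparts by (subst Bochner_Integration.integral_sum) (auto simp: sum_negf)
  also have "\<dots> = (LINT x|lborel. - (\<Sum>b\<in>Basis. indicator (cube R) x * (r * ppow (r - 1) (f x) * (g x \<bullet> b) * (T x \<bullet> b))))"
    by simp
  also have "\<dots> \<le> (LINT x|lborel. r * (X x * Y x))"
  proof (rule integral_mono)
    show "integrable lborel (\<lambda>x. - (\<Sum>b\<in>Basis. indicator (cube R) x * (r * ppow (r - 1) (f x) * (g x \<bullet> b) * (T x \<bullet> b))))"
      by (intro Bochner_Integration.integrable_minus Bochner_Integration.integrable_sum iparts)
    show "integrable lborel (\<lambda>x. r * (X x * Y x))" using iXY by simp
    fix x :: 'a
    have "- (\<Sum>b\<in>Basis. indicator (cube R) x * (r * ppow (r - 1) (f x) * (g x \<bullet> b) * (T x \<bullet> b)))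
       = indicator (cube R) x * (r * ppow (r - 1) (f x) * (- g x \<bullet> T x))"
      by (subst (2) euclidean_inner) (simp add: sum_distrib_left sum_negf mult_ac)
    also have "\<dots> \<le> r * (X x * Y x)"
    proof (cases "0 < f x")
      case True
      have "indicator (cube R) x * (r * ppow (r - 1) (f x) * (- g x \<bullet> T x))
         \<le> indicator (cube R) x * (r * ppow (r - 1) (f x) * (h (- g x) * \<nu> (T x)))"
        using r1 by (intro mult_left_mono h(3)) auto
      then show ?thesis using True by (simp add: X_def Y_def mult_ac)
    qed (simp add: X_def)
    finally show "- (\<Sum>b\<in>Basis. indicator (cube R) x * (r * ppow (r - 1) (f x) * (g x \<bullet> b) * (T x \<bullet> b))) \<le> r * (X x * Y x)" .
  qed
  also have "\<dots> = r * (LINT x|lborel. X x * Y x)" by simp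
  also have "\<dots> \<le> r * ((LINT x|lborel. X x powr p) powr (1 / p) * (LINT x|lborel. Y x powr q) powr (1 / q))"
    using r1 by (intro mult_left_mono Holder_integral p q1 pq X0 Y0 iXp iYq iXY) auto
  also have "\<dots> \<le> r * ((LINT x|lborel. X x powr p) powr (1 / p) * (P\<epsilon> / m * cint R (\<lambda>y. w y * \<nu> y powr q)) powr (1 / q))"
  proof (intro mult_left_mono powr_mono2)
    have "(LINT x|lborel. Y x powr q) = cint R (\<lambda>x. F x * \<nu> (T x) powr q)" by (simp add: cint_def Yq)
    also have "\<dots> \<le> cint R (\<lambda>x. F\<epsilon> x * \<nu> (T x) powr q)"
      using \<epsilon> by (intro cint_mono continuous_intros cF cF\<epsilon> c\<nu>qT mult_right_mono) (auto simp: F\<epsilon>_def)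
    also have "\<dots> = P\<epsilon> / m * cint R (\<lambda>y. w y * \<nu> y powr q)"
      by (rule push[OF c\<nu>q]) simp
    finally show "(LINT x|lborel. Y x powr q) \<le> P\<epsilon> / m * cint R (\<lambda>y. w y * \<nu> y powr q)" .
  qed (use r1 q1 in \<open>auto intro: integral_nonneg_AE\<close>)
  finally have "cint R (\<lambda>x. u x * (\<Sum>b\<in>Basis. d b x)) \<le>
     r * ((LINT x|lborel. X x powr p) powr (1 / p) * (P\<epsilon> / m * cint R (\<lambda>y. w y * \<nu> y powr q)) powr (1 / q))" .
  with lower show ?thesis unfolding X_def w_def by (simp add: mult.assoc)
qed

section \<open>The sharp Sobolev inequality\<close>

lemma sobolev_cube:
  fixes f \<nu> h :: "'a::euclidean_space \<Rightarrow> real" and g :: "'a \<Rightarrow> 'a"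
  defines "n \<equiv> real DIM('a)"
  assumes p: "1 < p" "p < n" and q: "q = p / (p - 1)" and r: "r = p * (n - 1) / (n - p)" and p': "p' = n * p / (n - p)"
    and \<nu>: "continuous_on UNIV \<nu>" "\<And>y. 0 \<le> \<nu> y"
    and h: "continuous_on UNIV h" "\<And>z. 0 \<le> h z" "\<And>z y. z \<bullet> y \<le> h z * \<nu> y"
    and grd: "ae_gradient f g N"
    and f: "continuous_on UNIV f" "\<And>x. x \<notin> cube M \<Longrightarrow> f x = 0" and R: "0 < M" "M < R"
    and P: "P = cint R (\<lambda>x. ppow p' (f x))" "0 < P"
    and m: "m = cint R (\<lambda>y. profile \<nu> q y powr (- n))" "0 < m"
  shows "n * (m / P) powr (1 / n) * (P / m * cint R (\<lambda>y. profile \<nu> q y powr (- (n - 1))))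
    \<le> r * (LINT x|lborel. (if 0 < f x then h (- g x) else 0) powr p) powr (1 / p)
        * (P / m * cint R (\<lambda>y. profile \<nu> q y powr (- n) * \<nu> y powr q)) powr (1 / q)"
proof -
  have q0: "0 < q" using p by (simp add: q)
  obtain C where C: "\<And>y. y \<in> cube R \<Longrightarrow> \<bar>profile \<nu> q y\<bar> \<le> C"
    using bounded_on_cube[OF continuous_profile[OF \<nu> q0]] by blast
  then have C: "\<And>y. y \<in> cube R \<Longrightarrow> profile \<nu> q y \<le> C" by (rule abs_le_D1)
  let ?a = "cint R (\<lambda>y. profile \<nu> q y powr (- (n - 1)))"
  let ?c = "cint R (\<lambda>y. profile \<nu> q y powr (- n) * \<nu> y powr q)"
  let ?vol = "cint R (\<lambda>x::'a. 1)"
  let ?H = "(LINT x|lborel. (if 0 < f x then h (- g x) else 0) powr p) powr (1 / p)"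
  let ?P = "\<lambda>\<epsilon>. P + \<epsilon> * ?vol"
  have c0: "0 \<le> ?c" by (intro cint_nonneg) simp
  have vol0: "0 \<le> ?vol" by (intro cint_nonneg) simp
  have tP: "((\<lambda>\<epsilon>. ?P \<epsilon>) \<longlongrightarrow> P + 0 * ?vol) (at_right 0)" by (intro tendsto_intros)
  then have tP: "(?P \<longlongrightarrow> P) (at_right 0)" by simp
  have "((\<lambda>\<epsilon>. n * (m / ?P \<epsilon>) powr (1 / n) * (?P \<epsilon> / m * ?a - \<epsilon> * (C * ?vol)))
      \<longlongrightarrow> n * (m / P) powr (1 / n) * (P / m * ?a - 0 * (C * ?vol))) (at_right 0)"
    using P(2) m(2) by (intro tendsto_intros tP) auto
  moreover have "((\<lambda>\<epsilon>. r * ?H * (?P \<epsilon> / m * ?c) powr (1 / q)) \<longlongrightarrow> r * ?H * (P / m * ?c) powr (1 / q)) (at_right 0)"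
  proof (intro tendsto_mult tendsto_const tendsto_powr2)
    show "((\<lambda>\<epsilon>. ?P \<epsilon> / m) \<longlongrightarrow> P / m) (at_right 0)" using m(2) by (intro tendsto_intros tP) auto
    show "\<forall>\<^sub>F \<epsilon> in at_right 0. 0 \<le> ?P \<epsilon> / m * ?c"
      using P(2) m(2) c0 vol0 by (auto simp: eventually_at_right_field intro!: exI[of _ 1])
  qed (use q0 in auto)
  moreover have "\<forall>\<^sub>F \<epsilon> in at_right 0. n * (m / ?P \<epsilon>) powr (1 / n) * (?P \<epsilon> / m * ?a - \<epsilon> * (C * ?vol)) \<le> r * ?H * (?P \<epsilon> / m * ?c) powr (1 / q)"
  proof -
    have "n * (m / ?P \<epsilon>) powr (1 / n) * (?P \<epsilon> / m * ?a - \<epsilon> * (C * ?vol)) \<le> r * ?H * (?P \<epsilon> / m * ?c) powr (1 / q)"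
      if "0 < \<epsilon>" for \<epsilon>
      unfolding n_def
      by (rule sobolev_cube_perturbed[OF p[unfolded n_def] q r[unfolded n_def] p'[unfolded n_def] \<nu> h grd f R that])
         (use C P m in \<open>auto simp: n_def\<close>)
    then show ?thesis by (auto simp: eventually_at_right_field intro!: exI[of _ 1])
  qed
  ultimately have "n * (m / P) powr (1 / n) * (P / m * ?a - 0 * (C * ?vol)) \<le> r * ?H * (P / m * ?c) powr (1 / q)"
    by (intro tendsto_le[of "at_right (0::real)"]) auto
  then show ?thesis by simp
qed

lemma cint_exhaust:
  fixes \<phi> :: "'a::euclidean_space \<Rightarrow> real"
  assumes "integrable lborel \<phi>"
  shows "(\<lambda>k. cint (R + real k) \<phi>) \<longlonglongrightarrow> integral\<^sup>L lborel \<phi>"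
  unfolding cint_def
proof (rule integral_dominated_convergence)
  show "integrable lborel (\<lambda>x. norm (\<phi> x))" using assms by simp
  show "AE x in lborel. (\<lambda>k. indicator (cube (R + real k)) x * \<phi> x) \<longlonglongrightarrow> \<phi> x"
  proof (rule AE_I2)
    fix x :: 'a
    obtain k0 :: nat where k0: "norm x - R \<le> real k0" using real_arch_simple by blast
    have "x \<in> cube (R + real k)" if "k \<ge> k0" for k
    proof -
      have "x \<bullet> b \<in> {- (R + real k)..R + real k}" if "b \<in> Basis" for b
      proof -
        have "\<bar>x \<bullet> b\<bar> \<le> norm x" by (rule Basis_le_norm[OF that])
        also have "\<dots> \<le> R + real k" using k0 \<open>k \<ge> k0\<close> by linarith
        finally show ?thesis by (auto simp: abs_le_iff)
      qed
      then show ?thesis unfolding cube_def by blast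
    qed
    then have "\<forall>\<^sub>F k in sequentially. indicator (cube (R + real k)) x * \<phi> x = \<phi> x"
      by (intro eventually_sequentiallyI[of k0]) auto
    then show "(\<lambda>k. indicator (cube (R + real k)) x * \<phi> x) \<longlonglongrightarrow> \<phi> x"
      by (rule tendsto_eventually)
  qed
qed (use assms in \<open>auto simp: indicator_def\<close>)

text \<open>Solving the limiting inequality for the norm of \<open>f\<close>. The powers of \<open>m\<close> combine to \<open>- 1 / n\<close>.\<close>

lemma sobolev_constant_algebra:
  fixes n p q r p' P m H :: real
  assumes p: "1 < p" "p < n" and q: "q = p / (p - 1)" and r: "r = p * (n - 1) / (n - p)" and p': "p' = n * p / (n - p)"
    and P: "0 < P" and m: "0 < m" and H: "0 \<le> H"
    and le: "n * (m / P) powr (1 / n) * (P / m * (r * m)) \<le> r * H * (P / m * ((r - 1) * m)) powr (1 / q)"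
  shows "P powr (1 / p') \<le> n powr (- (1 / p)) * ((p - 1) / (n - p)) powr (1 - 1 / p) * (1 / m) powr (1 / n) * H"
proof -
  have n0: "n > 0" and q0: "q > 0" using p by (auto simp: q)
  have r1: "r - 1 = n * ((p - 1) / (n - p))" using p unfolding r by (simp add: divide_simps) (simp add: algebra_simps)
  have r10: "r - 1 > 0" unfolding r1 using p n0 by simp
  have iq: "1 / q = 1 - 1 / p" using p by (simp add: q field_simps)
  have ip': "1 / p' = 1 / p - 1 / n" using p n0 by (simp add: p' field_simps)
  define s where "s = (r - 1) powr (1 / q)"
  have s0: "s > 0" using r10 by (simp add: s_def)
  have e1: "n * (m / P) powr (1 / n) * (P / m * (r * m)) = r * (n * (m powr (1 / n) * P powr (1 - 1 / n)))"
    using P m by (simp add: powr_divide powr_diff)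
  have e2: "r * H * (P / m * ((r - 1) * m)) powr (1 / q) = r * (H * (P powr (1 / q) * s))"
    using P m r10 by (simp add: s_def powr_mult)
  have "r * (n * (m powr (1 / n) * P powr (1 - 1 / n))) \<le> r * (H * (P powr (1 / q) * s))"
    using le unfolding e1 e2 .
  then have "n * (m powr (1 / n) * P powr (1 - 1 / n)) \<le> H * (P powr (1 / q) * s)"
    using r10 by (simp only: mult_le_cancel_left_pos)
  moreover have "P powr (1 - 1 / n) = P powr (1 / p') * P powr (1 / q)"
    unfolding iq ip' by (simp flip: powr_add)
  ultimately have "(n * m powr (1 / n) * P powr (1 / p')) * P powr (1 / q) \<le> (H * s) * P powr (1 / q)"
    by (simp add: mult_ac)
  then have "n * m powr (1 / n) * P powr (1 / p') \<le> H * s" using P by simp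
  then have "P powr (1 / p') \<le> H * s / (n * m powr (1 / n))"
    using n0 m by (simp add: pos_le_divide_eq mult_ac)
  also have "s = n powr (1 - 1 / p) * ((p - 1) / (n - p)) powr (1 - 1 / p)"
    unfolding s_def r1 iq using p n0 by (intro powr_mult)
  also have "H * (n powr (1 - 1 / p) * ((p - 1) / (n - p)) powr (1 - 1 / p)) / (n * m powr (1 / n))
     = n powr (- (1 / p)) * ((p - 1) / (n - p)) powr (1 - 1 / p) * (1 / m) powr (1 / n) * H"
  proof -
    have "n powr (1 - 1 / p) = n * n powr (- (1 / p))" using n0 by (simp add: powr_diff powr_minus_divide)
    then show ?thesis using n0 m by (simp add: powr_divide)
  qed
  finally show ?thesis .
qed

lemma Gamma_factors_pos:
  fixes n p :: real
  assumes "1 < p" "p < n"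
  shows "0 < Gamma n" "0 < Gamma (n / p)" "0 < Gamma (n + 1 - n / p)"
proof -
  have "n / p < n" using assms by (simp add: field_simps)
  then show "0 < Gamma n" "0 < Gamma (n / p)" "0 < Gamma (n + 1 - n / p)"
    using assms by (auto intro!: Gamma_real_pos)
qed

text \<open>Exhausting the space by cubes. The integral of \<open>profile powr (- n) * \<nu> powr q\<close> is the difference of
  the integrals of two powers of the profile, because \<open>\<nu> powr q = profile - 1\<close>.\<close>

theorem sobolev_positive_part:
  fixes f \<nu> h :: "'a::euclidean_space \<Rightarrow> real" and g :: "'a \<Rightarrow> 'a"
  defines "n \<equiv> real DIM('a)"
  assumes p: "1 < p" "p < n" and p': "p' = n * p / (n - p)"
    and \<nu>: "continuous_on UNIV \<nu>" "\<And>y. 0 \<le> \<nu> y" "pos_homogeneous \<nu>"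
    and V: "emeasure lborel {y. \<nu> y \<le> 1} = ennreal V" "0 < V"
    and h: "continuous_on UNIV h" "\<And>z. 0 \<le> h z" "\<And>z y. z \<bullet> y \<le> h z * \<nu> y"
    and grd: "ae_gradient f g N"
    and f: "continuous_on UNIV f" "\<And>x. x \<notin> cube M \<Longrightarrow> f x = 0" and M: "0 < M"
  shows "(LINT x|lborel. ppow p' (f x)) powr (1 / p')
    \<le> unit_ball_vol n powr (1 / n) * sobolev_const DIM('a) p * V powr (- (1 / n)) *
       (LINT x|lborel. (if 0 < f x then h (- g x) else 0) powr p) powr (1 / p)"
proof (cases "(LINT x|lborel. ppow p' (f x)) = 0")
  case True
  then show ?thesis using Gamma_factors_pos[OF p] by (simp add: sobolev_const_def n_def)
next
  case False
  define q where "q = p / (p - 1)"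
  define r where "r = p * (n - 1) / (n - p)"
  define P where "P = (LINT x|lborel. ppow p' (f x))"
  have "0 \<le> P" unfolding P_def by (intro integral_nonneg_AE) auto
  then have P0: "0 < P" using False unfolding P_def by linarith
  have n0: "0 < n" using p by simp
  have q0: "0 < q" using p by (simp add: q_def)
  let ?v = "profile \<nu> q"
  have v1: "1 \<le> ?v y" for y by (rule profile_ge_1)
  have [measurable]: "?v \<in> borel_measurable borel" by (rule profile_measurable[OF \<nu>(1)])
  note cst = extremal_mass_constants[OF p q_def r_def]
  define m where "m = V * (Gamma (n / p) * Gamma (n + 1 - n / p) / Gamma n)"
  note gam = Gamma_factors_pos[OF p]
  have m0: "0 < m" using gam V by (simp add: m_def)
  have r0: "0 < r" using p by (simp add: r_def)
  have nn: "(\<integral>\<^sup>+ y. ennreal (?v y powr (- n)) \<partial>lborel) = ennreal m"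
  proof -
    have "n / q < n" using cst(3) by simp
    then have "(\<integral>\<^sup>+ y. ennreal (?v y powr (- n)) \<partial>lborel) = ennreal (n * V * Beta (n - n / q) (n / q + 1))"
      using nn_integral_profile[OF \<nu> V(1) less_imp_le[OF V(2)] q0, of n] by (simp add: n_def)
    also have "n * V * Beta (n - n / q) (n / q + 1) = V * (n * Beta (n - n / q) (n / q + 1))" by simp
    finally show ?thesis unfolding m_def cst(1) .
  qed
  have nn1: "(\<integral>\<^sup>+ y. ennreal (?v y powr (- (n - 1))) \<partial>lborel) = ennreal (r * m)"
  proof -
    have "(\<integral>\<^sup>+ y. ennreal (?v y powr (- (n - 1))) \<partial>lborel) = ennreal ((n - 1) * V * Beta (n - 1 - n / q) (n / q + 1))"
      using nn_integral_profile[OF \<nu> V(1) less_imp_le[OF V(2)] q0, of "n - 1"] cst(3) by (simp add: n_def)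
    also have "(n - 1) * V * Beta (n - 1 - n / q) (n / q + 1) = V * ((n - 1) * Beta (n - 1 - n / q) (n / q + 1))" by simp
    also have "\<dots> = r * m" unfolding cst(2) m_def cst(1) by simp
    finally show ?thesis .
  qed
  have int: "has_bochner_integral lborel (\<lambda>y. ?v y powr (- n)) m"
    using nn m0 by (intro has_bochner_integral_nn_integral) auto
  have int1: "has_bochner_integral lborel (\<lambda>y. ?v y powr (- (n - 1))) (r * m)"
    using nn1 m0 r0 by (intro has_bochner_integral_nn_integral) auto
  have split: "?v y powr (- n) * \<nu> y powr q = ?v y powr (- (n - 1)) - ?v y powr (- n)" for y
  proof -
    have "?v y powr (- (n - 1)) = ?v y powr (- n + 1)" by simp
    also have "\<dots> = ?v y powr (- n) * ?v y" using v1[of y] by (simp only: powr_add) simp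
    finally show ?thesis by (simp add: profile_def algebra_simps)
  qed
  have int2: "has_bochner_integral lborel (\<lambda>y. ?v y powr (- n) * \<nu> y powr q) ((r - 1) * m)"
    unfolding split using has_bochner_integral_diff[OF int1 int] by (simp add: left_diff_distrib)
  let ?H = "(LINT x|lborel. (if 0 < f x then h (- g x) else 0) powr p) powr (1 / p)"
  \<comment> \<open>These cubes are strictly larger than the one that carries \<open>f\<close>, so \<open>f\<close> vanishes on their boundaries.\<close>
  let ?R = "\<lambda>k::nat. (M + 1) + real k"
  let ?m = "\<lambda>k. cint (?R k) (\<lambda>y. ?v y powr (- n))"
  let ?a = "\<lambda>k. cint (?R k) (\<lambda>y. ?v y powr (- (n - 1)))"
  let ?c = "\<lambda>k. cint (?R k) (\<lambda>y. ?v y powr (- n) * \<nu> y powr q)"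
  have tm: "?m \<longlonglongrightarrow> m" and ta: "?a \<longlonglongrightarrow> r * m" and tc: "?c \<longlonglongrightarrow> (r - 1) * m"
    using cint_exhaust[of "\<lambda>y. ?v y powr (- n)" "M + 1"] cint_exhaust[of "\<lambda>y. ?v y powr (- (n - 1))" "M + 1"]
      cint_exhaust[of "\<lambda>y. ?v y powr (- n) * \<nu> y powr q" "M + 1"] int int1 int2
    by (simp_all add: has_bochner_integral_iff)
  have Pk: "P = cint (?R k) (\<lambda>x. ppow p' (f x))" for k
  proof -
    have eq: "indicator (cube (?R k)) x * ppow p' (f x) = ppow p' (f x)" for x
    proof (cases "x \<in> cube (?R k)")
      case False
      then have "x \<notin> cube M" using cube_mono[of M "?R k"] by auto
      then show ?thesis using f(2) by simp
    qed simp
    show ?thesis unfolding P_def cint_def eq ..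
  qed
  have m_pos: "\<forall>\<^sub>F k in sequentially. 0 < ?m k" using tm m0 by (rule order_tendstoD)
  have le: "\<forall>\<^sub>F k in sequentially. n * (?m k / P) powr (1 / n) * (P / ?m k * ?a k) \<le> r * ?H * (P / ?m k * ?c k) powr (1 / q)"
    using m_pos
  proof eventually_elim
    fix k assume "0 < ?m k"
    then show "n * (?m k / P) powr (1 / n) * (P / ?m k * ?a k) \<le> r * ?H * (P / ?m k * ?c k) powr (1 / q)"
      unfolding n_def
      by (intro sobolev_cube[where M=M and p'=p' and N=N and f=f and g=g and h=h and \<nu>=\<nu> and p=p and R="?R k"])
         (use p p' q_def r_def \<nu> h grd f M Pk P0 in \<open>auto simp: n_def\<close>)
  qed
  have "n * (m / P) powr (1 / n) * (P / m * (r * m)) \<le> r * ?H * (P / m * ((r - 1) * m)) powr (1 / q)"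
  proof (rule tendsto_le[OF sequentially_bot _ _ le])
    show "(\<lambda>k. n * (?m k / P) powr (1 / n) * (P / ?m k * ?a k)) \<longlonglongrightarrow> n * (m / P) powr (1 / n) * (P / m * (r * m))"
      using P0 m0 by (intro tendsto_intros tm ta) auto
    show "(\<lambda>k. r * ?H * (P / ?m k * ?c k) powr (1 / q)) \<longlonglongrightarrow> r * ?H * (P / m * ((r - 1) * m)) powr (1 / q)"
    proof (intro tendsto_mult tendsto_const tendsto_powr2)
      show "(\<lambda>k. P / ?m k) \<longlonglongrightarrow> P / m" using m0 by (intro tendsto_intros tm) auto
      show "\<forall>\<^sub>F k in sequentially. 0 \<le> P / ?m k * ?c k"
        using P0 by (intro always_eventually allI mult_nonneg_nonneg divide_nonneg_nonneg cint_nonneg) auto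
    qed (use tc q0 in auto)
  qed
  from sobolev_constant_algebra[OF p q_def r_def p' P0 m0 _ this]
  have "P powr (1 / p') \<le> n powr (- (1 / p)) * ((p - 1) / (n - p)) powr (1 - 1 / p) * (1 / m) powr (1 / n) * ?H"
    by simp
  also have "(1 / m) powr (1 / n) = V powr (- (1 / n)) * unit_ball_vol n powr (1 / n) *
     (Gamma n / (unit_ball_vol n * Gamma (n / p) * Gamma (n + 1 - n / p))) powr (1 / n)"
  proof -
    have \<omega>: "0 < unit_ball_vol n" using n0 by simp
    define Z where "Z = Gamma n / (unit_ball_vol n * Gamma (n / p) * Gamma (n + 1 - n / p))"
    have Z: "0 < Z" using \<omega> gam by (simp add: Z_def)
    have "1 / m = (1 / V) * (unit_ball_vol n * Z)"
      using \<omega> gam V by (simp add: m_def Z_def)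
    also have "\<dots> powr (1 / n) = (1 / V) powr (1 / n) * (unit_ball_vol n powr (1 / n) * Z powr (1 / n))"
      using powr_mult[of "1 / V" "unit_ball_vol n * Z" "1 / n"] powr_mult[of "unit_ball_vol n" Z "1 / n"] \<omega> Z V by simp
    also have "(1 / V) powr (1 / n) = V powr (- (1 / n))" using V by (simp add: powr_divide powr_minus_divide)
    finally show ?thesis by (simp add: Z_def)
  qed
  finally show ?thesis
    unfolding P_def by (simp add: sobolev_const_def n_def mult_ac)
qed

section \<open>The inequality for the polytope of a piecewise affine function\<close>

lemma continuous_on_Max_insert_0:
  fixes \<phi> :: "'i \<Rightarrow> 'a::topological_space \<Rightarrow> real"
  assumes "finite U" "\<And>u. u \<in> U \<Longrightarrow> continuous_on S (\<phi> u)"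
  shows "continuous_on S (\<lambda>y. Max (insert 0 ((\<lambda>u. \<phi> u y) ` U)))"
  using assms
proof (induction U)
  case (insert u U)
  have "Max (insert 0 ((\<lambda>u. \<phi> u y) ` insert u U)) = max (\<phi> u y) (Max (insert 0 ((\<lambda>u. \<phi> u y) ` U)))" for y
    using insert.hyps by (simp add: insert_commute[of 0] Max_insert)
  then show ?case using insert by (simp add: continuous_on_max)
qed simp

text \<open>The gauge of \<open>K\<close> is the maximum of the linear functions \<open>u \<bullet> y / h u\<close> over the facet normals, and of 0.
  It vanishes only at the origin since \<open>K\<close> is bounded.\<close>

lemma origin_polytope_gauge:
  fixes K :: "'a::euclidean_space set"
  assumes K: "origin_polytope K"
  obtains \<nu> :: "'a \<Rightarrow> real" where "continuous_on UNIV \<nu>" "\<And>y. 0 \<le> \<nu> y" "pos_homogeneous \<nu>"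
    "{y. \<nu> y \<le> 1} = K" "\<And>z y. z \<bullet> y \<le> support_fun K z * \<nu> y"
proof -
  note K' = origin_polytopeD[OF K]
  obtain U where U: "finite U" "\<And>u. u \<in> U \<Longrightarrow> norm u = 1" "K = {x. \<forall>u\<in>U. u \<bullet> x \<le> support_fun K u}"
    using origin_polytope_facets[OF K] by blast
  define \<nu> where "\<nu> y = Max (insert 0 ((\<lambda>u. u \<bullet> y / support_fun K u) ` U))" for y
  have hpos: "0 < support_fun K u" if "u \<in> U" for u using U(2)[OF that] by (intro support_fun_pos K) auto
  have cont: "continuous_on UNIV \<nu>"
    unfolding \<nu>_def[abs_def] using hpos
    by (intro continuous_on_Max_insert_0 U continuous_intros) (auto simp: less_imp_neq[symmetric])
  have nonneg: "0 \<le> \<nu> y" for y unfolding \<nu>_def using U(1) by (intro Max_ge) auto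
  have hom: "\<nu> (t *\<^sub>R y) = t * \<nu> y" if "0 \<le> t" for t y
  proof -
    have "t * \<nu> y = Max ((\<lambda>x. t * x) ` insert 0 ((\<lambda>u. u \<bullet> y / support_fun K u) ` U))"
      unfolding \<nu>_def using that U(1) by (intro mono_Max_commute monoI mult_left_mono) auto
    then show ?thesis unfolding \<nu>_def by (simp add: image_image)
  qed
  have ball: "\<nu> y \<le> 1 \<longleftrightarrow> y \<in> K" for y
  proof -
    have "\<nu> y \<le> 1 \<longleftrightarrow> (\<forall>u\<in>U. u \<bullet> y / support_fun K u \<le> 1)"
      unfolding \<nu>_def using U(1) by (subst Max_le_iff) auto
    also have "\<dots> \<longleftrightarrow> (\<forall>u\<in>U. u \<bullet> y \<le> support_fun K u)" using hpos by (intro ball_cong) (auto simp: pos_divide_le_eq)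
    also have "\<dots> \<longleftrightarrow> y \<in> K" by (subst (2) U(3)) simp
    finally show ?thesis .
  qed
  have pair: "z \<bullet> y \<le> support_fun K z * \<nu> y" for z y
  proof (cases "\<nu> y = 0")
    case False
    then have pos: "0 < \<nu> y" using nonneg[of y] by simp
    have "\<nu> ((1 / \<nu> y) *\<^sub>R y) = (1 / \<nu> y) * \<nu> y" using pos by (intro hom) simp
    then have "(1 / \<nu> y) *\<^sub>R y \<in> K" using pos ball[of "(1 / \<nu> y) *\<^sub>R y"] by simp
    then have "z \<bullet> ((1 / \<nu> y) *\<^sub>R y) \<le> support_fun K z" by (intro support_fun_upper K')
    then show ?thesis using pos by (simp add: divide_le_eq)
  next
    case True
    have "y = 0"
    proof (rule ccontr)
      assume "y \<noteq> 0"
      obtain B where B: "\<And>x. x \<in> K \<Longrightarrow> norm x \<le> B" using K'(4) by (auto simp: bounded_iff)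
      have B0: "0 \<le> B" using B[OF K'(5)] by simp
      define t where "t = (B + 1) / norm y"
      have t: "0 \<le> t" using B0 by (simp add: t_def)
      then have "t *\<^sub>R y \<in> K" using hom[OF t, of y] True ball[of "t *\<^sub>R y"] by simp
      then show False using B[of "t *\<^sub>R y"] B0 \<open>y \<noteq> 0\<close> by (simp add: t_def)
    qed
    then show ?thesis using nonneg support_fun_nonneg[OF K] by simp
  qed
  show thesis
    by (rule that[of \<nu>]) (use cont nonneg hom ball pair in \<open>auto simp: pos_homogeneous_def\<close>)
qed

lemma measure_origin_polytope_pos:
  fixes K :: "'a::euclidean_space set"
  assumes K: "origin_polytope K"
  shows "emeasure lborel K = ennreal (measure lebesgue K)" "0 < measure lebesgue K"
proof -
  note K' = origin_polytopeD[OF K]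
  have "emeasure lborel K = emeasure lebesgue K" using K'(3) by simp
  also have "\<dots> = ennreal (measure lebesgue K)" by (rule emeasure_eq_measure2[OF lmeasurable_compact[OF K'(1)]])
  finally show "emeasure lborel K = ennreal (measure lebesgue K)" .
  have "\<not> negligible K" using K interior_subset open_not_negligible[OF open_interior, of K] negligible_subset[of K "interior K"]
    by (auto simp: origin_polytope_def)
  then have "measure lebesgue K \<noteq> 0"
    using lmeasurable_compact[OF K'(1)] negligible_iff_measure0 by blast
  then show "0 < measure lebesgue K" by (simp add: zero_less_measure_iff)
qed

lemma powr_superadditive:
  fixes x y s :: real
  assumes "0 \<le> x" "0 \<le> y" "1 \<le> s"
  shows "x powr s + y powr s \<le> (x + y) powr s"
proof -
  have split: "z powr s = z * z powr (s - 1)" if "0 \<le> z" for z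
    using that powr_add[of z 1 "s - 1"] by (cases "z = 0") auto
  have "x powr s + y powr s = x * x powr (s - 1) + y * y powr (s - 1)" using assms split by simp
  also have "\<dots> \<le> x * (x + y) powr (s - 1) + y * (x + y) powr (s - 1)"
    using assms by (intro add_mono mult_left_mono powr_mono2) auto
  also have "\<dots> = (x + y) powr s" using assms split[of "x + y"] by (simp add: distrib_right)
  finally show ?thesis .
qed

text \<open>Raise both bounds to the power \<open>p'\<close>, add them, and use that \<open>H powr (p' / p)\<close> is superadditive.\<close>

lemma combine_sign_parts:
  fixes a b :: real
  assumes p: "0 < p" "p \<le> p'" and nonneg: "0 \<le> a" "0 \<le> b" "0 \<le> H1" "0 \<le> H2" "0 \<le> c"
    and a: "a powr (1 / p') \<le> c * H1 powr (1 / p)" and b: "b powr (1 / p') \<le> c * H2 powr (1 / p)"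
  shows "(a + b) powr (1 / p') \<le> c * (H1 + H2) powr (1 / p)"
proof -
  have p'0: "0 < p'" using p by simp
  have raise: "z \<le> c powr p' * H powr (p' / p)" if "z powr (1 / p') \<le> c * H powr (1 / p)" "0 \<le> z" "0 \<le> H" for z H
  proof -
    have "z = (z powr (1 / p')) powr p'" using that p'0 by (simp add: powr_powr)
    also have "\<dots> \<le> (c * H powr (1 / p)) powr p'" using that p'0 by (intro powr_mono2) auto
    also have "\<dots> = c powr p' * H powr (p' / p)" using nonneg that by (simp add: powr_mult powr_powr)
    finally show ?thesis .
  qed
  have "a + b \<le> c powr p' * H1 powr (p' / p) + c powr p' * H2 powr (p' / p)"
    by (intro add_mono raise a b nonneg)
  also have "\<dots> = c powr p' * (H1 powr (p' / p) + H2 powr (p' / p))" by (simp add: distrib_left)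
  also have "\<dots> \<le> c powr p' * (H1 + H2) powr (p' / p)"
    using p nonneg by (intro mult_left_mono powr_superadditive) auto
  finally have "(a + b) powr (1 / p') \<le> (c powr p' * (H1 + H2) powr (p' / p)) powr (1 / p')"
    using nonneg p'0 by (intro powr_mono2) auto
  also have "\<dots> = c * (H1 + H2) powr (1 / p)"
    using nonneg p p'0 by (simp add: powr_mult powr_powr)
  finally show ?thesis .
qed

theorem theorem9:
  fixes f :: "real ^ 'n \<Rightarrow> real" and K :: "(real ^ 'n) set" and p :: real
  defines "n \<equiv> CARD('n)"
  defines "p' \<equiv> real n * p / (real n - p)"
  assumes "1 < p" and "p < real n"
    and "piecewise_affine f" and "\<exists>x. f x \<noteq> 0"
    and "is_Lp_polytope_of p f K"
  shows "unit_ball_vol (real n) powr (1 / real n) * sobolev_const n p *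
           measure lebesgue K powr ((real n - p) / (real n * p))
         \<ge> (LINT x|lebesgue. \<bar>f x\<bar> powr p') powr (1 / p')"
proof -
  let ?h = "support_fun K" and ?V = "measure lebesgue K"
  have dim: "DIM(real ^ 'n) = n" by (simp add: n_def)
  have p: "1 < p" "p < real DIM(real ^ 'n)" using assms by (simp_all add: dim)
  have n2: "2 \<le> DIM(real ^ 'n)" using p by simp
  have p'_def': "p' = real DIM(real ^ 'n) * p / (real DIM(real ^ 'n) - p)" by (simp add: p'_def n_def)
  have n0: "0 < real n" using assms(3,4) by simp
  have pp': "p \<le> p'"
  proof -
    have "p * (real n - p) \<le> p * real n" using assms(3) by simp
    then show ?thesis using assms(3,4) by (simp add: p'_def pos_le_divide_eq mult.commute)
  qed
  have p'0: "0 < p'" using pp' assms(3) by simp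
  have K: "origin_polytope K" using assms(7) by (simp add: is_Lp_polytope_of_def)
  obtain \<nu> where \<nu>: "continuous_on UNIV \<nu>" "\<And>y. 0 \<le> \<nu> y" "pos_homogeneous \<nu>"
    "{y. \<nu> y \<le> 1} = K" "\<And>z y. z \<bullet> y \<le> ?h z * \<nu> y"
    using origin_polytope_gauge[OF K] by blast
  note hc = continuous_support_fun[OF K] and h0 = support_fun_nonneg[OF K]
  obtain g N M where grd: "ae_gradient f g N"
    and M: "0 < M" "\<And>x. x \<notin> cube M \<Longrightarrow> f x = 0 \<and> g x = 0" and fc: "continuous_on UNIV f"
    by (rule piecewise_affine_structure[OF assms(5)]) (rule that; assumption)
  note N = ae_gradientD(1,2)[OF grd] and g1 = ae_gradientD(4)[OF grd]
  obtain B where B: "\<And>x. norm (g x) \<le> B" using ae_gradientD(5)[OF grd] by blast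
  have f0: "\<And>x. x \<notin> cube M \<Longrightarrow> f x = 0" using M(2) by blast
  have V: "emeasure lborel {y. \<nu> y \<le> 1} = ennreal ?V" "0 < ?V"
    using measure_origin_polytope_pos[OF K] \<nu>(4) by auto
  define c where "c = unit_ball_vol (real n) powr (1 / real n) * sobolev_const n p * ?V powr (- (1 / real n))"
  define H1 where "H1 = (LINT x|lborel. (if 0 < f x then ?h (- g x) else 0) powr p)"
  define H2 where "H2 = (LINT x|lborel. (if 0 < - f x then ?h (- g x) else 0) powr p)"
  have pos: "(LINT x|lborel. ppow p' (f x)) powr (1 / p') \<le> c * H1 powr (1 / p)"
    unfolding c_def H1_def
    using sobolev_positive_part[OF p p'_def' \<nu>(1-3) V hc h0 \<nu>(5) grd fc f0 M(1)] by (simp add: n_def)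
  \<comment> \<open>The reflected norm has a unit ball of the same volume, and \<open>h\<close> is reflected along with it, so that
    it is again evaluated at \<open>- g\<close>.\<close>
  have neg: "(LINT x|lborel. ppow p' (- f x)) powr (1 / p') \<le> c * H2 powr (1 / p)"
  proof -
    let ?\<nu> = "\<lambda>y. \<nu> (- y)" and ?h' = "\<lambda>z. ?h (- z)"
    have 1: "continuous_on UNIV ?\<nu>" "continuous_on UNIV ?h'"
      by (rule continuous_on_compose2[OF \<nu>(1)] continuous_on_compose2[OF hc], auto intro!: continuous_intros)+
    have 2: "pos_homogeneous ?\<nu>" using \<nu>(3) unfolding pos_homogeneous_def by (simp flip: scaleR_minus_right)
    have 3: "z \<bullet> y \<le> ?h' z * ?\<nu> y" for z y using \<nu>(5)[of "- z" "- y"] by simp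
    have "{y. ?\<nu> y \<le> 1} = (\<lambda>x. (-1) *\<^sub>R x + 0) ` {y. \<nu> y \<le> 1}"
    proof (intro equalityI subsetI)
      fix y assume "y \<in> {y. ?\<nu> y \<le> 1}"
      then show "y \<in> (\<lambda>x. (-1) *\<^sub>R x + 0) ` {y. \<nu> y \<le> 1}"
        by (intro image_eqI[of _ _ "- y"]) auto
    qed auto
    then have "emeasure lebesgue {y. ?\<nu> y \<le> 1} = emeasure lebesgue {y. \<nu> y \<le> 1}"
      using emeasure_lebesgue_affine[of "-1" 0 "{y. \<nu> y \<le> 1}"] by simp
    moreover have "{y. \<nu> y \<le> 1} \<in> sets borel" "{y. ?\<nu> y \<le> 1} \<in> sets borel"
      using \<nu>(1) 1(1) by (auto intro!: borel_closed closed_Collect_le continuous_intros)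
    ultimately have 4: "emeasure lborel {y. ?\<nu> y \<le> 1} = ennreal ?V" using V(1) by simp
    have 5: "continuous_on UNIV (\<lambda>x. - f x)" by (intro continuous_intros fc)
    show ?thesis
      unfolding c_def H2_def
      using sobolev_positive_part[OF p p'_def' 1(1) _ 2 4 V(2) 1(2) _ 3 ae_gradient_uminus[OF grd] 5 _ M(1)]
        \<nu>(2) h0 f0 by (simp add: n_def cong: if_cong)
  qed
  have iF: "integrable lborel (\<lambda>x. ppow p' (\<sigma> * f x))" for \<sigma>
  proof -
    have "continuous_on UNIV (\<lambda>x. ppow p' (\<sigma> * f x))" by (intro continuous_ppow p'0 continuous_intros fc)
    from integrable_cube_continuous[OF this, of M]
    have "integrable lborel (\<lambda>x. indicator (cube M) x * ppow p' (\<sigma> * f x))" .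
    moreover have "indicator (cube M) x * ppow p' (\<sigma> * f x) = ppow p' (\<sigma> * f x)" for x
      using f0[of x] by (auto simp: indicator_def)
    ultimately show ?thesis by (simp only:)
  qed
  have "(LINT x|lebesgue. \<bar>f x\<bar> powr p') = (LINT x|lborel. \<bar>f x\<bar> powr p')"
  proof (rule integral_completion)
    have [measurable]: "f \<in> borel_measurable borel" using fc by (rule borel_measurable_continuous_onI)
    show "(\<lambda>x. \<bar>f x\<bar> powr p') \<in> borel_measurable lborel" by measurable
  qed
  also have "\<dots> = (LINT x|lborel. ppow p' (f x) + ppow p' (- f x))"
    by (intro Bochner_Integration.integral_cong) (auto simp: ppow_def abs_if max_def)
  also have "\<dots> = (LINT x|lborel. ppow p' (f x)) + (LINT x|lborel. ppow p' (- f x))"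
    using iF[of 1] iF[of "-1"] by (intro Bochner_Integration.integral_add) auto
  finally have total: "(LINT x|lebesgue. \<bar>f x\<bar> powr p') = (LINT x|lborel. ppow p' (f x)) + (LINT x|lborel. ppow p' (- f x))" .
  have c0: "0 \<le> c"
    unfolding c_def sobolev_const_def by (intro mult_nonneg_nonneg) auto
  have H0: "0 \<le> H1" "0 \<le> H2" unfolding H1_def H2_def by (auto intro!: integral_nonneg_AE)
  \<comment> \<open>The two energies live on the disjoint sets where \<open>f\<close> is positive and where it is negative.\<close>
  have energy: "H1 + H2 \<le> ?V"
  proof -
    have [measurable]: "?h \<in> borel_measurable borel" "g \<in> borel_measurable borel" "f \<in> borel_measurable borel"
      using hc g1 fc by (auto intro: borel_measurable_continuous_onI)
    have "bounded (?h ` cball 0 B)"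
      by (intro compact_imp_bounded compact_continuous_image continuous_on_subset[OF hc]) auto
    then obtain D where D: "\<And>z. z \<in> cball 0 B \<Longrightarrow> \<bar>?h z\<bar> \<le> D" unfolding bounded_iff real_norm_def by blast
    have hD: "?h (- g x) \<le> D" for x using D[of "- g x"] B[of x] by auto
    have h00: "?h 0 = 0" using support_fun_scaleR[OF K, of 0 0] by simp
    have int: "integrable lborel (\<lambda>x. (if Q x then ?h (- g x) else 0) powr p)"
      if [measurable]: "Measurable.pred borel Q" for Q
    proof -
      have eq: "(if Q x then ?h (- g x) else 0) powr p = indicator (cube M) x * (if Q x then ?h (- g x) else 0) powr p" for x
        using M(2)[of x] h00 by (auto simp: indicator_def)
      show ?thesis
        by (subst eq, rule integrable_cube[where C="D powr p"]) (use hD h0 p in \<open>auto intro!: powr_mono2\<close>)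
    qed
    have "H1 + H2 = (LINT x|lborel. (if 0 < f x then ?h (- g x) else 0) powr p + (if 0 < - f x then ?h (- g x) else 0) powr p)"
      unfolding H1_def H2_def by (intro Bochner_Integration.integral_add[symmetric] int) measurable
    also have "\<dots> \<le> (LINT x|lborel. ?h (- g x) powr p)"
    proof (rule integral_mono)
      show "integrable lborel (\<lambda>x. ?h (- g x) powr p)" using int[of "\<lambda>_. True"] by simp
    qed (auto intro!: Bochner_Integration.integrable_add int)
    also have "\<dots> = (LINT x|lebesgue. ?h (- g x) powr p)"
      by (rule integral_completion[symmetric]) measurable
    also have "\<dots> = (LINT x|lebesgue. ?h (- grad f x) powr p)"
    proof -
      have "AE x in lborel. x \<notin> N" using N(1) by (rule AE_not_in)
      then have "AE x in lborel. ?h (- g x) powr p = ?h (- grad f x) powr p"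
        by eventually_elim (simp add: grad_eq[OF N(2)])
      then have ae: "AE x in lebesgue. ?h (- g x) powr p = ?h (- grad f x) powr p" by (rule AE_completion)
      have m: "(\<lambda>x. ?h (- g x) powr p) \<in> borel_measurable lebesgue"
        by (rule measurable_completion) measurable
      show ?thesis by (rule integral_cong_AE[OF m borel_measurable_AE[OF m ae] ae])
    qed
    also have "\<dots> \<le> ?V" by (rule Lp_polytope_energy_le[OF assms(7) n2])
    finally show ?thesis .
  qed
  have "(LINT x|lebesgue. \<bar>f x\<bar> powr p') powr (1 / p') \<le> c * (H1 + H2) powr (1 / p)"
    unfolding total using pos neg p pp' c0 H0
    by (intro combine_sign_parts) (auto intro!: integral_nonneg_AE)
  also have "\<dots> \<le> c * ?V powr (1 / p)"
    using energy c0 H0 p by (intro mult_left_mono powr_mono2) auto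
  also have "\<dots> = unit_ball_vol (real n) powr (1 / real n) * sobolev_const n p * (?V powr (- (1 / real n)) * ?V powr (1 / p))"
    by (simp add: c_def)
  also have "?V powr (- (1 / real n)) * ?V powr (1 / p) = ?V powr ((real n - p) / (real n * p))"
  proof -
    have "- (1 / real n) + 1 / p = (real n - p) / (real n * p)"
      using n0 p by (simp add: field_simps)
    then show ?thesis by (simp flip: powr_add)
  qed
  finally show ?thesis .
qed

end
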